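(* Consider the Gumbel-max watermark model of the context with $\varepsilon_n\asymp n^{-p}$, suppose Assumption (A) holds, and suppose that almost surely $\mathbf{P}_t\in\mathcal{P}_{\Delta_n}$ for all $1\le t\le n$, where $\Delta_n\asymp n^{-q}$, with constants $p,q\ge0$ satisfying $q+2p<1$. Fix $\delta>0$ and any sequence $c_n^+$ with $0\le c_n^+\le\Delta_n$. Then the Higher Criticism test that rejects $H_0$ if and only if $\mathrm{HC}_n^+\ge\sqrt{2(1+\delta)\log\log n}$ has Type I error plus Type II error tending to $0$ as $n\to\infty$.
   Context: Notation: $a_n \asymp b_n$ means there are constants $C_1,C_2>0$ with $C_1 a_n\le b_n\le C_2 a_n$ for all $n$. $\mathcal{W}$ is a finite vocabulary; $\mathcal{P}_\Delta=\{\mathbf{P}:\max_w P_w\le 1-\Delta\}$. For a probability vector $\mathbf{P}$ on $\mathcal{W}$, $\mu_{1,\mathbf{P}}$ is the distribution on $[0,1]$ with CDF $F_{1,\mathbf{P}}(r)=\sum_w P_w r^{1/P_w}$; $\mu_0=U(0,1)$. Watermark model: for $t=1,\dots,n$ a random next-token distribution $\mathbf{P}_t$ is produced, $\xi_t=(U_{t,w})_w$ has i.i.d. $U(0,1)$ entries, the decoder is $\mathcal{S}(\mathbf{P},\xi)=\arg\max_w\frac{\log U_w}{P_w}$, the observed token is $w_t$ and $Y_t=U_{t,w_t}$. Let $\mathcal{F}_{t-1}=\sigma(\{w_j,\xi_j,\mathbf{P}_{j+1}\}_{j=1}^{t-1})$. Assumption (A): (a) $\xi_1,\dots,\xi_n$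 are i.i.d. and $\xi_t$ is independent of $\mathcal{F}_{t-1}$; (b) with probability $\varepsilon_n$, $w_t=\mathcal{S}(\mathbf{P}_t,\xi_t)$; otherwise $w_t$ is drawn from $\mathbf{P}_t$ and, conditionally on $\mathcal{F}_{t-1}$, is independent of $\xi_t$. $H_1^{\mathrm{mix}}$: law of $Y_{1:n}$ under this model; $H_0$: $Y_1,\dots,Y_n$ i.i.d. $U(0,1)$. HC statistic: $\mathrm{p}_t=1-Y_t$, sorted $\mathrm{p}_{(1)}<\dots<\mathrm{p}_{(n)}$, $\mathrm{p}_{(n+1)}=1$, $\mathrm{HC}_{n,t}=\sqrt n\,\frac{t/n-\mathrm{p}_{(t)}}{\sqrt{\mathrm{p}_{(t)}(1-\mathrm{p}_{(t)})}}$, and $\mathrm{HC}_n^+=\sup_{t\in\{1,\dots,n\}:\mathrm{p}_{(t+1)}\ge c_n^+}\mathrm{HC}_{n,t}$. *)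

theory Defs
  imports "HOL-Probability.Probability"
begin

definition asymp_equiv_seq :: "(nat \<Rightarrow> real) \<Rightarrow> (nat \<Rightarrow> real) \<Rightarrow> bool" where
  "asymp_equiv_seq a b \<longleftrightarrow>
     (\<exists>C1>0. \<exists>C2>0. \<forall>n\<ge>1. C1 * a n \<le> b n \<and> b n \<le> C2 * a n)"

definition prob_vec :: "('w::finite \<Rightarrow> real) \<Rightarrow> bool" where
  "prob_vec P \<longleftrightarrow> (\<forall>v. 0 \<le> P v) \<and> (\<Sum>v\<in>UNIV. P v) = 1"

definition P_Delta :: "real \<Rightarrow> ('w::finite \<Rightarrow> real) set" where
  "P_Delta D = {P. prob_vec P \<and> (\<forall>v. P v \<le> 1 - D)}"

text \<open>argmax over w of log U_w / P_w; tokens with P_w = 0 have value -infinity, so the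
  argmax ranges over the support of P.\<close>
definition gumbel_dec :: "('w::finite \<Rightarrow> real) \<Rightarrow> ('w \<Rightarrow> real) \<Rightarrow> 'w" where
  "gumbel_dec P U = (ARG_MAX (\<lambda>v. ln (U v) / P v) v. 0 < P v)"

definition vecM :: "('w::finite \<Rightarrow> real) measure" where
  "vecM = PiM UNIV (\<lambda>_. borel)"

definition unif01 :: "real measure" where
  "unif01 = uniform_measure lborel {0..1}"

definition unifvec :: "('w::finite \<Rightarrow> real) measure" where
  "unifvec = PiM UNIV (\<lambda>_. unif01)"

text \<open>F_{t-1} generated by P_1 and {w_j, xi_j, P_{j+1}} for j = 1..t-1, i.e. by
  w_j, xi_j (j < t) and P_j (j \<le> t).\<close>
definition hist_sets ::
  "'a measure \<Rightarrow> (nat \<Rightarrow> 'a \<Rightarrow> 'w::finite \<Rightarrow> real) \<Rightarrow> (nat \<Rightarrow> 'a \<Rightarrow> 'w \<Rightarrow> real)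
     \<Rightarrow> (nat \<Rightarrow> 'a \<Rightarrow> 'w) \<Rightarrow> nat \<Rightarrow> 'a set set" where
  "hist_sets M Pt xi w t = sigma_sets (space M)
     ((\<Union>j\<in>{1..<t}. {w j -` B \<inter> space M | B. True}
                   \<union> {xi j -` C \<inter> space M | C. C \<in> sets vecM})
      \<union> (\<Union>j\<in>{1..t}. {Pt j -` C \<inter> space M | C. C \<in> sets vecM}))"

definition gumbel_model ::
  "'a measure \<Rightarrow> real \<Rightarrow> (nat \<Rightarrow> 'a \<Rightarrow> 'w::finite \<Rightarrow> real) \<Rightarrow> (nat \<Rightarrow> 'a \<Rightarrow> 'w \<Rightarrow> real)
     \<Rightarrow> (nat \<Rightarrow> 'a \<Rightarrow> 'w) \<Rightarrow> nat \<Rightarrow> bool" where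
  "gumbel_model M eps Pt xi w n \<longleftrightarrow>
     prob_space M \<and>
     (\<forall>t\<in>{1..n}. Pt t \<in> M \<rightarrow>\<^sub>M vecM \<and> xi t \<in> M \<rightarrow>\<^sub>M vecM
                   \<and> w t \<in> M \<rightarrow>\<^sub>M count_space UNIV) \<and>
     (AE \<omega> in M. \<forall>t\<in>{1..n}. prob_vec (Pt t \<omega>)) \<and>
     \<comment> \<open>(a): xi_1..xi_n i.i.d. with i.i.d. U(0,1) entries, xi_t independent of F_{t-1}\<close>
     prob_space.indep_vars M (\<lambda>_. vecM) xi {1..n} \<and>
     (\<forall>t\<in>{1..n}. distr M vecM (xi t) = unifvec) \<and>
     (\<forall>t\<in>{1..n}. \<forall>A\<in>hist_sets M Pt xi w t. \<forall>C\<in>sets vecM.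
        measure M (A \<inter> xi t -` C) = measure M A * measure M (xi t -` C \<inter> space M)) \<and>
     \<comment> \<open>(b): conditionally on F_{t-1}, (xi_t, w_t) has the mixture law:
         with prob. eps, w_t = S(P_t, xi_t); otherwise w_t ~ P_t independent of xi_t\<close>
     (\<forall>t\<in>{1..n}. \<forall>A\<in>hist_sets M Pt xi w t. \<forall>C\<in>sets vecM. \<forall>v.
        measure M (A \<inter> xi t -` C \<inter> {\<omega>. w t \<omega> = v})
          = eps * measure M (A \<inter> xi t -` C \<inter> {\<omega>. gumbel_dec (Pt t \<omega>) (xi t \<omega>) = v})
            + (1 - eps) * set_lebesgue_integral M A (\<lambda>\<omega>. Pt t \<omega> v)
                        * measure M (xi t -` C \<inter> space M))"

definition pvals_sorted :: "nat \<Rightarrow> (nat \<Rightarrow> real) \<Rightarrow> real list" where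
  "pvals_sorted n y = sort (map (\<lambda>t. 1 - y t) [1..<n+1])"

definition porder :: "nat \<Rightarrow> (nat \<Rightarrow> real) \<Rightarrow> nat \<Rightarrow> real" where
  "porder n y t = (if t \<le> n then pvals_sorted n y ! (t - 1) else 1)"

definition HC :: "nat \<Rightarrow> (nat \<Rightarrow> real) \<Rightarrow> nat \<Rightarrow> real" where
  "HC n y t = sqrt (real n) * (real t / real n - porder n y t)
                / sqrt (porder n y t * (1 - porder n y t))"

text \<open>HC_n^+ as an extended real (supremum of the empty set is -infinity).\<close>
definition HC_plus :: "real \<Rightarrow> nat \<Rightarrow> (nat \<Rightarrow> real) \<Rightarrow> ereal" where
  "HC_plus c n y = Sup {ereal (HC n y t) | t. t \<in> {1..n} \<and> c \<le> porder n y (t + 1)}"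

definition HC_reject :: "real \<Rightarrow> real \<Rightarrow> nat \<Rightarrow> (nat \<Rightarrow> real) \<Rightarrow> bool" where
  "HC_reject \<delta> c n y \<longleftrightarrow> ereal (sqrt (2 * (1 + \<delta>) * ln (ln (real n)))) \<le> HC_plus c n y"

definition null_law :: "nat \<Rightarrow> (nat \<Rightarrow> real) measure" where
  "null_law n = PiM {1..n} (\<lambda>_. unif01)"

definition type_I_error :: "real \<Rightarrow> real \<Rightarrow> nat \<Rightarrow> real" where
  "type_I_error \<delta> c n = measure (null_law n) {y \<in> space (null_law n). HC_reject \<delta> c n y}"

definition type_II_error ::
  "'a measure \<Rightarrow> (nat \<Rightarrow> 'a \<Rightarrow> 'w \<Rightarrow> real) \<Rightarrow> (nat \<Rightarrow> 'a \<Rightarrow> 'w) \<Rightarrow> real \<Rightarrow> real \<Rightarrow> nat \<Rightarrow> real" where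
  "type_II_error M xi w \<delta> c n =
     measure M {\<omega> \<in> space M. \<not> HC_reject \<delta> c n (\<lambda>t. xi t \<omega> (w t \<omega>))}"

end

theory Submission
  imports Defs "HOL-Real_Asymp.Real_Asymp"
begin

text \<open>
  Under the null hypothesis, rejection forces the empirical count \<open>N x\<close> of p-values up to \<open>x\<close> to
  exceed \<open>n x + lam * sqrt (n x (1 - x))\<close> at some \<open>x\<close>, with \<open>lam\<close> the critical value.  Split
  the range of \<open>x\<close> (and of \<open>1 - x\<close> for \<open>x > 1/2\<close>) into geometric blocks.  A maximal inequality
  for the reverse martingale \<open>N x / x\<close> bounds each block by a Chernoff bound at its left end.
  About \<open>ln n\<close> blocks have Gaussian exponent \<open>lam\<^sup>2 / 2 = (1 + \<delta>) ln (ln n)\<close> up to a factor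
  arbitrarily close to 1, the remaining \<open>O(ln lam)\<close> blocks have probability at most
  \<open>exp (- sqrt lam / 16)\<close>, and \<open>x < 1 / (lam n)\<close> is handled by Markov's inequality.

  Under the alternative, look at the single level \<open>x = \<Delta>\<close>.  Whatever the past, the p-value at
  time \<open>t\<close> is at most \<open>\<Delta>\<close> with probability at least \<open>\<Delta> + \<epsilon> \<kappa> \<Delta>\<close>, where \<open>\<kappa>\<close> depends only on the
  vocabulary size: some token has probability in the interval from \<open>\<Delta> / |W|\<close> to \<open>1/2\<close>, and it
  contributes the gain.  A Chernoff bound makes the type II error at most
  \<open>exp (- n \<epsilon>\<^sup>2 \<Delta> \<kappa>\<^sup>2 / 16)\<close>, and \<open>n \<epsilon>\<^sup>2 \<Delta>\<close> grows like \<open>n\<close> to the power \<open>1 - 2 p - q\<close>.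
\<close>

subsection \<open>A maximal inequality for counts\<close>

text \<open>The critical value leaves no room for a union bound over ranks:
  \<open>exp (- lam^2 / 2)\<close> is \<open>ln n\<close> to the power
  \<open>-(1 + \<delta>)\<close>, so only about \<open>ln n\<close> events can be afforded at that
  price, and the exponent must lose less than a factor \<open>1 + \<delta>\<close>. Hence whole
  blocks are treated at once, with a block ratio \<theta> strictly between 1 and
  \<open>1 + \<delta>\<close>. The two ends are not symmetric: an excess of p-values near 1 is a
  shortage in the complement, whose lower tail is Gaussian without restriction, and for large
  \<open>n\<close> no rank is significant at a level within \<open>1 / n\<close> of 1.

  Under the alternative the token distributions are random and depend on the past, so only a uniform
  conditional lower bound is available.\<close>

text \<open>Since \<open>f\<close> cannot see where inside \<open>S\<close> a coordinate lies,
  \<open>h'\<close> and \<open>h\<close> need only be compared on average over \<open>S\<close>, but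
  pointwise outside it. Coordinates are exchanged one at a time. This carries out Jensen's
  inequality given an event without conditional expectations.\<close>

lemma nn_integral_PiM_mono_lumped:
  fixes \<mu> :: "'b measure" and h h' :: "'b \<Rightarrow> ennreal"
  assumes "prob_space \<mu>" "finite J" and S: "S \<in> sets \<mu>"
    and h[measurable]: "h \<in> borel_measurable \<mu>" and h'[measurable]: "h' \<in> borel_measurable \<mu>"
    and out: "\<And>z. z \<in> space \<mu> \<Longrightarrow> z \<notin> S \<Longrightarrow> h' z \<le> h z"
    and ins: "(\<integral>\<^sup>+z. h' z * indicator S z \<partial>\<mu>) \<le> (\<integral>\<^sup>+z. h z * indicator S z \<partial>\<mu>)"
    and "f \<in> borel_measurable (PiM J (\<lambda>_. \<mu>))"
    and "\<And>y z. y \<in> space (PiM J (\<lambda>_. \<mu>)) \<Longrightarrow> z \<in> space (PiM J (\<lambda>_. \<mu>)) \<Longrightarrow>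
           (\<And>i. i \<in> J \<Longrightarrow> y i = z i \<or> y i \<in> S \<and> z i \<in> S) \<Longrightarrow> f y = f z"
  shows "(\<integral>\<^sup>+y. f y * (\<Prod>i\<in>J. h' (y i)) \<partial>PiM J (\<lambda>_. \<mu>))
           \<le> (\<integral>\<^sup>+y. f y * (\<Prod>i\<in>J. h (y i)) \<partial>PiM J (\<lambda>_. \<mu>))"
  using assms(2,8,9)
proof (induction J arbitrary: f rule: finite_induct)
  case empty
  then show ?case by simp
next
  case (insert i J)
  interpret prob_space \<mu> by fact
  interpret product_sigma_finite "\<lambda>_. \<mu>" by standard
  note [measurable] = insert.prems(1)
  let ?P = "PiM J (\<lambda>_. \<mu>)"
  interpret P: prob_space ?P by (intro prob_space_PiM prob_space_axioms)
  have upd: "y(i := z) \<in> space (PiM (insert i J) (\<lambda>_. \<mu>))" if "y \<in> space ?P" "z \<in> space \<mu>" for y z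
    using that by (auto simp: space_PiM PiE_iff extensional_def)
  have meas: "(\<lambda>y. f (y(i := z))) \<in> borel_measurable ?P" if "z \<in> space \<mu>" for z
    using that insert.hyps by measurable
  have prod_upd: "(\<Prod>j\<in>insert i J. g ((y(i := z)) j)) = g z * (\<Prod>j\<in>J. g (y j))"
    for g :: "'b \<Rightarrow> ennreal" and y z
  proof -
    have "(\<Prod>j\<in>J. g ((y(i := z)) j)) = (\<Prod>j\<in>J. g (y j))"
      using insert.hyps by (intro prod.cong) auto
    then show ?thesis using insert.hyps by simp
  qed
  define G where "G z = (\<integral>\<^sup>+y. f (y(i := z)) * (\<Prod>j\<in>J. h (y j)) \<partial>?P)" for z
  have [measurable]: "G \<in> borel_measurable \<mu>"
    unfolding G_def using insert.hyps by measurable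
  have split: "(\<integral>\<^sup>+y. f y * (\<Prod>j\<in>insert i J. g (y j)) \<partial>PiM (insert i J) (\<lambda>_. \<mu>))
      = (\<integral>\<^sup>+z. g z * (\<integral>\<^sup>+y. f (y(i := z)) * (\<Prod>j\<in>J. g (y j)) \<partial>?P) \<partial>\<mu>)"
    if [measurable]: "g \<in> borel_measurable \<mu>" for g :: "'b \<Rightarrow> ennreal"
  proof -
    have "(\<integral>\<^sup>+y. f y * (\<Prod>j\<in>insert i J. g (y j)) \<partial>PiM (insert i J) (\<lambda>_. \<mu>))
      = (\<integral>\<^sup>+z. \<integral>\<^sup>+y. f (y(i := z)) * (\<Prod>j\<in>insert i J. g ((y(i := z)) j)) \<partial>?P \<partial>\<mu>)"
      using insert.hyps by (intro product_nn_integral_insert_rev) auto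
    also have "\<dots> = (\<integral>\<^sup>+z. g z * (\<integral>\<^sup>+y. f (y(i := z)) * (\<Prod>j\<in>J. g (y j)) \<partial>?P) \<partial>\<mu>)"
      unfolding prod_upd
    proof (intro nn_integral_cong)
      fix z assume z: "z \<in> space \<mu>"
      note [measurable] = meas[OF z]
      show "(\<integral>\<^sup>+y. f (y(i := z)) * (g z * (\<Prod>j\<in>J. g (y j))) \<partial>?P)
          = g z * (\<integral>\<^sup>+y. f (y(i := z)) * (\<Prod>j\<in>J. g (y j)) \<partial>?P)"
        by (subst nn_integral_cmult[symmetric]) (auto simp: mult_ac)
    qed
    finally show ?thesis .
  qed
  \<comment> \<open>Hence \<open>G\<close> factors out of integrals over \<open>S\<close>, and
    \<open>ins\<close> becomes applicable.\<close>
  have const: "G z = G z'" if "z \<in> S" "z' \<in> S" for z z'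
    unfolding G_def
  proof (intro nn_integral_cong arg_cong2[where f="(*)"] refl)
    fix y assume "y \<in> space ?P"
    then show "f (y(i := z)) = f (y(i := z'))"
      using that sets.sets_into_space[OF S] by (intro insert.prems(2) upd) auto
  qed
  have "(\<integral>\<^sup>+y. f y * (\<Prod>j\<in>insert i J. h' (y j)) \<partial>PiM (insert i J) (\<lambda>_. \<mu>))
      \<le> (\<integral>\<^sup>+z. h' z * G z \<partial>\<mu>)"
    unfolding split[OF h'] G_def
  proof (rule nn_integral_mono, rule mult_left_mono)
    fix z assume z: "z \<in> space \<mu>"
    show "(\<integral>\<^sup>+y. f (y(i := z)) * (\<Prod>j\<in>J. h' (y j)) \<partial>?P) \<le> (\<integral>\<^sup>+y. f (y(i := z)) * (\<Prod>j\<in>J. h (y j)) \<partial>?P)"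
    proof (rule insert.IH[OF meas[OF z]])
      fix y y' assume "y \<in> space ?P" "y' \<in> space ?P" "\<And>j. j \<in> J \<Longrightarrow> y j = y' j \<or> y j \<in> S \<and> y' j \<in> S"
      then show "f (y(i := z)) = f (y'(i := z))"
        using z by (intro insert.prems(2) upd) auto
    qed
  qed auto
  also have "\<dots> = (\<integral>\<^sup>+z. h' z * G z * indicator S z \<partial>\<mu>) + (\<integral>\<^sup>+z. h' z * G z * indicator (space \<mu> - S) z \<partial>\<mu>)"
    using S by (subst nn_integral_add[symmetric]) (auto intro!: nn_integral_cong simp: indicator_def)
  also have "\<dots> \<le> (\<integral>\<^sup>+z. h z * G z * indicator S z \<partial>\<mu>) + (\<integral>\<^sup>+z. h z * G z * indicator (space \<mu> - S) z \<partial>\<mu>)"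
  proof (rule add_mono)
    show "(\<integral>\<^sup>+z. h' z * G z * indicator (space \<mu> - S) z \<partial>\<mu>) \<le> (\<integral>\<^sup>+z. h z * G z * indicator (space \<mu> - S) z \<partial>\<mu>)"
      by (intro nn_integral_mono) (auto simp: indicator_def intro!: mult_right_mono out)
    show "(\<integral>\<^sup>+z. h' z * G z * indicator S z \<partial>\<mu>) \<le> (\<integral>\<^sup>+z. h z * G z * indicator S z \<partial>\<mu>)"
    proof (cases "S = {}")
      case False
      then obtain z0 where z0: "z0 \<in> S" by auto
      have "(\<integral>\<^sup>+z. g z * G z * indicator S z \<partial>\<mu>) = G z0 * (\<integral>\<^sup>+z. g z * indicator S z \<partial>\<mu>)"
        if [measurable]: "g \<in> borel_measurable \<mu>" for g
        using S const[OF _ z0]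
        by (subst nn_integral_cmult[symmetric]) (auto intro!: nn_integral_cong simp: indicator_def mult_ac)
      then show ?thesis using h h' ins by (simp add: mult_left_mono)
    qed simp
  qed
  also have "\<dots> = (\<integral>\<^sup>+z. h z * G z \<partial>\<mu>)"
    using S by (subst nn_integral_add[symmetric]) (auto intro!: nn_integral_cong simp: indicator_def)
  also have "\<dots> = (\<integral>\<^sup>+y. f y * (\<Prod>j\<in>insert i J. h (y j)) \<partial>PiM (insert i J) (\<lambda>_. \<mu>))"
    unfolding split[OF h] G_def ..
  finally show ?case .
qed


lemma exp_mult_le_interpolate:
  fixes s r :: real
  assumes "0 \<le> r" "r \<le> 1"
  shows "exp (s * r) \<le> 1 + r * (exp s - 1)"
proof -
  have "exp ((1 - r) * 0 + r * s) \<le> (1 - r) * exp 0 + r * exp s"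
    using convex_onD[OF exp_convex, of r 0 s] assms by (simp add: algebra_simps)
  then show ?thesis by (simp add: algebra_simps)
qed

text \<open>
  A maximal inequality for the reverse martingale \<open>x \<mapsto> N x / x\<close>, where \<open>N x\<close> counts the
  coordinates in \<open>S x\<close>.  Decompose according to the last (largest) \<open>x\<close> at which the boundary is
  crossed: that event does not depend on how the points in \<open>S x\<close> are distributed, so given it
  \<open>N a\<close> is binomial with mean \<open>N x * a / x\<close>, and Jensen's inequality applies coordinatewise.
\<close>
lemma maximal_count_bound:
  fixes \<mu> :: "'b measure" and S :: "real \<Rightarrow> 'b set" and \<beta> :: "real \<Rightarrow> real" and I :: "'i set" and s :: real
  assumes "prob_space \<mu>" "finite I" "finite G" "0 < a"
    and S: "\<And>x. x \<in> insert a G \<Longrightarrow> S x \<in> sets \<mu> \<and> measure \<mu> (S x) = x"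
    and mono: "\<And>x x'. x \<in> insert a G \<Longrightarrow> x' \<in> G \<Longrightarrow> x \<le> x' \<Longrightarrow> S x \<subseteq> S x'"
    and B: "\<And>x. x \<in> G \<Longrightarrow> a \<le> x \<and> B \<le> \<beta> x * (a / x)"
  shows "measure (PiM I (\<lambda>_. \<mu>))
           {y \<in> space (PiM I (\<lambda>_. \<mu>)). \<exists>x\<in>G. \<beta> x \<le> s * card {i\<in>I. y i \<in> S x}}
         \<le> exp (card I * (a * (exp s - 1)) - B)"
proof -
  interpret prob_space \<mu> by fact
  interpret product_sigma_finite "\<lambda>_. \<mu>" by standard
  let ?P = "PiM I (\<lambda>_. \<mu>)"
  interpret P: prob_space ?P by (intro prob_space_PiM prob_space_axioms)
  define N where "N x y = real (card {i\<in>I. y i \<in> S x})" for x and y :: "'i \<Rightarrow> 'b"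
  have N_sum: "N x y = (\<Sum>i\<in>I. indicator (S x) (y i))" for x y
    using \<open>finite I\<close> by (simp add: N_def indicator_def sum.If_cases Int_def)
  have Sm: "S x \<in> sets \<mu>" if "x \<in> insert a G" for x using S[OF that] by simp
  have Nm: "N x \<in> borel_measurable ?P" if "x \<in> insert a G" for x
  proof -
    note [measurable] = Sm[OF that]
    show ?thesis unfolding N_sum by measurable
  qed
  define A where "A x = {y \<in> space ?P. \<beta> x \<le> s * N x y \<and> (\<forall>x'\<in>G. x < x' \<longrightarrow> \<not> \<beta> x' \<le> s * N x' y)}" for x
  have Am: "A x \<in> sets ?P" if "x \<in> G" for x
  proof -
    have "A x = {y \<in> space ?P. \<beta> x \<le> s * N x y} \<inter> {y \<in> space ?P. \<forall>x'\<in>{x'\<in>G. x < x'}. \<not> \<beta> x' \<le> s * N x' y}"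
      by (auto simp: A_def)
    also have "\<dots> \<in> sets ?P"
    proof (intro sets.Int)
      show "{y \<in> space ?P. \<beta> x \<le> s * N x y} \<in> sets ?P" by (intro borel_measurable_le borel_measurable_const borel_measurable_times Nm) (use that in auto)
      have "{y \<in> space ?P. \<not> \<beta> x' \<le> s * N x' y} \<in> sets ?P" if "x' \<in> G" for x'
        by (intro sets.sets_Collect_neg borel_measurable_le borel_measurable_const borel_measurable_times Nm)
          (use that in auto)
      then show "{y \<in> space ?P. \<forall>x'\<in>{x'\<in>G. x < x'}. \<not> \<beta> x' \<le> s * N x' y} \<in> sets ?P"
        using \<open>finite G\<close> by (intro sets.sets_Collect_finite_All) auto
    qed
    finally show ?thesis .
  qed
  have UN: "{y \<in> space ?P. \<exists>x\<in>G. \<beta> x \<le> s * card {i\<in>I. y i \<in> S x}} = (\<Union>x\<in>G. A x)"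
  proof (intro equalityI subsetI)
    fix y assume y: "y \<in> {y \<in> space ?P. \<exists>x\<in>G. \<beta> x \<le> s * card {i\<in>I. y i \<in> S x}}"
    define H where "H = {x\<in>G. \<beta> x \<le> s * N x y}"
    have "finite H" "H \<noteq> {}" using y \<open>finite G\<close> by (auto simp: H_def N_def)
    then have "Max H \<in> H" and "\<And>x'. x' \<in> H \<Longrightarrow> x' \<le> Max H" by auto
    then have "y \<in> A (Max H)" using y unfolding A_def H_def by force
    then show "y \<in> (\<Union>x\<in>G. A x)" using \<open>Max H \<in> H\<close> by (auto simp: H_def)
  qed (auto simp: A_def N_def)
  have disj: "disjoint_family_on A G"
    unfolding disjoint_family_on_def
  proof (intro ballI impI)
    fix x x' assume "x \<in> G" "x' \<in> G" "x \<noteq> x'"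
    then show "A x \<inter> A x' = {}" by (cases "x < x'") (auto simp: A_def)
  qed
  define h where "h z = ennreal (exp (s * indicator (S a) z))" for z
  have [measurable]: "S a \<in> sets \<mu>" by (rule Sm) simp
  have hm[measurable]: "h \<in> borel_measurable \<mu>" unfolding h_def by measurable
  have step: "ennreal (exp B) * emeasure ?P (A x) \<le> (\<integral>\<^sup>+y. indicator (A x) y * (\<Prod>i\<in>I. h (y i)) \<partial>?P)"
    if x: "x \<in> G" for x
  proof -
    \<comment> \<open>The conditional probability of \<open>S a\<close> given \<open>S x\<close>;
      \<open>exp (s * r * N x)\<close> is the Jensen lower bound for the conditional mean of
      \<open>exp (s * N a)\<close>. Convexity of \<open>exp\<close> holds for either sign of
      \<open>s\<close>, so one statement covers both tails.\<close>
    define r where "r = a / x"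
    have ax: "a \<le> x" "0 < x" using B[OF x] \<open>0 < a\<close> by auto
    have r: "0 \<le> r" "r \<le> 1" "r * x = a" using ax \<open>0 < a\<close> by (auto simp: r_def)
    have sub: "S a \<subseteq> S x" using mono[of a x] x ax by auto
    note [measurable] = Sm[OF insertI2[OF x]] Am[OF x]
    define h' where "h' z = ennreal (exp (s * r * indicator (S x) z))" for z
    have [measurable]: "h' \<in> borel_measurable \<mu>" unfolding h'_def by measurable
    have ms: "emeasure \<mu> (S x) = ennreal x" "emeasure \<mu> (S a) = ennreal a"
      using S x by (auto simp: emeasure_eq_measure)
    have md: "emeasure \<mu> (S x - S a) = ennreal (x - a)"
      using S x sub by (simp add: emeasure_eq_measure finite_measure_Diff)
    have i1: "(\<integral>\<^sup>+z. h' z * indicator (S x) z \<partial>\<mu>) = ennreal (exp (s * r) * x)"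
    proof -
      have "(\<integral>\<^sup>+z. h' z * indicator (S x) z \<partial>\<mu>) = (\<integral>\<^sup>+z. ennreal (exp (s * r)) * indicator (S x) z \<partial>\<mu>)"
        by (intro nn_integral_cong) (auto simp: h'_def indicator_def)
      then show ?thesis using ax by (simp add: nn_integral_cmult_indicator ms ennreal_mult)
    qed
    have i2: "(\<integral>\<^sup>+z. h z * indicator (S x) z \<partial>\<mu>) = ennreal (exp s * a + (x - a))"
    proof -
      have "(\<integral>\<^sup>+z. h z * indicator (S x) z \<partial>\<mu>)
          = (\<integral>\<^sup>+z. ennreal (exp s) * indicator (S a) z + indicator (S x - S a) z \<partial>\<mu>)"
        using sub by (intro nn_integral_cong) (auto simp: h_def indicator_def)
      also have "\<dots> = ennreal (exp s) * ennreal a + ennreal (x - a)"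
        by (subst nn_integral_add) (auto simp: nn_integral_cmult_indicator ms md)
      finally show ?thesis using ax \<open>0 < a\<close> by (simp add: ennreal_mult ennreal_plus)
    qed
    have "exp (s * r) * x \<le> (1 + r * (exp s - 1)) * x"
      using exp_mult_le_interpolate[of r s] r ax by (intro mult_right_mono) auto
    also have "\<dots> = exp s * a + (x - a)" using r(3) by (simp add: algebra_simps)
    finally have i12: "(\<integral>\<^sup>+z. h' z * indicator (S x) z \<partial>\<mu>) \<le> (\<integral>\<^sup>+z. h z * indicator (S x) z \<partial>\<mu>)"
      unfolding i1 i2 by (rule ennreal_leI)
    have "ennreal (exp B) * emeasure ?P (A x) = (\<integral>\<^sup>+y. ennreal (exp B) * indicator (A x) y \<partial>?P)"
      by (simp add: nn_integral_cmult_indicator)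
    also have "\<dots> \<le> (\<integral>\<^sup>+y. indicator (A x) y * (\<Prod>i\<in>I. h' (y i)) \<partial>?P)"
    proof (intro nn_integral_mono)
      fix y assume "y \<in> space ?P"
      have "(\<Prod>i\<in>I. h' (y i)) = ennreal (exp (s * r * N x y))"
        using \<open>finite I\<close> by (simp add: h'_def prod_ennreal exp_sum[symmetric] N_sum sum_distrib_left)
      \<comment> \<open>A crossing at \<open>x\<close>, rescaled by \<open>a / x\<close>, is at
        least \<open>B\<close>: here the boundary is carried to the left end
        \<open>a\<close>.\<close>
      moreover have "B \<le> s * r * N x y" if "y \<in> A x"
      proof -
        have "B \<le> \<beta> x * r" using B[OF x] by (simp add: r_def)
        also have "\<dots> \<le> (s * N x y) * r" using that r by (intro mult_right_mono) (auto simp: A_def)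
        finally show ?thesis by (simp add: mult_ac)
      qed
      ultimately show "ennreal (exp B) * indicator (A x) y \<le> indicator (A x) y * (\<Prod>i\<in>I. h' (y i))"
        by (auto simp: indicator_def intro!: ennreal_leI)
    qed
    also have "\<dots> \<le> (\<integral>\<^sup>+y. indicator (A x) y * (\<Prod>i\<in>I. h (y i)) \<partial>?P)"
    proof (rule nn_integral_PiM_mono_lumped[where S="S x"])
      show "h' z \<le> h z" if "z \<notin> S x" for z using that sub by (auto simp: h_def h'_def indicator_def)
    next
      fix y z assume yz: "y \<in> space ?P" "z \<in> space ?P" "\<And>i. i \<in> I \<Longrightarrow> y i = z i \<or> y i \<in> S x \<and> z i \<in> S x"
      have "N x' y = N x' z" if "x' \<in> G" "x \<le> x'" for x'
      proof -
        have "S x \<subseteq> S x'" using mono that x by auto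
        then have "{i\<in>I. y i \<in> S x'} = {i\<in>I. z i \<in> S x'}" using yz(3) by force
        then show ?thesis by (simp add: N_def)
      qed
      then have "y \<in> A x \<longleftrightarrow> z \<in> A x" using yz(1,2) x by (auto simp: A_def)
      then show "indicator (A x) y = (indicator (A x) z :: ennreal)" by (simp add: indicator_def)
    qed (use \<open>finite I\<close> i12 in \<open>auto intro: prob_space_axioms\<close>)
    finally show ?thesis .
  qed
  have ih: "(\<integral>\<^sup>+z. h z \<partial>\<mu>) = ennreal (1 + a * (exp s - 1))"
  proof -
    have a1: "a \<le> 1" using S[of a] prob_le_1[of "S a"] by auto
    have "(\<integral>\<^sup>+z. h z \<partial>\<mu>) = (\<integral>\<^sup>+z. ennreal (exp s) * indicator (S a) z + indicator (space \<mu> - S a) z \<partial>\<mu>)"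
      by (intro nn_integral_cong) (auto simp: h_def indicator_def)
    also have "\<dots> = ennreal (exp s) * ennreal a + ennreal (1 - a)"
      using S[of a] by (subst nn_integral_add) (auto simp: nn_integral_cmult_indicator emeasure_eq_measure prob_compl)
    also have "\<dots> = ennreal (exp s * a + (1 - a))"
      using a1 \<open>0 < a\<close> by (simp add: ennreal_mult ennreal_plus)
    finally show ?thesis by (simp add: algebra_simps)
  qed
  have pos: "0 \<le> 1 + a * (exp s - 1)"
  proof -
    have "a \<le> 1" using S[of a] prob_le_1[of "S a"] by auto
    then have "0 \<le> (1 - a) + a * exp s" using \<open>0 < a\<close> by (intro add_nonneg_nonneg) auto
    then show ?thesis by (simp add: algebra_simps)
  qed
  have "ennreal (exp B) * emeasure ?P (\<Union>x\<in>G. A x) = (\<Sum>x\<in>G. ennreal (exp B) * emeasure ?P (A x))"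
    using \<open>finite G\<close> disj Am by (subst sum_emeasure[symmetric]) (auto simp: sum_distrib_left)
  also have "\<dots> \<le> (\<Sum>x\<in>G. \<integral>\<^sup>+y. indicator (A x) y * (\<Prod>i\<in>I. h (y i)) \<partial>?P)"
    by (intro sum_mono step)
  also have "\<dots> = (\<integral>\<^sup>+y. (\<Sum>x\<in>G. indicator (A x) y * (\<Prod>i\<in>I. h (y i))) \<partial>?P)"
    by (subst nn_integral_sum) (use Am in auto)
  also have "\<dots> = (\<integral>\<^sup>+y. indicator (\<Union>x\<in>G. A x) y * (\<Prod>i\<in>I. h (y i)) \<partial>?P)"
    using \<open>finite G\<close> disj by (simp add: sum_distrib_right[symmetric] indicator_UN_disjoint)
  also have "\<dots> \<le> (\<integral>\<^sup>+y. (\<Prod>i\<in>I. h (y i)) \<partial>?P)"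
    by (intro nn_integral_mono) (auto simp: indicator_def)
  also have "\<dots> = ennreal ((1 + a * (exp s - 1)) ^ card I)"
    using \<open>finite I\<close> pos by (subst product_nn_integral_prod) (auto simp: ih ennreal_power)
  \<comment> \<open>The binomial moment generating function is bounded by the Poisson one.\<close>
  also have "\<dots> \<le> ennreal (exp (a * (exp s - 1)) ^ card I)"
    using pos by (intro ennreal_leI power_mono exp_ge_add_one_self)
  finally have "ennreal (exp B * measure ?P (\<Union>x\<in>G. A x)) \<le> ennreal (exp (card I * (a * (exp s - 1))))"
    by (simp add: ennreal_mult P.emeasure_eq_measure exp_of_nat_mult)
  then have "exp B * measure ?P (\<Union>x\<in>G. A x) \<le> exp (card I * (a * (exp s - 1)))"
    by simp
  then show ?thesis unfolding UN by (simp add: exp_diff pos_le_divide_eq mult.commute)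
qed

subsection \<open>Geometric blocks\<close>

lemma prob_space_unif01: "prob_space unif01"
  unfolding unif01_def by (rule prob_space_uniform_measure) auto

lemma space_unif01 [simp]: "space unif01 = UNIV"
  and sets_unif01 [simp, measurable_cong]: "sets unif01 = sets borel"
  unfolding unif01_def by simp_all

lemma measure_unif01:
  assumes "A \<in> sets borel"
  shows "measure unif01 A = measure lborel ({0..1} \<inter> A)"
  using assms by (simp add: unif01_def measure_uniform_measure)

lemma measure_unif01_atLeast:
  assumes "0 \<le> x" "x \<le> 1"
  shows "measure unif01 {1 - x..} = x"
proof -
  have "{0..1} \<inter> {1 - x..} = {1 - x..1}" using assms by auto
  then show ?thesis using assms by (simp add: measure_unif01)
qed

lemma measure_unif01_lessThan:
  assumes "0 \<le> x" "x \<le> 1"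
  shows "measure unif01 {..<x} = x"
proof -
  have "{0..1} \<inter> {..<x} = {0..<x}" using assms by auto
  then show ?thesis using assms by (simp add: measure_unif01)
qed

lemma AE_unif01: "AE z in unif01. 0 \<le> z \<and> z \<le> 1"
  unfolding unif01_def by (rule AE_uniform_measureI) auto

text \<open>Carrying the standard deviation from \<open>x\<close> to the left end \<open>a\<close>
  costs at most a factor \<theta> in variance for the width of the block, and \<open>1 - x\<close>
  is replaced by its smallest value \<open>1 - b\<close>.\<close>

lemma sqrt_variance_block:
  fixes a b x \<theta> :: real
  assumes x: "a \<le> x" "x \<le> \<theta> * a" "x \<le> b" "0 < x" and "0 < a" "1 \<le> \<theta>" "b < 1"
  shows "sqrt (real n * a * (1 - b) / \<theta>) \<le> sqrt (real n * x * (1 - x)) * (a / x)"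
proof -
  have r: "1 / \<theta> \<le> a / x" using x \<open>1 \<le> \<theta>\<close> by (simp add: field_simps)
  have "sqrt (real n * a * (1 - b) / \<theta>) \<le> sqrt (real n * x * (1 - x) * (a / x)\<^sup>2)"
  proof (rule real_sqrt_le_mono)
    have "real n * a * (1 - b) / \<theta> \<le> real n * a * (1 - x) / \<theta>"
      using x \<open>1 \<le> \<theta>\<close> \<open>0 < a\<close> by (intro divide_right_mono mult_left_mono) auto
    also have "\<dots> = real n * a * (1 - x) * (1 / \<theta>)" by simp
    also have "\<dots> \<le> real n * a * (1 - x) * (a / x)"
      using x \<open>b < 1\<close> \<open>0 < a\<close> by (intro mult_left_mono r) auto
    also have "\<dots> = real n * x * (1 - x) * (a / x)\<^sup>2" using x by (simp add: power2_eq_square)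
    finally show "real n * a * (1 - b) / \<theta> \<le> real n * x * (1 - x) * (a / x)\<^sup>2" .
  qed
  also have "\<dots> = sqrt (real n * x * (1 - x)) * (a / x)"
    using x \<open>0 < a\<close> by (simp add: real_sqrt_mult)
  finally show ?thesis .
qed

text \<open>This is \<open>maximal_count_bound\<close> with \<open>S x = {1 - x..}\<close>. The
  centring \<open>n x\<close> rescales exactly to \<open>n a\<close>, so only the deviation pays for
  the move to the left end; subtracting the centring from the Poisson exponent leaves
  \<open>exp s - 1 - s\<close>.\<close>

lemma upper_block:
  fixes lam s a b \<theta> :: real and G :: "real set"
  assumes "finite G" "0 < a" "1 \<le> \<theta>" "b < 1" "0 < s" "0 \<le> lam"
    and G: "\<And>x. x \<in> G \<Longrightarrow> a \<le> x \<and> x \<le> \<theta> * a \<and> x \<le> b"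
  shows "measure (null_law n) {y \<in> space (null_law n). \<exists>x\<in>G.
            real n * x + lam * sqrt (real n * x * (1 - x)) \<le> card {i\<in>{1..n}. 1 - y i \<le> x}}
         \<le> exp (real n * a * (exp s - 1 - s) - s * lam * sqrt (real n * a * (1 - b) / \<theta>))"
proof (cases "G = {}")
  case False
  then have ab: "a \<le> b" using G by fastforce
  define \<beta> where "\<beta> x = s * (real n * x + lam * sqrt (real n * x * (1 - x)))" for x
  define B where "B = s * (real n * a + lam * sqrt (real n * a * (1 - b) / \<theta>))"
  have eq: "{y \<in> space (null_law n). \<exists>x\<in>G. real n * x + lam * sqrt (real n * x * (1 - x)) \<le> card {i\<in>{1..n}. 1 - y i \<le> x}}
     = {y \<in> space (PiM {1..n} (\<lambda>_. unif01)). \<exists>x\<in>G. \<beta> x \<le> s * card {i\<in>{1..n}. y i \<in> {1 - x..}}}"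
  proof -
    have "\<beta> x \<le> s * real k \<longleftrightarrow> real n * x + lam * sqrt (real n * x * (1 - x)) \<le> real k" for x k
      unfolding \<beta>_def using \<open>0 < s\<close> by (rule mult_le_cancel_left_pos)
    moreover have "z \<in> {1 - x..} \<longleftrightarrow> 1 - z \<le> x" for x z :: real by auto
    ultimately show ?thesis by (simp only: null_law_def)
  qed
  have "measure (PiM {1..n} (\<lambda>_. unif01))
      {y \<in> space (PiM {1..n} (\<lambda>_. unif01)). \<exists>x\<in>G. \<beta> x \<le> s * card {i\<in>{1..n}. y i \<in> {1 - x..}}}
      \<le> exp (card {1..n} * (a * (exp s - 1)) - B)"
  proof (rule maximal_count_bound[OF prob_space_unif01 _ \<open>finite G\<close> \<open>0 < a\<close>])
    fix x assume "x \<in> insert a G"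
    then have "0 \<le> x" "x \<le> 1" using G ab \<open>0 < a\<close> \<open>b < 1\<close> by fastforce+
    then show "{1 - x..} \<in> sets unif01 \<and> measure unif01 {1 - x..} = x"
      by (simp add: measure_unif01_atLeast)
  next
    fix x assume "x \<in> G"
    then have x: "a \<le> x" "x \<le> \<theta> * a" "x \<le> b" "0 < x" using G \<open>0 < a\<close> by fastforce+
    have "sqrt (real n * a * (1 - b) / \<theta>) \<le> sqrt (real n * x * (1 - x)) * (a / x)"
      using x \<open>0 < a\<close> \<open>1 \<le> \<theta>\<close> \<open>b < 1\<close> by (intro sqrt_variance_block)
    then have "lam * sqrt (real n * a * (1 - b) / \<theta>) \<le> lam * (sqrt (real n * x * (1 - x)) * (a / x))"
      using \<open>0 \<le> lam\<close> by (rule mult_left_mono)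
    then have "s * (real n * a + lam * sqrt (real n * a * (1 - b) / \<theta>)) \<le> s * (real n * a + lam * (sqrt (real n * x * (1 - x)) * (a / x)))"
      using \<open>0 < s\<close> by (intro mult_left_mono) auto
    also have "\<dots> = \<beta> x * (a / x)"
      using x by (simp add: \<beta>_def field_simps)
    finally show "a \<le> x \<and> B \<le> \<beta> x * (a / x)" using x unfolding B_def by simp
  qed auto
  moreover have "card {1..n} * (a * (exp s - 1)) - B
      = real n * a * (exp s - 1 - s) - s * lam * sqrt (real n * a * (1 - b) / \<theta>)"
    by (simp add: B_def algebra_simps)
  ultimately show ?thesis unfolding eq by (simp add: null_law_def)
qed simp

text \<open>The parameter \<open>- s\<close> turns a shortfall of the count into a crossing. It
  serves p-value levels above \<open>1 / 2\<close>: an excess of p-values up to \<open>1 - x\<close>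
  is a shortfall of values below \<open>x\<close>.\<close>

lemma lower_block:
  fixes lam s a b \<theta> :: real and G :: "real set"
  assumes "finite G" "0 < a" "1 \<le> \<theta>" "b < 1" "0 < s" "0 \<le> lam"
    and G: "\<And>x. x \<in> G \<Longrightarrow> a \<le> x \<and> x \<le> \<theta> * a \<and> x \<le> b"
  shows "measure (null_law n) {y \<in> space (null_law n). \<exists>x\<in>G.
            card {i\<in>{1..n}. y i < x} \<le> real n * x - lam * sqrt (real n * x * (1 - x))}
         \<le> exp (real n * a * (exp (- s) - 1 + s) - s * lam * sqrt (real n * a * (1 - b) / \<theta>))"
proof (cases "G = {}")
  case False
  then have ab: "a \<le> b" using G by fastforce
  define \<beta> where "\<beta> x = (- s) * (real n * x - lam * sqrt (real n * x * (1 - x)))" for x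
  define B where "B = (- s) * (real n * a - lam * sqrt (real n * a * (1 - b) / \<theta>))"
  have eq: "{y \<in> space (null_law n). \<exists>x\<in>G. card {i\<in>{1..n}. y i < x} \<le> real n * x - lam * sqrt (real n * x * (1 - x))}
     = {y \<in> space (PiM {1..n} (\<lambda>_. unif01)). \<exists>x\<in>G. \<beta> x \<le> (- s) * card {i\<in>{1..n}. y i \<in> {..<x}}}"
  proof -
    have "\<beta> x \<le> (- s) * real k \<longleftrightarrow> real k \<le> real n * x - lam * sqrt (real n * x * (1 - x))" for x k
      unfolding \<beta>_def using \<open>0 < s\<close> by (subst mult_le_cancel_left_neg) auto
    then show ?thesis by (simp only: null_law_def lessThan_iff)
  qed
  have "measure (PiM {1..n} (\<lambda>_. unif01))
      {y \<in> space (PiM {1..n} (\<lambda>_. unif01)). \<exists>x\<in>G. \<beta> x \<le> (- s) * card {i\<in>{1..n}. y i \<in> {..<x}}}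
      \<le> exp (card {1..n} * (a * (exp (- s) - 1)) - B)"
  proof (rule maximal_count_bound[OF prob_space_unif01 _ \<open>finite G\<close> \<open>0 < a\<close>])
    fix x assume "x \<in> insert a G"
    then have "0 \<le> x" "x \<le> 1" using G ab \<open>0 < a\<close> \<open>b < 1\<close> by fastforce+
    then show "{..<x} \<in> sets unif01 \<and> measure unif01 {..<x} = x"
      by (simp add: measure_unif01_lessThan)
  next
    fix x assume "x \<in> G"
    then have x: "a \<le> x" "x \<le> \<theta> * a" "x \<le> b" "0 < x" using G \<open>0 < a\<close> by fastforce+
    have "sqrt (real n * a * (1 - b) / \<theta>) \<le> sqrt (real n * x * (1 - x)) * (a / x)"
      using x \<open>0 < a\<close> \<open>1 \<le> \<theta>\<close> \<open>b < 1\<close> by (intro sqrt_variance_block)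
    then have "lam * sqrt (real n * a * (1 - b) / \<theta>) \<le> lam * (sqrt (real n * x * (1 - x)) * (a / x))"
      using \<open>0 \<le> lam\<close> by (rule mult_left_mono)
    then have "s * (lam * sqrt (real n * a * (1 - b) / \<theta>)) \<le> s * (lam * (sqrt (real n * x * (1 - x)) * (a / x)))"
      by (rule mult_left_mono) (use \<open>0 < s\<close> in auto)
    moreover have "\<beta> x * (a / x) = - (s * (real n * a)) + s * (lam * (sqrt (real n * x * (1 - x)) * (a / x)))"
      using x by (simp add: \<beta>_def field_simps)
    ultimately show "a \<le> x \<and> B \<le> \<beta> x * (a / x)" using x unfolding B_def by (simp add: algebra_simps)
  qed auto
  moreover have "card {1..n} * (a * (exp (- s) - 1)) - B
      = real n * a * (exp (- s) - 1 + s) - s * lam * sqrt (real n * a * (1 - b) / \<theta>)"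
    by (simp add: B_def algebra_simps)
  ultimately show ?thesis unfolding eq by (simp add: null_law_def)
qed simp

text \<open>The left ends \<open>A * \<theta> ^ j\<close> with \<open>j \<le> J\<close> give
  \<open>J + 1\<close> blocks. The last one may reach past \<open>B\<close>; hence the extra cap
  \<open>x \<le> B\<close> in \<open>bound\<close>, which also controls the variance factor
  \<open>1 - x\<close>.\<close>

lemma geometric_cover:
  fixes \<theta> A B \<beta> :: real
  assumes "finite_measure M" "finite G" "1 < \<theta>" "0 < A" "A \<le> B"
    and meas: "\<And>x. x \<in> G \<Longrightarrow> {y \<in> space M. Q x y} \<in> sets M"
    and bound: "\<And>a. A \<le> a \<Longrightarrow> a \<le> B \<Longrightarrow>
      measure M {y \<in> space M. \<exists>x\<in>{x\<in>G. a \<le> x \<and> x \<le> \<theta> * a \<and> x \<le> B}. Q x y} \<le> \<beta>"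
  shows "measure M {y \<in> space M. \<exists>x\<in>{x\<in>G. A \<le> x \<and> x \<le> B}. Q x y} \<le> (ln (B / A) / ln \<theta> + 1) * \<beta>"
proof -
  interpret finite_measure M by fact
  define J where "J = nat \<lfloor>ln (B / A) / ln \<theta>\<rfloor>"
  have lnt: "0 < ln \<theta>" using \<open>1 < \<theta>\<close> by simp
  have J: "real J \<le> ln (B / A) / ln \<theta>"
    using assms by (simp add: J_def)
  have Jpow: "A * \<theta> ^ j \<le> B" if "j \<le> J" for j
  proof -
    have "ln (\<theta> ^ j) \<le> ln (B / A)"
    proof -
      have "real j * ln \<theta> \<le> real J * ln \<theta>" using that lnt by (intro mult_right_mono) auto
      also have "\<dots> \<le> ln (B / A)" using J lnt by (simp add: pos_le_divide_eq)
      finally show ?thesis using \<open>1 < \<theta>\<close> by (simp add: ln_realpow)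
    qed
    then have "\<theta> ^ j \<le> B / A"
      using assms by (subst (asm) ln_le_cancel_iff) auto
    then show ?thesis using \<open>0 < A\<close> by (simp add: field_simps)
  qed
  define E where "E j = {y \<in> space M. \<exists>x\<in>{x\<in>G. A * \<theta> ^ j \<le> x \<and> x \<le> \<theta> * (A * \<theta> ^ j) \<and> x \<le> B}. Q x y}" for j
  have Em: "{y \<in> space M. \<exists>x\<in>G'. Q x y} \<in> sets M" if "G' \<subseteq> G" for G'
    using that finite_subset[OF that \<open>finite G\<close>] meas by (intro sets.sets_Collect_finite_Ex) auto
  have EmE: "E j \<in> sets M" for j unfolding E_def by (rule Em) auto
  have sub: "{y \<in> space M. \<exists>x\<in>{x\<in>G. A \<le> x \<and> x \<le> B}. Q x y} \<subseteq> (\<Union>j\<in>{..J}. E j)"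
  proof
    fix y assume "y \<in> {y \<in> space M. \<exists>x\<in>{x\<in>G. A \<le> x \<and> x \<le> B}. Q x y}"
    then obtain x where y: "y \<in> space M" and x: "x \<in> G" "A \<le> x" "x \<le> B" "Q x y" by auto
    define j where "j = nat \<lfloor>ln (x / A) / ln \<theta>\<rfloor>"
    have nn: "0 \<le> ln (x / A) / ln \<theta>" using x \<open>0 < A\<close> lnt by simp
    have "ln (x / A) / ln \<theta> \<le> ln (B / A) / ln \<theta>"
      using x \<open>0 < A\<close> lnt by (intro divide_right_mono) (auto simp: field_simps)
    then have "j \<le> J" unfolding j_def J_def by (intro nat_mono floor_mono)
    have j1: "real j \<le> ln (x / A) / ln \<theta>" and j2: "ln (x / A) / ln \<theta> \<le> real (Suc j)"
      using nn unfolding j_def by linarith+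
    have "ln (\<theta> ^ j) \<le> ln (x / A)" "ln (x / A) \<le> ln (\<theta> ^ Suc j)"
      using j1 j2 lnt \<open>1 < \<theta>\<close> by (auto simp: ln_realpow pos_le_divide_eq pos_divide_le_eq simp del: power_Suc of_nat_Suc)
    then have "\<theta> ^ j \<le> x / A" "x / A \<le> \<theta> ^ Suc j"
      using x \<open>0 < A\<close> \<open>1 < \<theta>\<close> by (metis divide_pos_pos less_le_trans less_trans ln_le_cancel_iff zero_less_one zero_less_power)+
    then have "A * \<theta> ^ j \<le> x" "x \<le> \<theta> * (A * \<theta> ^ j)"
      using \<open>0 < A\<close> by (auto simp: field_simps)
    then show "y \<in> (\<Union>j\<in>{..J}. E j)" using \<open>j \<le> J\<close> x y unfolding E_def by blast
  qed
  have "measure M {y \<in> space M. \<exists>x\<in>{x\<in>G. A \<le> x \<and> x \<le> B}. Q x y} \<le> measure M (\<Union>j\<in>{..J}. E j)"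
    by (intro finite_measure_mono sub sets.finite_UN) (auto intro: EmE)
  also have "\<dots> \<le> (\<Sum>j\<in>{..J}. measure M (E j))"
    by (intro measure_UNION_le) (auto intro: EmE)
  also have "\<dots> \<le> (\<Sum>j\<in>{..J}. \<beta>)"
  proof (rule sum_mono)
    fix j assume "j \<in> {..J}"
    moreover have "A * 1 \<le> A * \<theta> ^ j" using \<open>0 < A\<close> \<open>1 < \<theta>\<close> by (intro mult_left_mono) auto
    ultimately show "measure M (E j) \<le> \<beta>" unfolding E_def using Jpow by (intro bound) auto
  qed
  also have "\<dots> = (real J + 1) * \<beta>" by simp
  also have "\<dots> \<le> (ln (B / A) / ln \<theta> + 1) * \<beta>"
    using J bound[of A] \<open>A \<le> B\<close> by (intro mult_right_mono order_trans[OF measure_nonneg bound[of A]]) auto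
  finally show ?thesis .
qed

section \<open>Chernoff exponents on a single block\<close>

text \<open>The quadratics \<open>1 + s + s^2 / 2\<close> and \<open>1 - s + s^2 / 2\<close>
  multiply to \<open>1 + s^4 / 4\<close>. Unlike in \<open>exp_le_quadratic\<close> the constant
  \<open>1 / 2\<close> is not spoiled, so lower tails are Gaussian for every
  \<open>s\<close>.\<close>

lemma exp_minus_le_quadratic:
  assumes "0 \<le> (s::real)"
  shows "exp (- s) - 1 + s \<le> s\<^sup>2 / 2"
proof -
  have "1 + s + s\<^sup>2 / 2 \<le> exp s" by (rule exp_lower_Taylor_quadratic[OF assms])
  then have "exp (- s) \<le> 1 / (1 + s + s\<^sup>2 / 2)"
    using assms by (auto simp: exp_minus inverse_eq_divide intro!: divide_left_mono mult_pos_pos add_pos_nonneg)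
  also have "\<dots> \<le> 1 - s + s\<^sup>2 / 2"
  proof -
    have "(1 - s + s\<^sup>2 / 2) * (1 + s + s\<^sup>2 / 2) = 1 + s ^ 4 / 4"
      by (simp add: field_simps power2_eq_square power4_eq_xxxx)
    then have "1 \<le> (1 - s + s\<^sup>2 / 2) * (1 + s + s\<^sup>2 / 2)" by simp
    then show ?thesis using assms by (subst pos_divide_le_eq) (auto intro!: add_pos_nonneg)
  qed
  finally show ?thesis by simp
qed

lemma exp_le_quadratic:
  assumes "0 \<le> (s::real)" "s \<le> t"
  shows "exp s - 1 - s \<le> exp t / 2 * s\<^sup>2"
proof -
  obtain u where u: "\<bar>u\<bar> \<le> \<bar>s\<bar>" "exp s = (\<Sum>m<2. s ^ m / fact m) + exp u / fact 2 * s ^ 2"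
    using Maclaurin_exp_le by blast
  have "exp u / 2 * s\<^sup>2 \<le> exp t / 2 * s\<^sup>2"
    using u(1) assms by (intro mult_right_mono) auto
  then show ?thesis using u(2) by (simp add: eval_nat_numeral)
qed

text \<open>With \<open>m^2 = n a\<close>, the exponent \<open>m^2 * s^2 - s * lam * m / 2\<close>
  is smallest at \<open>s = lam / (4 * m)\<close>; the cap at 1 keeps
  \<open>exp s - 1 - s \<le> s^2\<close> valid. Uncapped, the value is \<open>- lam^2 / 16\<close>;
  capped, it is at most \<open>- lam * m / 4\<close>, and \<open>n a \<ge> 1 / lam\<close> gives
  \<open>lam * m \<ge> sqrt lam\<close>. The stated exponent covers both.\<close>

lemma upper_block_crude:
  fixes lam a \<theta> :: real and G :: "real set"
  assumes "finite G" "0 < n" "1 \<le> lam" "1 / (lam * real n) \<le> a" "1 \<le> \<theta>" "\<theta> \<le> 2"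
    and G: "\<And>x. x \<in> G \<Longrightarrow> a \<le> x \<and> x \<le> \<theta> * a \<and> x \<le> 1 / 2"
  shows "measure (null_law n) {y \<in> space (null_law n). \<exists>x\<in>G.
            real n * x + lam * sqrt (real n * x * (1 - x)) \<le> card {i\<in>{1..n}. 1 - y i \<le> x}}
         \<le> exp (- (sqrt lam / 16))"
proof -
  have "0 < a" using assms by (smt (verit) divide_pos_pos mult_pos_pos of_nat_0_less_iff)
  define m where "m = sqrt (real n * a)"
  have m2: "real n * a = m\<^sup>2" using \<open>0 < a\<close> by (simp add: m_def)
  have "1 / lam \<le> real n * a" using assms by (simp add: field_simps)
  then have "sqrt (1 / lam) \<le> m" unfolding m_def by (rule real_sqrt_le_mono)
  then have lm: "sqrt lam \<le> lam * m"
  proof -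
    have "lam * sqrt (1 / lam) \<le> lam * m"
      using \<open>sqrt (1 / lam) \<le> m\<close> assms by (intro mult_left_mono) auto
    moreover have "lam * sqrt (1 / lam) = sqrt lam"
      using assms by (simp add: real_sqrt_divide real_div_sqrt)
    ultimately show ?thesis by simp
  qed
  have mpos: "0 < m" using \<open>0 < a\<close> \<open>0 < n\<close> by (simp add: m_def)
  define s where "s = min 1 (lam / (4 * m))"
  have s: "0 < s" "s \<le> 1" using mpos assms by (auto simp: s_def)
  have "m / 2 = sqrt (m\<^sup>2 / 4)" using mpos by (simp add: real_sqrt_divide)
  also have "\<dots> \<le> sqrt (real n * a * (1 - 1/2) / \<theta>)"
    using assms mpos unfolding m2 by (intro real_sqrt_le_mono) (simp add: field_simps)
  finally have r: "m / 2 \<le> sqrt (real n * a * (1 - 1/2) / \<theta>)" .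
  have "real n * a * (exp s - 1 - s) - s * lam * sqrt (real n * a * (1 - 1/2) / \<theta>)
      \<le> m\<^sup>2 * s\<^sup>2 - s * lam * (m / 2)"
    unfolding m2[symmetric] using exp_bound[of s] s r assms \<open>0 < a\<close>
    by (intro diff_mono mult_left_mono) auto
  also have "\<dots> \<le> - (sqrt lam / 16)"
  proof (cases "lam / (4 * m) \<le> 1")
    case True
    then have "s = lam / (4 * m)" by (simp only: s_def min.absorb2)
    then have lam4: "lam = 4 * m * s" using mpos by simp
    have "m\<^sup>2 * s\<^sup>2 - s * lam * (m / 2) = - (lam\<^sup>2 / 16)"
      unfolding lam4 by (simp add: power2_eq_square)
    moreover have "sqrt lam \<le> lam\<^sup>2"
    proof -
      have "sqrt lam \<le> sqrt (lam\<^sup>2)" using assms by (intro real_sqrt_le_mono) (simp add: power2_eq_square)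
      also have "\<dots> \<le> lam\<^sup>2" using assms by (simp add: power2_eq_square)
      finally show ?thesis .
    qed
    ultimately show ?thesis by simp
  next
    case False
    then have "s = 1" "4 * m < lam" using mpos by (auto simp: s_def field_simps)
    have "m * (m - lam / 2) \<le> m * (- lam / 4)"
      using \<open>4 * m < lam\<close> mpos by (intro mult_left_mono) auto
    moreover have "m\<^sup>2 * s\<^sup>2 - s * lam * (m / 2) = m * (m - lam / 2)"
      by (simp add: \<open>s = 1\<close> power2_eq_square algebra_simps)
    moreover have "m * (- lam / 4) \<le> - (sqrt lam / 16)"
    proof -
      have "m * (- lam / 4) = - (lam * m / 4)" "0 \<le> sqrt lam" using \<open>1 \<le> lam\<close> by simp_all
      with lm show ?thesis by linarith
    qed
    ultimately show ?thesis by linarith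
  qed
  finally have e: "exp (real n * a * (exp s - 1 - s) - s * lam * sqrt (real n * a * (1 - 1/2) / \<theta>)) \<le> exp (- (sqrt lam / 16))"
    by simp
  show ?thesis
    by (rule order_trans[OF upper_block e]) (use assms \<open>0 < a\<close> s in auto)
qed

text \<open>
  The optimal Chernoff exponent \<open>s = lam * sqrt \<rho> / m\<close> is at most \<open>1 / lam\<close> here, so the bound is
  Gaussian up to factors tending to 1.
\<close>
lemma upper_block_fine:
  fixes lam a \<theta> :: real and G :: "real set"
  assumes "finite G" "1 < lam" "lam ^ 4 \<le> real n * a" "1 \<le> \<theta>" "0 < a"
    and G: "\<And>x. x \<in> G \<Longrightarrow> a \<le> x \<and> x \<le> \<theta> * a \<and> x \<le> 1 / lam"
  shows "measure (null_law n) {y \<in> space (null_law n). \<exists>x\<in>G.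
            real n * x + lam * sqrt (real n * x * (1 - x)) \<le> card {i\<in>{1..n}. 1 - y i \<le> x}}
         \<le> exp (- (lam\<^sup>2 * ((1 - 1 / lam) / \<theta>) * (1 - exp (1 / lam) / 2)))"
proof -
  \<comment> \<open>The variance loss of a block: \<open>1 - 1 / lam\<close> from the cap on
    \<open>x\<close>, and \<open>1 / \<theta>\<close> from its width.\<close>
  define \<rho> where "\<rho> = (1 - 1 / lam) / \<theta>"
  define m where "m = sqrt (real n * a)"
  have m2: "real n * a = m\<^sup>2" using \<open>0 < a\<close> by (simp add: m_def)
  \<comment> \<open>The threshold \<open>lam ^ 4\<close> is what yields
    \<open>m \<ge> lam^2\<close>, and with it \<open>s \<le> 1 / lam\<close>.\<close>
  have "sqrt (lam ^ 4) \<le> m" unfolding m_def using assms by (intro real_sqrt_le_mono)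
  moreover have "sqrt (lam ^ 4) = lam\<^sup>2"
    by (rule real_sqrt_unique) (simp_all flip: power_mult)
  ultimately have ml: "lam\<^sup>2 \<le> m" by simp
  have "0 < m" using assms by (intro less_le_trans[OF _ ml]) auto
  have "0 < 1 - 1 / lam" "1 - 1 / lam \<le> 1" using \<open>1 < lam\<close> by auto
  then have rho: "0 < \<rho>" "\<rho> \<le> 1" using \<open>1 \<le> \<theta>\<close> unfolding \<rho>_def
    by (simp, subst pos_divide_le_eq) linarith+
  define s where "s = lam * sqrt \<rho> / m"
  have s0: "0 < s" using rho \<open>0 < m\<close> assms by (simp add: s_def)
  have "s \<le> lam * 1 / lam\<^sup>2"
    unfolding s_def using rho assms ml by (intro frac_le mult_left_mono) auto
  then have s1: "s \<le> 1 / lam" using \<open>1 < lam\<close> by (simp add: power2_eq_square)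
  have q: "sqrt (real n * a * (1 - 1 / lam) / \<theta>) = m * sqrt \<rho>"
  proof -
    have "real n * a * (1 - 1 / lam) / \<theta> = m\<^sup>2 * \<rho>" by (simp add: m2 \<rho>_def)
    then show ?thesis using \<open>0 < m\<close> by (simp add: real_sqrt_mult)
  qed
  have ms: "m\<^sup>2 * s\<^sup>2 = lam\<^sup>2 * \<rho>" "s * lam * (m * sqrt \<rho>) = lam\<^sup>2 * \<rho>"
    using rho \<open>0 < m\<close> by (auto simp: s_def power_mult_distrib power_divide) (simp add: power2_eq_square)
  have "real n * a * (exp s - 1 - s) - s * lam * sqrt (real n * a * (1 - 1 / lam) / \<theta>)
      \<le> m\<^sup>2 * (exp (1 / lam) / 2 * s\<^sup>2) - s * lam * (m * sqrt \<rho>)"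
    unfolding q by (rule diff_right_mono, unfold m2, intro mult_left_mono exp_le_quadratic)
      (use s0 s1 in auto)
  also have "\<dots> = - (lam\<^sup>2 * \<rho> * (1 - exp (1 / lam) / 2))"
  proof -
    have "m\<^sup>2 * (exp (1 / lam) / 2 * s\<^sup>2) = (m\<^sup>2 * s\<^sup>2) * (exp (1 / lam) / 2)" by simp
    then show ?thesis unfolding ms by (simp add: algebra_simps)
  qed
  finally have e: "exp (real n * a * (exp s - 1 - s) - s * lam * sqrt (real n * a * (1 - 1 / lam) / \<theta>))
       \<le> exp (- (lam\<^sup>2 * ((1 - 1 / lam) / \<theta>) * (1 - exp (1 / lam) / 2)))"
    unfolding \<rho>_def by simp
  show ?thesis
    by (rule order_trans[OF upper_block e]) (use assms s0 in auto)
qed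

text \<open>The optimal \<open>s = lam * sqrt \<rho> / m\<close> gives a Gaussian exponent. As
  \<open>exp_minus_le_quadratic\<close> imposes no upper limit on \<open>s\<close>,
  \<open>n a\<close> may be small, and one range from \<open>1 / n\<close> to \<open>1 / lam\<close>
  suffices on this side.\<close>

lemma lower_block_bound:
  fixes lam a \<theta> b :: real and G :: "real set"
  assumes "finite G" "0 < n" "0 < lam" "1 \<le> \<theta>" "0 < a" "b < 1"
    and G: "\<And>x. x \<in> G \<Longrightarrow> a \<le> x \<and> x \<le> \<theta> * a \<and> x \<le> b"
  shows "measure (null_law n) {y \<in> space (null_law n). \<exists>x\<in>G.
            card {i\<in>{1..n}. y i < x} \<le> real n * x - lam * sqrt (real n * x * (1 - x))}
         \<le> exp (- (lam\<^sup>2 * ((1 - b) / \<theta>) / 2))"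
proof -
  define \<rho> where "\<rho> = (1 - b) / \<theta>"
  define m where "m = sqrt (real n * a)"
  have m2: "real n * a = m\<^sup>2" using \<open>0 < a\<close> by (simp add: m_def)
  have "0 < m" using assms by (simp add: m_def)
  have rho: "0 < \<rho>" using assms by (auto simp: \<rho>_def field_simps)
  define s where "s = lam * sqrt \<rho> / m"
  have s0: "0 < s" using rho \<open>0 < m\<close> assms by (simp add: s_def)
  have q: "sqrt (real n * a * (1 - b) / \<theta>) = m * sqrt \<rho>"
  proof -
    have "real n * a * (1 - b) / \<theta> = m\<^sup>2 * \<rho>" by (simp add: m2 \<rho>_def)
    then show ?thesis using \<open>0 < m\<close> by (simp add: real_sqrt_mult)
  qed
  have ms: "m\<^sup>2 * s\<^sup>2 = lam\<^sup>2 * \<rho>" "s * lam * (m * sqrt \<rho>) = lam\<^sup>2 * \<rho>"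
    using rho \<open>0 < m\<close> by (auto simp: s_def power_mult_distrib power_divide) (simp add: power2_eq_square)
  have "real n * a * (exp (- s) - 1 + s) - s * lam * sqrt (real n * a * (1 - b) / \<theta>)
      \<le> m\<^sup>2 * (s\<^sup>2 / 2) - s * lam * (m * sqrt \<rho>)"
    unfolding q by (rule diff_right_mono, unfold m2, intro mult_left_mono exp_minus_le_quadratic)
      (use s0 in auto)
  also have "\<dots> = - (lam\<^sup>2 * \<rho> / 2)"
    using ms by simp
  finally have e: "exp (real n * a * (exp (- s) - 1 + s) - s * lam * sqrt (real n * a * (1 - b) / \<theta>))
       \<le> exp (- (lam\<^sup>2 * ((1 - b) / \<theta>) / 2))"
    unfolding \<rho>_def by simp
  show ?thesis
    by (rule order_trans[OF lower_block e]) (use assms s0 in auto)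
qed

section \<open>From order statistics to counts\<close>

lemma sorted_nth_le_iff:
  fixes xs :: "'a::linorder list"
  assumes "sorted xs" "i < length xs"
  shows "xs ! i \<le> x \<longleftrightarrow> i < length (filter (\<lambda>z. z \<le> x) xs)"
  using assms
proof (induction xs arbitrary: i)
  case (Cons z zs)
  show ?case
  proof (cases "z \<le> x")
    case True
    then show ?thesis using Cons by (cases i) auto
  next
    case False
    then have "\<not> u \<le> x" if "u \<in> set (z # zs)" for u using that Cons.prems(1) by force
    then have "filter (\<lambda>z. z \<le> x) (z # zs) = []" "\<not> (z # zs) ! i \<le> x"
      using Cons.prems(2) nth_mem[of i "z # zs"] by (auto simp: filter_empty_conv)
    then show ?thesis by simp
  qed
qed simp

lemma porder_le_iff:
  assumes "t \<in> {1..n}"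
  shows "porder n y t \<le> x \<longleftrightarrow> t \<le> card {i\<in>{1..n}. 1 - y i \<le> x}"
proof -
  have "length (filter (\<lambda>z. z \<le> x) (pvals_sorted n y)) = size (filter_mset (\<lambda>z. z \<le> x) (mset (pvals_sorted n y)))"
    by (metis mset_filter size_mset)
  also have "\<dots> = length (filter (\<lambda>z. z \<le> x) (map (\<lambda>t. 1 - y t) [1..<n+1]))"
    unfolding pvals_sorted_def mset_sort by (metis mset_filter size_mset)
  also have "\<dots> = card (set (filter (\<lambda>t. 1 - y t \<le> x) [1..<n+1]))"
    by (subst distinct_card) (auto simp: filter_map comp_def)
  also have "set (filter (\<lambda>t. 1 - y t \<le> x) [1..<n+1]) = {i\<in>{1..n}. 1 - y i \<le> x}"
    by auto
  finally have *: "length (filter (\<lambda>z. z \<le> x) (pvals_sorted n y)) = card {i\<in>{1..n}. 1 - y i \<le> x}" .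
  have "sorted (pvals_sorted n y)" "t - 1 < length (pvals_sorted n y)"
    using assms by (auto simp: pvals_sorted_def)
  from sorted_nth_le_iff[OF this, of x]
  have "pvals_sorted n y ! (t - 1) \<le> x \<longleftrightarrow> t - 1 < card {i\<in>{1..n}. 1 - y i \<le> x}"
    unfolding * .
  then show ?thesis using assms unfolding porder_def by auto
qed

text \<open>The supremum runs over a finite set, nonempty because \<open>Sup {}\<close> is minus
  infinity, and is therefore attained. The cutoff only removes ranks; covering all ranks makes the
  type I bound uniform in \<open>c\<close>.\<close>

lemma HC_reject_imp:
  assumes "HC_reject \<delta> c n y"
  shows "\<exists>t\<in>{1..n}. sqrt (2 * (1 + \<delta>) * ln (ln (real n))) \<le> HC n y t"
proof -
  define T where "T = {t\<in>{1..n}. c \<le> porder n y (t + 1)}"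
  define S where "S = (\<lambda>t. ereal (HC n y t)) ` T"
  have "{ereal (HC n y t) | t. t \<in> {1..n} \<and> c \<le> porder n y (t + 1)} = S"
    unfolding S_def T_def by blast
  then have le: "ereal (sqrt (2 * (1 + \<delta>) * ln (ln (real n)))) \<le> Sup S"
    using assms unfolding HC_reject_def HC_plus_def by metis
  have fin: "finite S" unfolding S_def T_def by simp
  have ne: "S \<noteq> {}" using le by (auto simp: bot_ereal_def)
  have "Sup S \<in> S" using Max_in[OF fin ne] Max_Sup[OF fin ne] by simp
  then obtain t where "t \<in> T" "Sup S = ereal (HC n y t)" unfolding S_def by blast
  then show ?thesis using le unfolding T_def by (metis (no_types, lifting) ereal_less_eq(3) mem_Collect_eq)
qed

text \<open>With \<open>p\<close> the \<open>t\<close>-th smallest p-value, clearing denominators in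
  \<open>HC\<close> gives the boundary inequality. The cap on \<open>p\<close> comes from
  \<open>t \<le> n\<close>: too close to 1, \<open>lam * sqrt (n p (1 - p))\<close> would exceed the
  available \<open>n (1 - p)\<close>.\<close>

lemma HC_imp_exceedance:
  assumes "t \<in> {1..n}" "0 < lam" "lam \<le> HC n y t" "\<And>i. i \<in> {1..n} \<Longrightarrow> 0 \<le> y i \<and> y i \<le> 1"
  shows "\<exists>p. 0 < p \<and> p \<le> real n / (real n + lam\<^sup>2) \<and> t \<le> card {i\<in>{1..n}. 1 - y i \<le> p}
           \<and> real n * p + lam * sqrt (real n * p * (1 - p)) \<le> t"
proof -
  define p where "p = porder n y t"
  have n: "0 < real n" using assms(1) by auto
  have tc: "t \<le> card {i\<in>{1..n}. 1 - y i \<le> p}"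
    using porder_le_iff[OF assms(1), of y p] by (simp add: p_def)
  have "t \<le> card {i\<in>{1..n}. 1 - y i \<le> 1}"
  proof -
    have "{i\<in>{1..n}. 1 - y i \<le> 1} = {1..n}" using assms(4) by auto
    then show ?thesis using assms(1) by simp
  qed
  then have "p \<le> 1" unfolding p_def by (simp add: porder_le_iff[OF assms(1)])
  moreover have "0 \<le> p"
  proof -
    have "{i\<in>{1..n}. 1 - y i \<le> p} \<noteq> {}" using tc assms(1) by (metis card.empty atLeastAtMost_iff le_trans not_one_le_zero)
    then show ?thesis using assms(4) by force
  qed
  \<comment> \<open>At 0 and 1 the denominator vanishes, and division by zero makes
    \<open>HC\<close> equal to 0, below \<open>lam\<close>.\<close>
  moreover have "p \<noteq> 0" "p \<noteq> 1" using assms(2,3) unfolding HC_def p_def by auto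
  ultimately have p: "0 < p" "p < 1" by auto
  have "lam \<le> sqrt (real n) * (real t / real n - p) / sqrt (p * (1 - p))"
    using assms(3) by (simp add: HC_def p_def)
  then have "lam * sqrt (p * (1 - p)) \<le> sqrt (real n) * (real t / real n - p)"
    using p by (simp add: pos_le_divide_eq)
  then have "sqrt (real n) * (lam * sqrt (p * (1 - p))) \<le> sqrt (real n) * (sqrt (real n) * (real t / real n - p))"
    by (rule mult_left_mono) simp
  then have le: "real n * p + lam * sqrt (real n * p * (1 - p)) \<le> t"
  proof -
    have "sqrt (real n) * (lam * sqrt (p * (1 - p))) = lam * sqrt (real n * p * (1 - p))"
      by (simp add: real_sqrt_mult)
    moreover have "sqrt (real n) * (sqrt (real n) * (real t / real n - p)) = real t - real n * p"
      using n by (simp add: right_diff_distrib flip: mult.assoc)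
    ultimately show ?thesis
      using \<open>sqrt (real n) * (lam * sqrt (p * (1 - p))) \<le> _\<close> by linarith
  qed
  have "lam * sqrt (real n * p * (1 - p)) \<le> real n * (1 - p)"
    using le assms(1) by (simp add: algebra_simps)
  then have "(lam * sqrt (real n * p * (1 - p)))\<^sup>2 \<le> (real n * (1 - p))\<^sup>2"
    using p assms(2) by (intro power_mono) auto
  moreover have "(lam * sqrt (real n * p * (1 - p)))\<^sup>2 = lam\<^sup>2 * p * (real n * (1 - p))"
  proof -
    have "0 \<le> real n * p * (1 - p)" using p by simp
    then show ?thesis unfolding power_mult_distrib by (simp add: mult_ac)
  qed
  ultimately have "lam\<^sup>2 * p * (real n * (1 - p)) \<le> real n * (1 - p) * (real n * (1 - p))"
    by (simp only: power2_eq_square[of "real n * (1 - p)"])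
  then have "lam\<^sup>2 * p \<le> real n * (1 - p)"
    using p n by (simp add: mult_le_cancel_right)
  then have "p \<le> real n / (real n + lam\<^sup>2)"
    using n assms(2) by (subst pos_le_divide_eq) (auto simp: algebra_simps add_pos_nonneg)
  then show ?thesis using p le tc by blast
qed

text \<open>
  For each rank \<open>k\<close> the largest \<open>x\<close> at which a count of \<open>k\<close> is still significant does not depend
  on the sample, so finitely many deterministic levels suffice.  The range of \<open>x\<close> is capped because
  \<open>x = 1\<close> satisfies the inequality trivially when \<open>k = n\<close>.
\<close>
lemma exceedance_thresholds:
  assumes "0 < lam"
  obtains G where "finite G" "G \<subseteq> {0<..real n / (real n + lam\<^sup>2)}"
    "\<And>y t. t \<in> {1..n} \<Longrightarrow> lam \<le> HC n y t \<Longrightarrow> (\<And>i. i \<in> {1..n} \<Longrightarrow> 0 \<le> y i \<and> y i \<le> 1) \<Longrightarrow>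
       \<exists>x\<in>G. real n * x + lam * sqrt (real n * x * (1 - x)) \<le> card {i\<in>{1..n}. 1 - y i \<le> x}"
proof -
  let ?b = "real n / (real n + lam\<^sup>2)"
  define T where "T k = {x. 0 \<le> x \<and> x \<le> ?b \<and> real n * x + lam * sqrt (real n * x * (1 - x)) \<le> real k}" for k :: nat
  have "\<exists>x\<in>T k. \<forall>x'\<in>T k. x' \<le> x" for k
  proof -
    have "T k = {0..?b} \<inter> {x. real n * x + lam * sqrt (real n * x * (1 - x)) \<le> real k}"
      by (auto simp: T_def)
    moreover have "closed {x. real n * x + lam * sqrt (real n * x * (1 - x)) \<le> real k}"
      by (intro closed_Collect_le continuous_intros)
    ultimately have "compact (T k)" by (simp add: compact_Int_closed)
    moreover have "0 \<in> T k" by (simp add: T_def)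
    ultimately show ?thesis by (intro compact_attains_sup) auto
  qed
  then obtain X where X: "\<And>k. X k \<in> T k" "\<And>k x. x \<in> T k \<Longrightarrow> x \<le> X k" by metis
  show ?thesis
  \<comment> \<open>Ranks whose largest level is 0 are dropped; a rank that exceeds the boundary has
    \<open>X t \<ge> p > 0\<close>.\<close>
  proof (rule that[of "X ` {1..n} \<inter> {0<..}"])
    show "X ` {1..n} \<inter> {0<..} \<subseteq> {0<..?b}" using X(1) by (auto simp: T_def)
    fix y t assume t: "t \<in> {1..n}" "lam \<le> HC n y t" "\<And>i. i \<in> {1..n} \<Longrightarrow> 0 \<le> y i \<and> y i \<le> 1"
    from HC_imp_exceedance[OF t(1) assms t(2,3)] obtain p where p: "0 < p" "p \<le> ?b"
      "t \<le> card {i\<in>{1..n}. 1 - y i \<le> p}" "real n * p + lam * sqrt (real n * p * (1 - p)) \<le> t" by blast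
    then have "p \<le> X t" by (intro X(2)) (auto simp: T_def)
    then have "card {i\<in>{1..n}. 1 - y i \<le> p} \<le> card {i\<in>{1..n}. 1 - y i \<le> X t}"
      by (intro card_mono) auto
    with p(3) have "t \<le> card {i\<in>{1..n}. 1 - y i \<le> X t}" by simp
    moreover have "real n * X t + lam * sqrt (real n * X t * (1 - X t)) \<le> t"
      using X(1)[of t] by (simp add: T_def)
    ultimately show "\<exists>x\<in>X ` {1..n} \<inter> {0<..}. real n * x + lam * sqrt (real n * x * (1 - x)) \<le> card {i\<in>{1..n}. 1 - y i \<le> x}"
      using \<open>p \<le> X t\<close> p(1) t(1) by (intro bexI[of _ "X t"]) auto
  qed simp
qed

subsection \<open>Type I error\<close>

lemma prob_space_null_law: "prob_space (null_law n)"
  unfolding null_law_def by (intro prob_space_PiM prob_space_unif01)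

lemma measurable_card_null_law [measurable]:
  assumes [measurable]: "Measurable.pred borel P"
  shows "(\<lambda>y. real (card {i\<in>{1..n}. P (y i)})) \<in> borel_measurable (null_law n)"
proof -
  have "real (card {i\<in>{1..n}. P (y i)}) = (\<Sum>i\<in>{1..n}. indicator {z. P z} (y i))" for y :: "nat \<Rightarrow> real"
    by (simp add: indicator_def sum.If_cases Int_def)
  moreover have "{z. P z} \<in> sets borel" by measurable
  ultimately show ?thesis unfolding null_law_def by simp
qed

lemma AE_null_law: "AE y in null_law n. \<forall>i\<in>{1..n}. 0 \<le> y i \<and> y i \<le> 1"
proof -
  have "AE y in null_law n. 0 \<le> y i \<and> y i \<le> 1" if "i \<in> {1..n}" for i
    unfolding null_law_def using that by (intro AE_PiM_component prob_space_unif01 AE_unif01)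
  then show ?thesis by (intro AE_finite_allI) auto
qed

lemma geometric_cover_ratio:
  fixes \<theta> A B \<beta> R :: real
  assumes "prob_space M" "finite G" "1 < \<theta>" "0 < A" "A \<le> B" "B / A \<le> R"
    and "\<And>x. x \<in> G \<Longrightarrow> {y \<in> space M. Q x y} \<in> sets M"
    and bound: "\<And>a. A \<le> a \<Longrightarrow> a \<le> B \<Longrightarrow>
      measure M {y \<in> space M. \<exists>x\<in>{x\<in>G. a \<le> x \<and> x \<le> \<theta> * a \<and> x \<le> B}. Q x y} \<le> \<beta>"
  shows "measure M {y \<in> space M. \<exists>x\<in>{x\<in>G. A \<le> x \<and> x \<le> B}. Q x y} \<le> (ln R / ln \<theta> + 1) * \<beta>"
proof -
  interpret prob_space M by fact
  have "measure M {y \<in> space M. \<exists>x\<in>{x\<in>G. A \<le> x \<and> x \<le> B}. Q x y} \<le> (ln (B / A) / ln \<theta> + 1) * \<beta>"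
    by (rule geometric_cover) (use assms finite_measure_axioms in auto)
  also have "\<dots> \<le> (ln R / ln \<theta> + 1) * \<beta>"
  proof (rule mult_right_mono)
    show "ln (B / A) / ln \<theta> + 1 \<le> ln R / ln \<theta> + 1"
      using assms by (intro add_right_mono divide_right_mono) (auto intro!: ln_mono)
    show "0 \<le> \<beta>" using bound[of A] \<open>A \<le> B\<close> by (intro order_trans[OF measure_nonneg bound[of A]]) auto
  qed
  finally show ?thesis .
qed

lemma measure_near_zero:
  assumes "0 \<le> x" "x \<le> 1"
  shows "measure (null_law n) {y \<in> space (null_law n). \<exists>i\<in>{1..n}. 1 - y i \<le> x} \<le> real n * x"
proof -
  interpret prob_space "null_law n" by (rule prob_space_null_law)
  have m: "{y \<in> space (null_law n). 1 - y i \<le> x} \<in> sets (null_law n)" if "i \<in> {1..n}" for i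
    using that unfolding null_law_def by measurable
  have p: "measure (null_law n) {y \<in> space (null_law n). 1 - y i \<le> x} = x" if i: "i \<in> {1..n}" for i
  proof -
    have "{y \<in> space (null_law n). 1 - y i \<le> x} = (\<lambda>y. y i) -` {1 - x..} \<inter> space (PiM {1..n} (\<lambda>_. unif01))"
      by (auto simp: null_law_def)
    then have "measure (null_law n) {y \<in> space (null_law n). 1 - y i \<le> x}
        = measure (distr (PiM {1..n} (\<lambda>_. unif01)) unif01 (\<lambda>y. y i)) {1 - x..}"
      using i by (simp add: measure_distr null_law_def)
    also have "distr (PiM {1..n} (\<lambda>_. unif01)) unif01 (\<lambda>y. y i) = unif01"
      using i by (intro distr_PiM_component prob_space_unif01)
    finally show ?thesis using measure_unif01_atLeast[OF assms] by simp
  qed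
  have "{y \<in> space (null_law n). \<exists>i\<in>{1..n}. 1 - y i \<le> x} = (\<Union>i\<in>{1..n}. {y \<in> space (null_law n). 1 - y i \<le> x})"
    by auto
  moreover have "measure (null_law n) (\<Union>i\<in>{1..n}. {y \<in> space (null_law n). 1 - y i \<le> x})
      \<le> (\<Sum>i\<in>{1..n}. measure (null_law n) {y \<in> space (null_law n). 1 - y i \<le> x})"
    by (intro measure_UNION_le m) auto
  moreover have "(\<Sum>i\<in>{1..n}. measure (null_law n) {y \<in> space (null_law n). 1 - y i \<le> x}) = real n * x"
    using p by simp
  ultimately show ?thesis by simp
qed

text \<open>The terms belong to levels below \<open>1 / (lam n)\<close>, then up to
  \<open>lam^4 / n\<close>, \<open>1 / lam\<close> and \<open>1 / 2\<close>, and to reflected levels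
  \<open>1 - x\<close> up to \<open>1 / lam\<close> and \<open>1 / 2\<close>. From
  \<open>lam^4 / n\<close> on \<open>upper_block_fine\<close> is available; the break at
  \<open>1 / lam\<close> keeps the variance factor near 1 in the ranges with about
  \<open>ln n\<close> blocks. The crude ranges have end ratios \<open>lam ^ 5\<close> and at most
  \<open>lam\<close>.\<close>

lemma type_I_error_le:
  assumes lam: "lam = sqrt (2 * (1 + \<delta>) * ln (ln (real n)))" and "2 \<le> lam" "lam ^ 5 \<le> real n"
    and th: "1 < \<theta>" "\<theta> \<le> 2"
  shows "type_I_error \<delta> c n \<le> 1 / lam
     + (ln (lam ^ 5) / ln \<theta> + 1) * exp (- (sqrt lam / 16))
     + (ln (real n) / ln \<theta> + 1) * exp (- (lam\<^sup>2 * ((1 - 1 / lam) / \<theta>) * (1 - exp (1 / lam) / 2)))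
     + (ln lam / ln \<theta> + 1) * exp (- (sqrt lam / 16))
     + (ln (real n) / ln \<theta> + 1) * exp (- (lam\<^sup>2 * ((1 - 1 / lam) / \<theta>) / 2))
     + (ln lam / ln \<theta> + 1) * exp (- (lam\<^sup>2 * ((1 - 1 / 2) / \<theta>) / 2))"
proof -
  interpret prob_space "null_law n" by (rule prob_space_null_law)
  have "0 < lam" using \<open>2 \<le> lam\<close> by simp
  have "(2::real) ^ 5 \<le> lam ^ 5" using \<open>2 \<le> lam\<close> by (intro power_mono) auto
  then have n: "32 \<le> real n" using \<open>lam ^ 5 \<le> real n\<close> by simp
  have lamn: "lam \<le> real n"
    using \<open>lam ^ 5 \<le> real n\<close> \<open>2 \<le> lam\<close> self_le_power[of lam 5] by simp
  obtain G where G: "finite G" "G \<subseteq> {0<..real n / (real n + lam\<^sup>2)}"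
    "\<And>y t. t \<in> {1..n} \<Longrightarrow> lam \<le> HC n y t \<Longrightarrow> (\<And>i. i \<in> {1..n} \<Longrightarrow> 0 \<le> y i \<and> y i \<le> 1) \<Longrightarrow>
       \<exists>x\<in>G. real n * x + lam * sqrt (real n * x * (1 - x)) \<le> card {i\<in>{1..n}. 1 - y i \<le> x}"
    using exceedance_thresholds[OF \<open>0 < lam\<close>] by blast
  define G' where "G' = (\<lambda>x. 1 - x) ` G"
  have "finite G'" using G(1) by (simp add: G'_def)
  define U where "U x y \<longleftrightarrow> real n * x + lam * sqrt (real n * x * (1 - x)) \<le> card {i\<in>{1..n}. 1 - y i \<le> x}"
    for x and y :: "nat \<Rightarrow> real"
  define V where "V x y \<longleftrightarrow> card {i\<in>{1..n}. y i < x} \<le> real n * x - lam * sqrt (real n * x * (1 - x))"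
    for x and y :: "nat \<Rightarrow> real"
  have Um: "{y \<in> space (null_law n). U x y} \<in> sets (null_law n)" for x
    unfolding U_def by measurable
  have Vm: "{y \<in> space (null_law n). V x y} \<in> sets (null_law n)" for x
    unfolding V_def by measurable
  let ?Z = "{y \<in> space (null_law n). \<exists>i\<in>{1..n}. 1 - y i \<le> 1 / (lam * real n)}"
  let ?EU = "\<lambda>A B. {y \<in> space (null_law n). \<exists>x\<in>{x\<in>G. A \<le> x \<and> x \<le> B}. U x y}"
  let ?EV = "\<lambda>A B. {y \<in> space (null_law n). \<exists>x\<in>{x\<in>G'. A \<le> x \<and> x \<le> B}. V x y}"
  let ?E = "?Z \<union> ?EU (1 / (lam * real n)) (lam ^ 4 / real n) \<union> ?EU (lam ^ 4 / real n) (1 / lam) \<union> ?EU (1 / lam) (1 / 2)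
     \<union> ?EV (1 / real n) (1 / lam) \<union> ?EV (1 / lam) (1 / 2)"
  have E0m: "?Z \<in> sets (null_law n)"
    unfolding null_law_def by measurable
  have EUm: "?EU A B \<in> sets (null_law n)" for A B
    using G(1) Um by (intro sets.sets_Collect_finite_Ex) auto
  have EVm: "?EV A B \<in> sets (null_law n)" for A B
    using \<open>finite G'\<close> Vm by (intro sets.sets_Collect_finite_Ex) auto
  have "type_I_error \<delta> c n \<le> measure (null_law n) ?E"
    unfolding type_I_error_def
  proof (rule finite_measure_mono_AE)
    show "AE y in null_law n. y \<in> {y \<in> space (null_law n). HC_reject \<delta> c n y} \<longrightarrow> y \<in> ?E"
      using AE_null_law
    proof (eventually_elim, intro impI)
      fix y assume y01: "\<forall>i\<in>{1..n}. 0 \<le> y i \<and> y i \<le> 1"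
        and "y \<in> {y \<in> space (null_law n). HC_reject \<delta> c n y}"
      then have y: "y \<in> space (null_law n)" and rej: "HC_reject \<delta> c n y" by auto
      from HC_reject_imp[OF rej] obtain t where "t \<in> {1..n}" "lam \<le> HC n y t" using lam by auto
      then have "\<exists>x\<in>G. real n * x + lam * sqrt (real n * x * (1 - x)) \<le> card {i\<in>{1..n}. 1 - y i \<le> x}"
        by (rule G(3)) (use y01 in auto)
      then obtain x where x: "x \<in> G" "U x y" unfolding U_def by blast
      then have "0 < x" "x \<le> real n / (real n + lam\<^sup>2)" using G(2) by auto
      moreover have "real n / (real n + lam\<^sup>2) < 1"
        using \<open>0 < lam\<close> n by (subst pos_divide_less_eq) (auto simp: add_pos_pos)
      ultimately have x01: "0 < x" "x < 1" by auto
      consider "x < 1 / (lam * real n)" | "1 / (lam * real n) \<le> x" "x \<le> lam ^ 4 / real n"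
        | "lam ^ 4 / real n \<le> x" "x \<le> 1 / lam" | "1 / lam \<le> x" "x \<le> 1 / 2" | "1 / 2 < x"
        by linarith
      then show "y \<in> ?E"
      proof cases
        case 1
        have "0 < real n * x + lam * sqrt (real n * x * (1 - x))"
          using x01 n \<open>0 < lam\<close> by (intro add_pos_nonneg) auto
        then have "0 < real (card {i\<in>{1..n}. 1 - y i \<le> x})" using x(2) unfolding U_def by linarith
        then have "{i\<in>{1..n}. 1 - y i \<le> x} \<noteq> {}" by (auto simp only: card.empty of_nat_0)
        then obtain i where "i \<in> {1..n}" "1 - y i \<le> x" by blast
        then have "\<exists>i\<in>{1..n}. 1 - y i \<le> 1 / (lam * real n)"
          by (intro bexI[of _ i]) (use 1 in linarith)
        then have "y \<in> ?Z" using y by blast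
        then show ?thesis by blast
      next
        case 5
        \<comment> \<open>The two counts add up to \<open>n\<close>, so an upper crossing at
          \<open>x\<close> is a lower crossing at \<open>1 - x\<close>, with the same
          variance.\<close>
        have "{i\<in>{1..n}. 1 - y i \<le> x} \<union> {i\<in>{1..n}. y i < 1 - x} = {1..n}" by auto
        then have "n = card ({i\<in>{1..n}. 1 - y i \<le> x} \<union> {i\<in>{1..n}. y i < 1 - x})" by simp
        also have "\<dots> = card {i\<in>{1..n}. 1 - y i \<le> x} + card {i\<in>{1..n}. y i < 1 - x}"
          by (intro card_Un_disjoint) auto
        finally have "V (1 - x) y"
        proof -
          assume split: "n = card {i\<in>{1..n}. 1 - y i \<le> x} + card {i\<in>{1..n}. y i < 1 - x}"
          have "real n = real (card {i\<in>{1..n}. 1 - y i \<le> x}) + real (card {i\<in>{1..n}. y i < 1 - x})"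
            by (rule trans[OF arg_cong[OF split, of real] of_nat_add])
          moreover have e: "real n * (1 - x) * (1 - (1 - x)) = real n * x * (1 - x)" "real n * (1 - x) = real n - real n * x"
            by (simp_all add: algebra_simps)
          ultimately show "V (1 - x) y" using x(2) unfolding U_def V_def e(1) unfolding e(2) by linarith
        qed
        \<comment> \<open>The cap on the levels in \<open>G\<close> leaves at least
          \<open>lam^2 / (n + lam^2)\<close>, so the reflected range needs no counterpart of
          \<open>?Z\<close>.\<close>
        moreover have "1 / real n \<le> 1 - x"
        proof -
          have "1 / real n \<le> lam\<^sup>2 / (real n + lam\<^sup>2)"
          proof -
            have "2 * 2 \<le> lam\<^sup>2" using \<open>2 \<le> lam\<close> unfolding power2_eq_square by (intro mult_mono) auto
            then have "4 * real n \<le> lam\<^sup>2 * real n" "lam\<^sup>2 * 32 \<le> lam\<^sup>2 * real n" using n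
              by (auto intro!: mult_right_mono mult_left_mono)
            then have "real n + lam\<^sup>2 \<le> lam\<^sup>2 * real n" using n \<open>2 * 2 \<le> lam\<^sup>2\<close> by linarith
            then show ?thesis using n \<open>0 < lam\<close> by (simp add: field_simps add_pos_pos)
          qed
          also have "\<dots> = 1 - real n / (real n + lam\<^sup>2)"
          proof -
            have "real n + lam\<^sup>2 \<noteq> 0" using n \<open>0 < lam\<close> by (simp add: add_pos_pos less_imp_neq[symmetric])
            then show ?thesis by (simp add: field_simps)
          qed
          also have "\<dots> \<le> 1 - x" using \<open>x \<le> real n / (real n + lam\<^sup>2)\<close> by simp
          finally show ?thesis .
        qed
        moreover have "1 - x \<in> G'" using x(1) by (auto simp: G'_def)
        moreover have "1 - x \<le> 1 / 2" using 5 by simp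
        ultimately have "y \<in> ?EV (1 / real n) (1 / lam) \<or> y \<in> ?EV (1 / lam) (1 / 2)"
          using y by (cases "1 - x \<le> 1 / lam") auto
        then show ?thesis by blast
      next
        case 2
        then have "y \<in> ?EU (1 / (lam * real n)) (lam ^ 4 / real n)" using x y by blast
        then show ?thesis by blast
      next
        case 3
        then have "y \<in> ?EU (lam ^ 4 / real n) (1 / lam)" using x y by blast
        then show ?thesis by blast
      next
        case 4
        then have "y \<in> ?EU (1 / lam) (1 / 2)" using x y by blast
        then show ?thesis by blast
      qed
    qed
    show "?E \<in> sets (null_law n)" by (intro sets.Un E0m EUm EVm)
  qed
  also have "\<dots> \<le> measure (null_law n) ?Z + measure (null_law n) (?EU (1 / (lam * real n)) (lam ^ 4 / real n))
     + measure (null_law n) (?EU (lam ^ 4 / real n) (1 / lam)) + measure (null_law n) (?EU (1 / lam) (1 / 2))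
     + measure (null_law n) (?EV (1 / real n) (1 / lam)) + measure (null_law n) (?EV (1 / lam) (1 / 2))"
    by (intro order_trans[OF measure_Un_le] add_mono order_refl sets.Un E0m EUm EVm)
  also have "\<dots> \<le> 1 / lam
     + (ln (lam ^ 5) / ln \<theta> + 1) * exp (- (sqrt lam / 16))
     + (ln (real n) / ln \<theta> + 1) * exp (- (lam\<^sup>2 * ((1 - 1 / lam) / \<theta>) * (1 - exp (1 / lam) / 2)))
     + (ln lam / ln \<theta> + 1) * exp (- (sqrt lam / 16))
     + (ln (real n) / ln \<theta> + 1) * exp (- (lam\<^sup>2 * ((1 - 1 / lam) / \<theta>) / 2))
     + (ln lam / ln \<theta> + 1) * exp (- (lam\<^sup>2 * ((1 - 1 / 2) / \<theta>) / 2))"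
  proof (intro add_mono)
    have "1 * 1 \<le> lam * real n" using \<open>2 \<le> lam\<close> n by (intro mult_mono) auto
    then show "measure (null_law n) ?Z \<le> 1 / lam"
      using measure_near_zero[of "1 / (lam * real n)" n] \<open>0 < lam\<close> n by simp
    \<comment> \<open>This is the role of \<open>lam ^ 5 \<le> n\<close>: it puts the breakpoints in
      order.\<close>
    have l4: "lam ^ 4 / real n \<le> 1 / lam"
      using \<open>lam ^ 5 \<le> real n\<close> \<open>0 < lam\<close> n by (simp add: field_simps flip: power_Suc)
    have l12: "1 / lam \<le> 1 / 2" using \<open>2 \<le> lam\<close> by simp
    have l4': "1 / (lam * real n) \<le> lam ^ 4 / real n"
    proof -
      have "1 \<le> lam ^ 5" using \<open>2 \<le> lam\<close> by simp
      then show ?thesis using \<open>0 < lam\<close> n by (simp add: field_simps flip: power_Suc)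
    qed
    show "measure (null_law n) (?EU (1 / (lam * real n)) (lam ^ 4 / real n)) \<le> (ln (lam ^ 5) / ln \<theta> + 1) * exp (- (sqrt lam / 16))"
    proof (rule geometric_cover_ratio[OF prob_space_axioms G(1) th(1) _ l4' _ Um])
      fix a assume "1 / (lam * real n) \<le> a"
      then show "measure (null_law n) {y \<in> space (null_law n). \<exists>x\<in>{x\<in>G. a \<le> x \<and> x \<le> \<theta> * a \<and> x \<le> lam ^ 4 / real n}. U x y}
         \<le> exp (- (sqrt lam / 16))"
        unfolding U_def
      proof (intro upper_block_crude[where a=a and \<theta>=\<theta>])
        fix x assume "x \<in> {x \<in> G. a \<le> x \<and> x \<le> \<theta> * a \<and> x \<le> lam ^ 4 / real n}"
        moreover have "x \<le> lam ^ 4 / real n \<Longrightarrow> x \<le> 1 / 2" using l4 l12 by linarith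
        ultimately show "a \<le> x \<and> x \<le> \<theta> * a \<and> x \<le> 1 / 2" by blast
      qed (use G(1) n \<open>2 \<le> lam\<close> th in auto)
    qed (use n \<open>0 < lam\<close> in \<open>auto simp: field_simps simp flip: power_Suc\<close>)
    show "measure (null_law n) (?EU (1 / lam) (1 / 2)) \<le> (ln lam / ln \<theta> + 1) * exp (- (sqrt lam / 16))"
    proof (rule geometric_cover_ratio[OF prob_space_axioms G(1) th(1) _ l12 _ Um])
      fix a assume "1 / lam \<le> a"
      moreover have "1 / (lam * real n) \<le> 1 / lam" using n \<open>0 < lam\<close> by (simp add: field_simps)
      ultimately show "measure (null_law n) {y \<in> space (null_law n). \<exists>x\<in>{x\<in>G. a \<le> x \<and> x \<le> \<theta> * a \<and> x \<le> 1 / 2}. U x y}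
         \<le> exp (- (sqrt lam / 16))"
        unfolding U_def using G(1) n \<open>2 \<le> lam\<close> th
        by (intro upper_block_crude[where a=a and \<theta>=\<theta>]) auto
    qed (use \<open>0 < lam\<close> in auto)
    show "measure (null_law n) (?EU (lam ^ 4 / real n) (1 / lam))
      \<le> (ln (real n) / ln \<theta> + 1) * exp (- (lam\<^sup>2 * ((1 - 1 / lam) / \<theta>) * (1 - exp (1 / lam) / 2)))"
    proof (rule geometric_cover_ratio[OF prob_space_axioms G(1) th(1) _ l4 _ Um])
      fix a assume a: "lam ^ 4 / real n \<le> a"
      then have "0 < a" using n \<open>0 < lam\<close> by (intro less_le_trans[OF _ a]) auto
      then show "measure (null_law n) {y \<in> space (null_law n). \<exists>x\<in>{x\<in>G. a \<le> x \<and> x \<le> \<theta> * a \<and> x \<le> 1 / lam}. U x y}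
         \<le> exp (- (lam\<^sup>2 * ((1 - 1 / lam) / \<theta>) * (1 - exp (1 / lam) / 2)))"
        unfolding U_def using G(1) n \<open>2 \<le> lam\<close> th a
        by (intro upper_block_fine[where a=a and \<theta>=\<theta>]) (auto simp: field_simps)
    next
      have "1 \<le> lam ^ 5" using \<open>2 \<le> lam\<close> by simp
      then show "1 / lam / (lam ^ 4 / real n) \<le> real n"
        using n \<open>0 < lam\<close> by (simp add: field_simps flip: power_Suc)
    qed (use n \<open>0 < lam\<close> in auto)
    show "measure (null_law n) (?EV (1 / real n) (1 / lam))
      \<le> (ln (real n) / ln \<theta> + 1) * exp (- (lam\<^sup>2 * ((1 - 1 / lam) / \<theta>) / 2))"
    proof (rule geometric_cover_ratio[OF prob_space_axioms \<open>finite G'\<close> th(1) _ _ _ Vm])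
      fix a assume a: "1 / real n \<le> a"
      then have "0 < a" using n by (intro less_le_trans[OF _ a]) auto
      then show "measure (null_law n) {y \<in> space (null_law n). \<exists>x\<in>{x\<in>G'. a \<le> x \<and> x \<le> \<theta> * a \<and> x \<le> 1 / lam}. V x y}
         \<le> exp (- (lam\<^sup>2 * ((1 - 1 / lam) / \<theta>) / 2))"
        unfolding V_def using \<open>finite G'\<close> n \<open>2 \<le> lam\<close> th
        by (intro lower_block_bound[where a=a and \<theta>=\<theta>]) auto
    next
      show "1 / lam / (1 / real n) \<le> real n" "1 / real n \<le> 1 / lam"
        using n \<open>2 \<le> lam\<close> lamn by (auto simp: field_simps)
    qed (use n in auto)
    show "measure (null_law n) (?EV (1 / lam) (1 / 2))
      \<le> (ln lam / ln \<theta> + 1) * exp (- (lam\<^sup>2 * ((1 - 1 / 2) / \<theta>) / 2))"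
    proof (rule geometric_cover_ratio[OF prob_space_axioms \<open>finite G'\<close> th(1) _ l12 _ Vm])
      fix a assume a: "1 / lam \<le> a"
      then have "0 < a" using \<open>0 < lam\<close> by (intro less_le_trans[OF _ a]) auto
      then show "measure (null_law n) {y \<in> space (null_law n). \<exists>x\<in>{x\<in>G'. a \<le> x \<and> x \<le> \<theta> * a \<and> x \<le> 1 / 2}. V x y}
         \<le> exp (- (lam\<^sup>2 * ((1 - 1 / 2) / \<theta>) / 2))"
        unfolding V_def using \<open>finite G'\<close> n \<open>2 \<le> lam\<close> th
        by (intro lower_block_bound[where a=a and \<theta>=\<theta>]) auto
    qed (use \<open>0 < lam\<close> in auto)
  qed
  finally show ?thesis .
qed

lemma type_I_error_tendsto_0:
  assumes "0 < \<delta>"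
  shows "(\<lambda>n. type_I_error \<delta> (c n) n) \<longlonglongrightarrow> 0"
proof -
  \<comment> \<open>Strictly below \<open>1 + \<delta>\<close>, so that the exponent per block,
    \<open>(1 + \<delta>) / \<theta>\<close> in units of \<open>ln (ln n)\<close>, still exceeds 1;
    \<gamma> is half of that excess. The minimum with 1 ensures
    \<open>\<theta> \<le> 2\<close>.\<close>
  define \<theta> where "\<theta> = 1 + min \<delta> 1 / 2"
  have th: "1 < \<theta>" "\<theta> \<le> 2" "\<theta> < 1 + \<delta>" using assms by (auto simp: \<theta>_def)
  define K where "K = ln \<theta>"
  have "0 < K" using th by (simp add: K_def)
  define \<gamma> where "\<gamma> = ((1 + \<delta>) / \<theta> - 1) / 2"
  define r where "r = (1 + \<delta>) / \<theta>"
  have "1 < r" using th by (simp add: r_def)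
  then have "0 < (r - 1) / 2" "1 + (r - 1) / 2 < r" by (simp_all add: field_simps)
  then have ga: "0 < \<gamma>" "1 + \<gamma> < (1 + \<delta>) / \<theta>" unfolding \<gamma>_def r_def by blast+
  define lam where "lam n = sqrt (2 * (1 + \<delta>) * ln (ln (real n)))" for n :: nat
  have lam_top: "filterlim lam at_top at_top"
    unfolding lam_def using assms by real_asymp
  have ev5: "eventually (\<lambda>n. lam n ^ 5 \<le> real n) at_top"
    unfolding lam_def using assms by real_asymp
  have evL: "eventually (\<lambda>n. 0 < ln (ln (real n))) at_top"
    by real_asymp
  have ev2: "eventually (\<lambda>n. 2 \<le> lam n) at_top"
    using lam_top by (simp add: filterlim_at_top)
  \<comment> \<open>The number of blocks is of order \<open>ln n\<close>, against
    \<open>ln n\<close> to the power \<open>-(1 + \<gamma>)\<close>. One power of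
    \<open>ln n\<close> is split off so that the product has the finite limit
    \<open>inverse K\<close>.\<close>
  have g: "((\<lambda>n. (ln (real n) / K + 1) * exp (- ((1 + \<gamma>) * ln (ln (real n))))) \<longlongrightarrow> 0) at_top"
  proof -
    have "((\<lambda>n. (ln (real n) / K + 1) * exp (- ln (ln (real n)))) \<longlongrightarrow> inverse K) at_top"
      using \<open>0 < K\<close> by real_asymp
    moreover have "((\<lambda>n. exp (- (\<gamma> * ln (ln (real n))))) \<longlongrightarrow> 0) at_top"
      using ga(1) by real_asymp
    ultimately have "((\<lambda>n. (ln (real n) / K + 1) * exp (- ln (ln (real n))) * exp (- (\<gamma> * ln (ln (real n))))) \<longlongrightarrow> inverse K * 0) at_top"
      by (rule tendsto_mult)
    then show ?thesis by (simp add: mult.assoc distrib_right flip: exp_add)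
  qed
  \<comment> \<open>In units of \<open>ln (ln n)\<close>, the exponents of the fine upper blocks
    (\<open>h\<close>) and of the lower blocks up to \<open>1 / lam\<close> (\<open>h'\<close>);
    both tend to \<open>(1 + \<delta>) / \<theta>\<close>.\<close>
  define h where "h l = (1 + \<delta>) * ((1 - 1 / l) / \<theta>) * (2 - exp (1 / l))" for l :: real
  define h' where "h' l = (1 + \<delta>) * ((1 - 1 / l) / \<theta>)" for l :: real
  have "(h \<longlongrightarrow> (1 + \<delta>) * ((1 - 0) / \<theta>) * (2 - exp 0)) at_top"
    unfolding h_def by (intro tendsto_intros tendsto_divide_0[OF tendsto_const] filterlim_at_top_imp_at_infinity filterlim_ident)
      (use th in auto)
  then have "eventually (\<lambda>l. 1 + \<gamma> < h l) at_top"
    by (rule order_tendstoD) (use ga in simp)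
  then have evh: "eventually (\<lambda>n. 1 + \<gamma> < h (lam n)) at_top"
    using lam_top by (rule eventually_compose_filterlim)
  have "(h' \<longlongrightarrow> (1 + \<delta>) * ((1 - 0) / \<theta>)) at_top"
    unfolding h'_def by (intro tendsto_intros tendsto_divide_0[OF tendsto_const] filterlim_at_top_imp_at_infinity filterlim_ident)
      (use th in auto)
  then have "eventually (\<lambda>l. 1 + \<gamma> < h' l) at_top"
    by (rule order_tendstoD) (use ga in simp)
  then have evh': "eventually (\<lambda>n. 1 + \<gamma> < h' (lam n)) at_top"
    using lam_top by (rule eventually_compose_filterlim)
  \<comment> \<open>The terms that depend on \<open>n\<close> through \<open>lam\<close> alone;
    their block numbers grow only like \<open>ln lam\<close>.\<close>
  define u where "u l = 1 / l + (ln (l ^ 5) / K + 1) * exp (- (sqrt l / 16)) + (ln l / K + 1) * exp (- (sqrt l / 16))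
    + (ln l / K + 1) * exp (- (l\<^sup>2 * ((1 - 1 / 2) / \<theta>) / 2))" for l :: real
  have "(u \<longlongrightarrow> 0) at_top"
    unfolding u_def using \<open>0 < K\<close> th by real_asymp
  then have "((\<lambda>n. u (lam n)) \<longlongrightarrow> 0) at_top"
    using lam_top by (rule filterlim_compose)
  from tendsto_add[OF this tendsto_add[OF g g]]
  have lim: "((\<lambda>n. u (lam n) + ((ln (real n) / K + 1) * exp (- ((1 + \<gamma>) * ln (ln (real n))))
      + (ln (real n) / K + 1) * exp (- ((1 + \<gamma>) * ln (ln (real n)))))) \<longlongrightarrow> 0) at_top"
    by simp
  show ?thesis
  proof (rule tendsto_sandwich[OF _ _ tendsto_const lim])
    show "eventually (\<lambda>n. 0 \<le> type_I_error \<delta> (c n) n) sequentially"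
      by (simp add: type_I_error_def)
    show "eventually (\<lambda>n. type_I_error \<delta> (c n) n \<le> u (lam n) + ((ln (real n) / K + 1) * exp (- ((1 + \<gamma>) * ln (ln (real n))))
      + (ln (real n) / K + 1) * exp (- ((1 + \<gamma>) * ln (ln (real n)))))) sequentially"
      using ev5 ev2 evL evh evh' eventually_ge_at_top[of 1]
    proof eventually_elim
      case (elim n)
      let ?L = "ln (ln (real n))"
      have lam2: "(lam n)\<^sup>2 = 2 * (1 + \<delta>) * ?L"
        unfolding lam_def using elim assms by simp
      have "(1 + \<gamma>) * ?L \<le> h (lam n) * ?L" "(1 + \<gamma>) * ?L \<le> h' (lam n) * ?L"
        using elim by (auto intro!: mult_right_mono)
      then have e: "exp (- ((lam n)\<^sup>2 * ((1 - 1 / lam n) / \<theta>) * (1 - exp (1 / lam n) / 2))) \<le> exp (- ((1 + \<gamma>) * ?L))"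
        "exp (- ((lam n)\<^sup>2 * ((1 - 1 / lam n) / \<theta>) / 2)) \<le> exp (- ((1 + \<gamma>) * ?L))"
      proof -
        have "2 * (1 + \<delta>) * ?L * X * (1 - E / 2) = (1 + \<delta>) * X * (2 - E) * ?L" "2 * (1 + \<delta>) * ?L * X / 2 = (1 + \<delta>) * X * ?L"
          for X E :: real
          by (simp_all add: algebra_simps)
        then show "exp (- ((lam n)\<^sup>2 * ((1 - 1 / lam n) / \<theta>) * (1 - exp (1 / lam n) / 2))) \<le> exp (- ((1 + \<gamma>) * ?L))"
          "exp (- ((lam n)\<^sup>2 * ((1 - 1 / lam n) / \<theta>) / 2)) \<le> exp (- ((1 + \<gamma>) * ?L))"
          using \<open>(1 + \<gamma>) * ?L \<le> h (lam n) * ?L\<close> \<open>(1 + \<gamma>) * ?L \<le> h' (lam n) * ?L\<close>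
          unfolding lam2 h_def h'_def by (simp_all only: exp_le_cancel_iff neg_le_iff_le)
      qed
      have nn: "0 \<le> ln (real n) / K + 1" using \<open>0 < K\<close> elim by (auto intro!: add_nonneg_nonneg)
      from type_I_error_le[OF lam_def elim(2) elim(1) th(1,2), of "c n"]
        mult_left_mono[OF e(1) nn] mult_left_mono[OF e(2) nn]
      show ?case unfolding u_def K_def by linarith
    qed
  qed
qed

subsection \<open>The Gumbel-max decoder\<close>

lemma space_vecM [simp]: "space vecM = UNIV"
  by (simp add: vecM_def space_PiM)

lemma measurable_vecM_component [measurable]: "(\<lambda>U. U v) \<in> borel_measurable (vecM :: ('w::finite \<Rightarrow> real) measure)"
  unfolding vecM_def by measurable

lemma sets_unifvec [measurable_cong]: "sets (unifvec :: ('w::finite \<Rightarrow> real) measure) = sets vecM"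
  unfolding unifvec_def vecM_def by (intro sets_PiM_cong) auto

lemma space_unifvec [simp]: "space (unifvec :: ('w::finite \<Rightarrow> real) measure) = UNIV"
  by (simp add: unifvec_def space_PiM)

lemma prob_space_unifvec: "prob_space (unifvec :: ('w::finite \<Rightarrow> real) measure)"
  unfolding unifvec_def by (intro prob_space_PiM prob_space_unif01)

text \<open>The choice operator hidden in \<open>ARG_MAX\<close> is harmless because the decoder
  factors through the set \<open>Z\<close> of maximisers: that set has finitely many possible
  values, and any function on a discrete space is measurable.\<close>

lemma measurable_gumbel_dec:
  "(\<lambda>p. gumbel_dec (fst p) (snd p)) \<in> (vecM :: ('w::finite \<Rightarrow> real) measure) \<Otimes>\<^sub>M vecM \<rightarrow>\<^sub>M count_space UNIV"
proof -
  let ?M = "(vecM :: ('w \<Rightarrow> real) measure) \<Otimes>\<^sub>M vecM"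
  define Z where "Z p = {v. is_arg_max (\<lambda>v. ln (snd p v) / fst p v) (\<lambda>v. 0 < fst p v) v}"
    for p :: "('w \<Rightarrow> real) \<times> ('w \<Rightarrow> real)"
  have "Z \<in> ?M \<rightarrow>\<^sub>M count_space UNIV"
  proof (subst measurable_count_space_eq2, simp, intro conjI ballI)
    fix S :: "'w set"
    have [measurable]: "(\<lambda>p. fst p v) \<in> borel_measurable ?M" "(\<lambda>p. snd p v) \<in> borel_measurable ?M" for v :: 'w
      by (rule measurable_compose[OF measurable_fst measurable_vecM_component],
          rule measurable_compose[OF measurable_snd measurable_vecM_component])
    have "Measurable.pred ?M (\<lambda>p. \<forall>v. is_arg_max (\<lambda>v. ln (snd p v) / fst p v) (\<lambda>v. 0 < fst p v) v \<longleftrightarrow> v \<in> S)"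
      unfolding is_arg_max_def by measurable
    also have "(\<lambda>p. \<forall>v. is_arg_max (\<lambda>v. ln (snd p v) / fst p v) (\<lambda>v. 0 < fst p v) v \<longleftrightarrow> v \<in> S) = (\<lambda>p. Z p = S)"
      by (auto simp: Z_def fun_eq_iff)
    finally show "Z -` {S} \<inter> space ?M \<in> sets ?M"
      by (simp add: pred_def vimage_def Int_def conj_commute)
  qed simp
  then have "(\<lambda>p. SOME v. v \<in> Z p) \<in> ?M \<rightarrow>\<^sub>M count_space UNIV"
    by (rule measurable_compose) simp
  then show ?thesis by (simp add: Z_def gumbel_dec_def arg_max_def)
qed

text \<open>The hypothesis is the comparison of \<open>ln U / P\<close> in exponentiated form: given
  \<open>U v\<close>, it confines every other coordinate to an interval, so that the winning event
  becomes a box. Strictness makes the maximiser unique and settles the choice.\<close>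

lemma gumbel_dec_eqI:
  assumes "0 < P v" "0 < U v" and "\<And>u. u \<noteq> v \<Longrightarrow> 0 < U u \<and> U u < U v powr (P u / P v)"
  shows "gumbel_dec P U = v"
proof -
  have less: "ln (U u) / P u < ln (U v) / P v" if "u \<noteq> v" "0 < P u" for u
  proof -
    have "ln (U u) < ln (U v powr (P u / P v))"
      using assms(2) assms(3)[OF that(1)] by (subst ln_less_cancel_iff) auto
    also have "\<dots> = P u / P v * ln (U v)" using assms(2) by (simp add: ln_powr)
    finally show ?thesis using that assms(1) by (simp add: field_simps)
  qed
  show ?thesis
    unfolding gumbel_dec_def arg_max_def
  proof (rule some_equality)
    show "is_arg_max (\<lambda>v. ln (U v) / P v) (\<lambda>v. 0 < P v) v"
      unfolding is_arg_max_def using assms(1) less by (metis less_asym less_irrefl)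
    fix u assume "is_arg_max (\<lambda>v. ln (U v) / P v) (\<lambda>v. 0 < P v) u"
    then show "u = v" unfolding is_arg_max_def using assms(1) less by metis
  qed
qed

lemma nn_integral_unif01:
  assumes [measurable]: "f \<in> borel_measurable borel"
  shows "(\<integral>\<^sup>+z. f z \<partial>unif01) = (\<integral>\<^sup>+z. f z * indicator {0..1} z \<partial>lborel)"
  unfolding unif01_def by (simp add: nn_integral_uniform_measure divide_ennreal_def)

lemma emeasure_unif01_less:
  assumes "0 \<le> b" "b \<le> 1"
  shows "emeasure unif01 {0<..<b} = ennreal b"
proof -
  interpret prob_space unif01 by (rule prob_space_unif01)
  have "{0..1} \<inter> {0<..<b} = {0<..<b}" using assms by auto
  then show ?thesis using assms by (simp add: emeasure_eq_measure measure_unif01)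
qed

text \<open>Given \<open>U v = z\<close>, all others lose with probability at least the product of
  \<open>z powr (P u / P v)\<close>, which is \<open>z powr (1 / P v - 1)\<close>; integrating over
  \<open>z \<ge> 1 - x\<close> gives the claim. Summed over \<open>v\<close> of positive
  probability, the bounds give \<open>1 - F (1 - x)\<close> with \<open>F\<close> the CDF
  \<open>F_{1,P}\<close>.\<close>

lemma gumbel_win_prob:
  fixes P :: "'w::finite \<Rightarrow> real"
  assumes "prob_vec P" "0 < P v" "0 \<le> x" "x < 1"
  shows "ennreal (P v * (1 - (1 - x) powr (1 / P v)))
           \<le> emeasure unifvec {U. gumbel_dec P U = v \<and> 1 - x \<le> U v}"
proof -
  interpret prob_space unif01 by (rule prob_space_unif01)
  interpret product_sigma_finite "\<lambda>_::'w. unif01" by standard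
  define I where "I = UNIV - {v}"
  have UNIV_I: "UNIV = insert v I" "v \<notin> I" "finite I" by (auto simp: I_def)
  let ?PI = "PiM I (\<lambda>_. unif01)"
  interpret P: prob_space ?PI by (intro prob_space_PiM prob_space_unif01)
  define r where "r = 1 - x"
  have r: "0 < r" "r \<le> 1" using assms by (auto simp: r_def)
  have Pnn: "0 \<le> P u" for u using assms(1) by (simp add: prob_vec_def)
  have Psum: "(\<Sum>u\<in>I. P u) = 1 - P v"
    using assms(1) sum.insert[OF UNIV_I(3,2), of P] UNIV_I(1) by (simp add: prob_vec_def)
  define E where "E = {U. r \<le> U v \<and> (\<forall>u\<in>I. 0 < U u \<and> U u < U v powr (P u / P v))}"
  have [measurable]: "E \<in> sets (unifvec :: ('w \<Rightarrow> real) measure)"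
  proof -
    have "Measurable.pred (vecM :: ('w \<Rightarrow> real) measure) (\<lambda>U. r \<le> U v \<and> (\<forall>u\<in>I. 0 < U u \<and> U u < U v powr (P u / P v)))"
      by measurable
    then show ?thesis by (simp add: sets_unifvec pred_def E_def)
  qed
  have meas: "{U. gumbel_dec P U = v \<and> 1 - x \<le> U v} \<in> sets (unifvec :: ('w \<Rightarrow> real) measure)"
  proof -
    have "(\<lambda>U. (P, U)) \<in> vecM \<rightarrow>\<^sub>M vecM \<Otimes>\<^sub>M vecM" by (rule measurable_Pair1') simp
    from measurable_compose[OF this measurable_gumbel_dec]
    have [measurable]: "gumbel_dec P \<in> vecM \<rightarrow>\<^sub>M count_space UNIV" by simp
    have "Measurable.pred vecM (\<lambda>U. gumbel_dec P U = v \<and> 1 - x \<le> U v)" by measurable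
    then show ?thesis by (simp add: sets_unifvec pred_def)
  qed
  have "ennreal (P v * (1 - (1 - x) powr (1 / P v))) = ennreal (P v * 1 powr (1 / P v) - P v * r powr (1 / P v))"
    by (simp add: r_def algebra_simps)
  also have "\<dots> = (\<integral>\<^sup>+z. ennreal (z powr (1 / P v - 1)) * indicator {r..1} z \<partial>lborel)"
  proof (subst nn_integral_FTC_Icc[where F="\<lambda>z. P v * z powr (1 / P v)"])
    fix z assume "z \<in> {r..1}"
    then have "0 < z" using r by auto
    then show "((\<lambda>z. P v * z powr (1 / P v)) has_real_derivative z powr (1 / P v - 1)) (at z)"
      using \<open>0 < P v\<close> by (auto intro!: derivative_eq_intros)
  qed (use r in auto)
  also have "\<dots> = (\<integral>\<^sup>+z. ennreal (z powr (1 / P v - 1)) * indicator {r..} z \<partial>unif01)"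
    using r by (subst nn_integral_unif01) (auto intro!: nn_integral_cong simp: indicator_def)
  also have "\<dots> = (\<integral>\<^sup>+z. (\<integral>\<^sup>+y. indicator E (y(v := z)) \<partial>?PI) \<partial>unif01)"
  proof (rule nn_integral_cong_AE, use AE_unif01 in eventually_elim)
    fix z :: real assume z: "0 \<le> z \<and> z \<le> 1"
    show "ennreal (z powr (1 / P v - 1)) * indicator {r..} z = (\<integral>\<^sup>+y. indicator E (y(v := z)) \<partial>?PI)"
    proof (cases "r \<le> z")
      case True
      then have "0 < z" using r by simp
      have le1: "z powr (P u / P v) \<le> 1" for u
        using z Pnn[of u] \<open>0 < P v\<close> by (intro powr_le1) auto
      have "(\<integral>\<^sup>+y. indicator E (y(v := z)) \<partial>?PI) = (\<integral>\<^sup>+y. indicator (PiE I (\<lambda>u. {0<..<z powr (P u / P v)})) y \<partial>?PI)"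
      proof (rule nn_integral_cong)
        fix y assume "y \<in> space ?PI"
        then have "y \<in> extensional I" by (auto simp: space_PiM PiE_def)
        then have "y(v := z) \<in> E \<longleftrightarrow> y \<in> PiE I (\<lambda>u. {0<..<z powr (P u / P v)})"
          using UNIV_I(2) True by (auto simp: E_def PiE_iff)
        then show "indicator E (y(v := z)) = (indicator (PiE I (\<lambda>u. {0<..<z powr (P u / P v)})) y :: ennreal)"
          by (simp add: indicator_def)
      qed
      also have "\<dots> = emeasure ?PI (PiE I (\<lambda>u. {0<..<z powr (P u / P v)}))"
        using UNIV_I(3) by (intro nn_integral_indicator sets_PiM_I_finite) auto
      also have "\<dots> = (\<Prod>u\<in>I. emeasure unif01 {0<..<z powr (P u / P v)})"
        using UNIV_I(3) by (intro emeasure_PiM) auto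
      also have "\<dots> = (\<Prod>u\<in>I. ennreal (z powr (P u / P v)))"
        using le1 by (intro prod.cong refl emeasure_unif01_less) auto
      also have "\<dots> = ennreal (\<Prod>u\<in>I. z powr (P u / P v))" by (intro prod_ennreal) auto
      also have "(\<Prod>u\<in>I. z powr (P u / P v)) = z powr (\<Sum>u\<in>I. P u / P v)"
        using \<open>0 < z\<close> by (subst powr_sum) auto
      also have "(\<Sum>u\<in>I. P u / P v) = 1 / P v - 1"
        using Psum \<open>0 < P v\<close> by (simp add: sum_divide_distrib[symmetric] diff_divide_distrib)
      finally have *: "(\<integral>\<^sup>+y. indicator E (y(v := z)) \<partial>?PI) = ennreal (z powr (1 / P v - 1))" .
      show ?thesis unfolding * using True by simp
    qed (simp add: E_def)
  qed
  also have "\<dots> = (\<integral>\<^sup>+y. indicator E y \<partial>PiM (insert v I) (\<lambda>_. unif01))"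
    using UNIV_I \<open>E \<in> sets unifvec\<close> by (intro product_nn_integral_insert_rev[symmetric]) (auto simp: unifvec_def)
  also have "\<dots> = emeasure unifvec E"
    unfolding UNIV_I(1)[symmetric] unifvec_def[symmetric] by simp
  also have "\<dots> \<le> emeasure unifvec {U. gumbel_dec P U = v \<and> 1 - x \<le> U v}"
  proof (intro emeasure_mono meas subsetI CollectI conjI)
    fix U assume U: "U \<in> E"
    then show "1 - x \<le> U v" by (simp add: E_def r_def)
    have "0 < U v" using U r by (auto simp: E_def)
    then show "gumbel_dec P U = v" using U \<open>0 < P v\<close> by (intro gumbel_dec_eqI) (auto simp: E_def I_def)
  qed
  finally show ?thesis .
qed

section \<open>The gain from a watermarked token\<close>

text \<open>If some token has more than half the mass, the others share between \<open>D\<close> and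
  \<open>1 / 2\<close>, and one of them has at least \<open>D / CARD('w)\<close>. Otherwise a token
  with at least the average mass will do.\<close>

lemma P_Delta_obtain_medium:
  fixes P :: "'w::finite \<Rightarrow> real"
  assumes "P \<in> P_Delta D" "0 < D" "D \<le> 1"
  obtains v where "D / CARD('w) \<le> P v" "P v \<le> 1 / 2"
proof -
  have P: "\<And>v. 0 \<le> P v" "(\<Sum>v\<in>UNIV. P v) = 1" "\<And>v. P v \<le> 1 - D"
    using assms(1) by (auto simp: P_Delta_def prob_vec_def)
  have K: "1 \<le> CARD('w)" by (simp add: Suc_leI)
  show thesis
  proof (cases "\<exists>w. 1 / 2 < P w")
    case True
    then obtain w where w: "1 / 2 < P w" by blast
    have sw: "(\<Sum>v\<in>UNIV - {w}. P v) = 1 - P w" using P(2) by (simp add: sum_diff1)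
    have "\<exists>v\<in>UNIV - {w}. D / CARD('w) \<le> P v"
    proof (rule ccontr)
      assume "\<not> ?thesis"
      then have "(\<Sum>v\<in>UNIV - {w}. P v) \<le> (\<Sum>v\<in>UNIV - {w}. D / CARD('w))"
        by (intro sum_mono) (auto simp: not_le less_imp_le)
      also have "\<dots> = (real CARD('w) - 1) * (D / CARD('w))" using K by (simp add: of_nat_diff)
      also have "\<dots> < D" using K \<open>0 < D\<close> by (simp add: field_simps)
      finally show False using sw P(3)[of w] by simp
    qed
    then obtain v where v: "v \<noteq> w" "D / CARD('w) \<le> P v" by blast
    have "P v \<le> (\<Sum>v\<in>UNIV - {w}. P v)" using v P(1) by (intro member_le_sum) auto
    then show thesis using that v w sw by simp
  next
    case False
    have "\<exists>v. 1 / CARD('w) \<le> P v"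
    proof (rule ccontr)
      assume "\<not> ?thesis"
      then have "(\<Sum>v\<in>UNIV. P v) < (\<Sum>v\<in>(UNIV::'w set). 1 / CARD('w))"
        by (intro sum_strict_mono) (auto simp: not_le)
      then show False using P(2) by simp
    qed
    then obtain v where "1 / CARD('w) \<le> P v" by blast
    moreover have "D / CARD('w) \<le> 1 / CARD('w)" using assms by (intro divide_right_mono) auto
    moreover have "P v \<le> 1 / 2" using False not_le by blast
    ultimately show thesis using that[of v] order_trans by blast
  qed
qed

text \<open>Every token contributes at least \<open>P v * x\<close>, because
  \<open>1 / P v \<ge> 1\<close> when \<open>P v > 0\<close>. The medium token \<open>w\<close> adds
  \<open>P w * r * (1 - r powr k)\<close> with \<open>k = 1 / P w - 1\<close>. In the constant,
  \<open>1 / K\<close> bounds \<open>r\<close>, \<open>1 / 2\<close> bounds \<open>1 - P w\<close>,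
  and \<open>K + 1\<close> comes from \<open>x \<le> K * P w\<close>.\<close>

lemma gumbel_gain:
  fixes P :: "'w::finite \<Rightarrow> real"
  assumes "P \<in> P_Delta x" "0 < x" "x < 1"
  shows "x + x / (2 * real CARD('w) * (real CARD('w) + 1)) \<le> (\<Sum>v\<in>UNIV. P v * (1 - (1 - x) powr (1 / P v)))"
proof -
  define K where "K = real CARD('w)"
  define r where "r = 1 - x"
  have r: "0 < r" "r < 1" using assms by (auto simp: r_def)
  have P: "\<And>v. 0 \<le> P v" "(\<Sum>v\<in>UNIV. P v) = 1" "\<And>v. P v \<le> r"
    using assms(1) by (auto simp: P_Delta_def prob_vec_def r_def)
  have K1: "1 \<le> K" by (simp add: K_def Suc_leI)
  \<comment> \<open>Entries at most \<open>r\<close> sum to 1. This keeps the surplus from vanishing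
    when \<open>x\<close> is close to 1.\<close>
  have rK: "1 / K \<le> r"
  proof -
    have "1 \<le> (\<Sum>v\<in>(UNIV::'w set). r)" using P(2,3) by (metis sum_mono)
    then show ?thesis using K1 by (simp add: K_def field_simps)
  qed
  have each: "P v * x \<le> P v * (1 - r powr (1 / P v))" for v
  proof (cases "P v = 0")
    case False
    then have "1 \<le> 1 / P v" using P(1)[of v] P(3)[of v] r by simp
    then have "r powr (1 / P v) \<le> r powr 1" using r by (intro powr_mono') auto
    then show ?thesis using r P(1)[of v] by (intro mult_left_mono) (auto simp: r_def)
  qed simp
  obtain w where w: "x / K \<le> P w" "P w \<le> 1 / 2"
    using P_Delta_obtain_medium[OF assms(1,2)] assms(3) unfolding K_def by (metis less_imp_le)
  have Pw: "0 < P w" using w K1 \<open>0 < x\<close> by (smt (verit) divide_pos_pos)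
  have big: "P w * x + x / (2 * K * (K + 1)) \<le> P w * (1 - r powr (1 / P w))"
  proof -
    define k where "k = (1 - P w) / P w"
    have k: "0 \<le> k" "1 / P w = 1 + k" using Pw w by (auto simp: k_def field_simps)
    \<comment> \<open>The target \<open>1 - r powr k \<ge> k * x / (1 + k * x)\<close> is useful for
      small and for large \<open>k * x\<close> alike.\<close>
    have "ln r \<le> - x" using ln_le_minus_one[of r] r by (simp add: r_def)
    then have "k * ln r \<le> k * (- x)" using k by (intro mult_left_mono)
    then have "r powr k \<le> exp (- (k * x))" using r by (simp add: powr_def)
    also have "\<dots> \<le> 1 / (1 + k * x)"
    proof -
      have "0 < 1 + k * x" using k \<open>0 < x\<close> by (intro add_pos_nonneg) auto
      then show ?thesis
        using exp_ge_add_one_self[of "k * x"] by (simp add: exp_minus inverse_eq_divide frac_le)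
    qed
    finally have "r powr k \<le> 1 / (1 + k * x)" .
    moreover have "1 - 1 / (1 + k * x) = k * x / (1 + k * x)"
      using k \<open>0 < x\<close> by (simp add: field_simps add_nonneg_eq_0_iff)
    ultimately have "k * x / (1 + k * x) \<le> 1 - r powr k" by linarith
    then have "P w * r * (k * x / (1 + k * x)) \<le> P w * r * (1 - r powr k)"
      using Pw r by (intro mult_left_mono) auto
    also have "\<dots> = P w * (1 - r powr (1 / P w)) - P w * x"
      using r unfolding k(2) powr_add by (simp add: r_def algebra_simps)
    finally have 1: "P w * r * (k * x / (1 + k * x)) \<le> P w * (1 - r powr (1 / P w)) - P w * x" .
    have "x / (2 * (K + 1)) \<le> P w * (k * x / (1 + k * x))"
    proof -
      have "P w * (k * x / (1 + k * x)) = P w * (1 - P w) * x / (P w + (1 - P w) * x)"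
      proof -
        have Pk: "P w * k = 1 - P w" using Pw by (simp add: k_def)
        have "P w + (1 - P w) * x = P w * (1 + k * x)" unfolding Pk[symmetric] by (simp add: algebra_simps)
        moreover have "P w * (1 - P w) * x = P w * (P w * (k * x))" unfolding Pk[symmetric] by simp
        moreover have "P w \<noteq> 0" using Pw by simp
        ultimately show ?thesis
          by (simp only: nonzero_mult_divide_mult_cancel_left times_divide_eq_right not_False_eq_True)
      qed
      moreover have "x / (2 * (K + 1)) \<le> P w * (1 - P w) * x / (P w + (1 - P w) * x)"
      proof -
        \<comment> \<open>The lower bound on \<open>P w\<close> makes the denominator comparable to
          \<open>P w\<close>, which then cancels however small it is.\<close>
        have "(1 - P w) * x \<le> 1 * x" using Pw \<open>0 < x\<close> by (intro mult_right_mono) auto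
        also have "x \<le> K * P w" using w K1 by (simp add: field_simps)
        finally have "P w + (1 - P w) * x \<le> (K + 1) * P w" by (simp add: algebra_simps)
        then have "P w * (1 / 2) * x / ((K + 1) * P w) \<le> P w * (1 - P w) * x / (P w + (1 - P w) * x)"
          using Pw w \<open>0 < x\<close> by (intro frac_le mult_right_mono mult_left_mono add_pos_nonneg) auto
        moreover have "P w * (1 / 2) * x / ((K + 1) * P w) = x / (2 * (K + 1))" using Pw by simp
        ultimately show ?thesis by simp
      qed
      ultimately show ?thesis by simp
    qed
    then have "1 / K * (x / (2 * (K + 1))) \<le> r * (P w * (k * x / (1 + k * x)))"
      using rK r K1 \<open>0 < x\<close> by (intro mult_mono) auto
    moreover have "1 / K * (x / (2 * (K + 1))) = x / (2 * K * (K + 1))" by simp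
    ultimately show ?thesis using 1 by (simp add: mult_ac)
  qed
  have "x + x / (2 * K * (K + 1)) = (P w * x + x / (2 * K * (K + 1))) + (\<Sum>v\<in>UNIV - {w}. P v * x)"
  proof -
    have "(\<Sum>v\<in>UNIV. P v * x) = x" using P(2) by (simp add: sum_distrib_right[symmetric])
    then show ?thesis by (simp add: sum.remove[of UNIV w])
  qed
  also have "\<dots> \<le> P w * (1 - r powr (1 / P w)) + (\<Sum>v\<in>UNIV - {w}. P v * (1 - r powr (1 / P v)))"
    by (intro add_mono big sum_mono each)
  also have "\<dots> = (\<Sum>v\<in>UNIV. P v * (1 - r powr (1 / P v)))"
    by (simp add: sum.remove[of UNIV w])
  finally show ?thesis unfolding K_def r_def .
qed

section \<open>Histories and integration over a past event\<close>

lemma hist_sets_sigma_algebra: "sigma_algebra (space M) (hist_sets M Pt xi w t)"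
  unfolding hist_sets_def by (intro sigma_algebra_sigma_sets) auto

lemma hist_sets_P:
  assumes "1 \<le> j" "j \<le> t" "C \<in> sets vecM"
  shows "Pt j -` C \<inter> space M \<in> hist_sets M Pt xi w t"
  unfolding hist_sets_def
  by (rule sigma_sets.Basic, rule UnI2, rule UN_I[of j]) (use assms in auto)

lemma hist_sets_w:
  assumes "1 \<le> j" "j < t"
  shows "w j -` B \<inter> space M \<in> hist_sets M Pt xi w t"
  unfolding hist_sets_def
  by (rule sigma_sets.Basic, rule UnI1, rule UN_I[of j]) (use assms in auto)

lemma hist_sets_xi:
  assumes "1 \<le> j" "j < t" "C \<in> sets vecM"
  shows "xi j -` C \<inter> space M \<in> hist_sets M Pt xi w t"
  unfolding hist_sets_def
  by (rule sigma_sets.Basic, rule UnI1, rule UN_I[of j]) (use assms in auto)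

lemma hist_sets_subset:
  assumes "\<And>j. 1 \<le> j \<Longrightarrow> j \<le> t \<Longrightarrow> Pt j \<in> M \<rightarrow>\<^sub>M vecM \<and> xi j \<in> M \<rightarrow>\<^sub>M vecM \<and> w j \<in> M \<rightarrow>\<^sub>M count_space UNIV"
  shows "hist_sets M Pt xi w t \<subseteq> sets M"
  unfolding hist_sets_def
proof (rule sets.sigma_sets_subset, rule subsetI)
  fix A assume "A \<in> (\<Union>j\<in>{1..<t}. {w j -` B \<inter> space M | B. True} \<union> {xi j -` C \<inter> space M | C. C \<in> sets vecM})
      \<union> (\<Union>j\<in>{1..t}. {Pt j -` C \<inter> space M | C. C \<in> sets vecM})"
  then consider j B where "1 \<le> j" "j < t" "A = w j -` B \<inter> space M"
    | j C where "1 \<le> j" "j < t" "A = xi j -` C \<inter> space M" "C \<in> sets vecM"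
    | j C where "1 \<le> j" "j \<le> t" "A = Pt j -` C \<inter> space M" "C \<in> sets vecM"
    by auto
  then show "A \<in> sets M"
  proof cases
    case (1 j B)
    then show ?thesis using assms[of j] measurable_sets[of "w j" M "count_space UNIV" B] by simp
  next
    case (2 j C)
    then show ?thesis using assms[of j] measurable_sets[of "xi j" M vecM C] by simp
  next
    case (3 j C)
    then show ?thesis using assms[of j] measurable_sets[of "Pt j" M vecM C] by simp
  qed
qed

text \<open>Fubini on a past event: restricted to \<open>A\<close>, the law of \<open>(X, Y)\<close>
  is the product of the restricted law of \<open>X\<close> and \<open>unifvec\<close>, as rectangles
  show. It allows the random token distribution to be frozen while the decoder is analysed.\<close>

lemma emeasure_indep_pair:
  fixes X Y :: "'a \<Rightarrow> 'w::finite \<Rightarrow> real" and g :: "('w \<Rightarrow> real) \<Rightarrow> ennreal"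
  assumes "prob_space M" and X: "X \<in> M \<rightarrow>\<^sub>M vecM" and Y: "Y \<in> M \<rightarrow>\<^sub>M vecM"
    and A[measurable]: "A \<in> sets M" and distr: "distr M vecM Y = unifvec"
    and indep: "\<And>B C. B \<in> sets vecM \<Longrightarrow> C \<in> sets vecM \<Longrightarrow>
        measure M (A \<inter> X -` B \<inter> Y -` C) = measure M (A \<inter> X -` B) * measure M (Y -` C \<inter> space M)"
    and D: "D \<in> sets (vecM \<Otimes>\<^sub>M vecM)"
  shows "emeasure M {\<omega> \<in> A. (X \<omega>, Y \<omega>) \<in> D} = (\<integral>\<^sup>+\<omega>. indicator A \<omega> * emeasure unifvec (Pair (X \<omega>) -` D) \<partial>M)"
proof -
  interpret prob_space M by fact
  interpret U: prob_space "unifvec :: ('w \<Rightarrow> real) measure" by (rule prob_space_unifvec)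
  note [measurable] = X Y
  have AM: "A \<subseteq> space M" by (rule sets.sets_into_space[OF A])
  \<comment> \<open>Restriction instead of conditioning: nothing is divided by the probability of
    \<open>A\<close>, which may be 0.\<close>
  define MA where "MA = density M (indicator A)"
  have sMA[simp, measurable_cong]: "sets MA = sets M" "space MA = space M" by (simp_all add: MA_def)
  have eMA: "emeasure MA B = emeasure M (A \<inter> B)" if "B \<in> sets M" for B
    using that by (simp add: MA_def emeasure_density indicator_inter_arith[symmetric] mult.commute)
  define \<nu> where "\<nu> = distr MA vecM X"
  have e\<nu>: "emeasure \<nu> B = emeasure M (A \<inter> X -` B)" if "B \<in> sets vecM" for B
  proof -
    have "emeasure \<nu> B = emeasure MA (X -` B \<inter> space M)"
      unfolding \<nu>_def using that by (subst emeasure_distr) auto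
    also have "\<dots> = emeasure M (A \<inter> (X -` B \<inter> space M))"
      using that by (intro eMA) auto
    also have "A \<inter> (X -` B \<inter> space M) = A \<inter> X -` B" using AM by auto
    finally show ?thesis .
  qed
  have "finite_measure \<nu>"
  proof
    have "emeasure \<nu> (space \<nu>) = emeasure M (A \<inter> X -` UNIV)"
      using e\<nu>[of UNIV] sets.top[of vecM] by (simp add: \<nu>_def)
    then show "emeasure \<nu> (space \<nu>) \<noteq> \<infinity>" by simp
  qed
  then interpret nu: finite_measure \<nu> .
  have snu[measurable_cong]: "sets \<nu> = sets vecM" by (simp add: \<nu>_def)
  have pair: "\<nu> \<Otimes>\<^sub>M unifvec = distr MA (vecM \<Otimes>\<^sub>M vecM) (\<lambda>\<omega>. (X \<omega>, Y \<omega>))"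
  proof (rule pair_measure_eqI)
    show "sigma_finite_measure \<nu>" "sigma_finite_measure (unifvec :: ('w \<Rightarrow> real) measure)"
      by unfold_locales
    show "sets (\<nu> \<Otimes>\<^sub>M unifvec) = sets (distr MA (vecM \<Otimes>\<^sub>M vecM) (\<lambda>\<omega>. (X \<omega>, Y \<omega>)))"
      unfolding sets_distr by (rule sets_pair_measure_cong[OF snu sets_unifvec])
    fix B C assume "B \<in> sets \<nu>" "C \<in> sets (unifvec :: ('w \<Rightarrow> real) measure)"
    then have BC[measurable]: "B \<in> sets vecM" "C \<in> sets vecM" using snu sets_unifvec by auto
    have "emeasure (distr MA (vecM \<Otimes>\<^sub>M vecM) (\<lambda>\<omega>. (X \<omega>, Y \<omega>))) (B \<times> C)
        = emeasure MA ((\<lambda>\<omega>. (X \<omega>, Y \<omega>)) -` (B \<times> C) \<inter> space MA)"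
      by (intro emeasure_distr) auto
    also have "\<dots> = emeasure M (A \<inter> ((\<lambda>\<omega>. (X \<omega>, Y \<omega>)) -` (B \<times> C) \<inter> space M))"
      using measurable_sets[of "\<lambda>\<omega>. (X \<omega>, Y \<omega>)" M "vecM \<Otimes>\<^sub>M vecM" "B \<times> C"]
      unfolding sMA(2) by (intro eMA) auto
    also have "A \<inter> ((\<lambda>\<omega>. (X \<omega>, Y \<omega>)) -` (B \<times> C) \<inter> space M) = A \<inter> X -` B \<inter> Y -` C"
      using AM by auto
    also have "emeasure M (A \<inter> X -` B \<inter> Y -` C) = ennreal (measure M (A \<inter> X -` B)) * ennreal (measure M (Y -` C \<inter> space M))"
      by (simp add: emeasure_eq_measure indep[OF BC] ennreal_mult)
    also have "ennreal (measure M (Y -` C \<inter> space M)) = emeasure unifvec C"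
      unfolding distr[symmetric] by (simp add: emeasure_distr emeasure_eq_measure)
    also have "ennreal (measure M (A \<inter> X -` B)) = emeasure \<nu> B"
      by (simp add: e\<nu> emeasure_eq_measure)
    finally show "emeasure \<nu> B * emeasure unifvec C = emeasure (distr MA (vecM \<Otimes>\<^sub>M vecM) (\<lambda>\<omega>. (X \<omega>, Y \<omega>))) (B \<times> C)" ..
  qed
  have D': "D \<in> sets (\<nu> \<Otimes>\<^sub>M unifvec)"
    unfolding sets_pair_measure_cong[OF snu sets_unifvec] by (rule D)
  have "{\<omega> \<in> A. (X \<omega>, Y \<omega>) \<in> D} = A \<inter> ((\<lambda>\<omega>. (X \<omega>, Y \<omega>)) -` D \<inter> space M)" using AM by auto
  then have "emeasure M {\<omega> \<in> A. (X \<omega>, Y \<omega>) \<in> D} = emeasure MA ((\<lambda>\<omega>. (X \<omega>, Y \<omega>)) -` D \<inter> space M)"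
    using D measurable_sets[of "\<lambda>\<omega>. (X \<omega>, Y \<omega>)" M "vecM \<Otimes>\<^sub>M vecM" D] by (subst eMA) auto
  also have "\<dots> = emeasure (distr MA (vecM \<Otimes>\<^sub>M vecM) (\<lambda>\<omega>. (X \<omega>, Y \<omega>))) D"
    using D by (subst emeasure_distr) auto
  also have "\<dots> = (\<integral>\<^sup>+P. emeasure unifvec (Pair P -` D) \<partial>\<nu>)"
    unfolding pair[symmetric] by (rule U.emeasure_pair_measure_alt[OF D'])
  also have "\<dots> = (\<integral>\<^sup>+\<omega>. emeasure unifvec (Pair (X \<omega>) -` D) \<partial>MA)"
  proof -
    have "(\<lambda>P. emeasure unifvec (Pair P -` D)) \<in> borel_measurable vecM"
      using U.measurable_emeasure_Pair[OF D'] by (simp cong: measurable_cong_sets[OF snu refl])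
    then show ?thesis unfolding \<nu>_def by (subst nn_integral_distr) auto
  qed
  also have "\<dots> = (\<integral>\<^sup>+\<omega>. indicator A \<omega> * emeasure unifvec (Pair (X \<omega>) -` D) \<partial>M)"
  proof -
    have "(\<lambda>P. emeasure unifvec (Pair P -` D)) \<in> borel_measurable vecM"
      using U.measurable_emeasure_Pair[OF D'] by (simp cong: measurable_cong_sets[OF snu refl])
    then have "(\<lambda>\<omega>. emeasure unifvec (Pair (X \<omega>) -` D)) \<in> borel_measurable M"
      by (rule measurable_compose[OF X])
    then show ?thesis unfolding MA_def by (subst nn_integral_density) auto
  qed
  finally show ?thesis .
qed

subsection \<open>Type II error\<close>

text \<open>The p-value of an unwatermarked token is at most \<open>x\<close> with probability
  exactly \<open>x\<close>; for a watermarked one the probability is at least \<open>g\<close>, from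
  \<open>gumbel_gain\<close> integrated over the law of \<open>Pt t\<close> on \<open>A\<close>. The
  mixture gives \<open>x + eps * (g - x)\<close>.\<close>

lemma gumbel_model_cond_prob:
  fixes Pt xi :: "nat \<Rightarrow> 'a \<Rightarrow> 'w::finite \<Rightarrow> real"
  assumes model: "gumbel_model M eps Pt xi w n" and t: "t \<in> {1..n}" and A: "A \<in> hist_sets M Pt xi w t"
    and eps: "0 \<le> eps" "eps \<le> 1" and x: "0 < x" "x < 1"
    and AE: "AE \<omega> in M. \<forall>t\<in>{1..n}. Pt t \<omega> \<in> P_Delta x"
  shows "(x + eps * (x / (2 * real CARD('w) * (real CARD('w) + 1)))) * measure M A
           \<le> measure M (A \<inter> {\<omega>. 1 - xi t \<omega> (w t \<omega>) \<le> x})"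
proof -
  define g where "g = x + x / (2 * real CARD('w) * (real CARD('w) + 1))"
  have "0 \<le> g" using x by (simp add: g_def)
  have m: "prob_space M"
    and meas: "\<And>t. t \<in> {1..n} \<Longrightarrow> Pt t \<in> M \<rightarrow>\<^sub>M vecM \<and> xi t \<in> M \<rightarrow>\<^sub>M vecM \<and> w t \<in> M \<rightarrow>\<^sub>M count_space UNIV"
    and distr: "distr M vecM (xi t) = unifvec"
    and indep: "\<And>A C. A \<in> hist_sets M Pt xi w t \<Longrightarrow> C \<in> sets vecM \<Longrightarrow>
        measure M (A \<inter> xi t -` C) = measure M A * measure M (xi t -` C \<inter> space M)"
    and mix: "\<And>C v. C \<in> sets vecM \<Longrightarrow>
        measure M (A \<inter> xi t -` C \<inter> {\<omega>. w t \<omega> = v})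
          = eps * measure M (A \<inter> xi t -` C \<inter> {\<omega>. gumbel_dec (Pt t \<omega>) (xi t \<omega>) = v})
            + (1 - eps) * set_lebesgue_integral M A (\<lambda>\<omega>. Pt t \<omega> v) * measure M (xi t -` C \<inter> space M)"
    using model t A unfolding gumbel_model_def by blast+
  interpret prob_space M by fact
  have [measurable]: "Pt t \<in> M \<rightarrow>\<^sub>M vecM" "xi t \<in> M \<rightarrow>\<^sub>M vecM" "w t \<in> M \<rightarrow>\<^sub>M count_space UNIV"
    using meas[OF t] by auto
  have A_sets[measurable]: "A \<in> sets M"
    using hist_sets_subset[of t Pt M xi w] meas t A by auto
  have AM: "A \<subseteq> space M" by (rule sets.sets_into_space[OF A_sets])
  have AE_t: "AE \<omega> in M. Pt t \<omega> \<in> P_Delta x"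
    using AE t by (auto elim!: eventually_mono)
  define C where "C v = {U :: 'w \<Rightarrow> real. 1 - U v \<le> x}" for v
  have C[measurable]: "C v \<in> sets vecM" for v
  proof -
    have "Measurable.pred (vecM :: ('w \<Rightarrow> real) measure) (\<lambda>U. 1 - U v \<le> x)" by measurable
    then show ?thesis by (simp add: C_def pred_def)
  qed
  have pC: "measure M (xi t -` C v \<inter> space M) = x" for v
  proof -
    have "measure M (xi t -` C v \<inter> space M) = measure (distr M vecM (xi t)) (C v)"
      by (simp add: measure_distr)
    also have "\<dots> = measure unifvec ((\<lambda>U. U v) -` {1 - x..} \<inter> space (unifvec :: ('w \<Rightarrow> real) measure))"
      unfolding distr by (intro arg_cong2[where f=measure] refl) (auto simp: C_def)
    also have "\<dots> = measure (distr (PiM UNIV (\<lambda>_::'w. unif01)) unif01 (\<lambda>U. U v)) {1 - x..}"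
      unfolding unifvec_def by (subst measure_distr) auto
    also have "distr (PiM UNIV (\<lambda>_::'w. unif01)) unif01 (\<lambda>U. U v) = unif01"
      by (intro distr_PiM_component prob_space_unif01) auto
    finally show ?thesis using x by (simp add: measure_unif01_atLeast)
  qed
  define D where "D v = {p :: ('w \<Rightarrow> real) \<times> ('w \<Rightarrow> real). gumbel_dec (fst p) (snd p) = v \<and> 1 - snd p v \<le> x}" for v
  have D: "D v \<in> sets (vecM \<Otimes>\<^sub>M vecM)" for v
  proof -
    note [measurable] = measurable_gumbel_dec
    have [measurable]: "(\<lambda>p. snd p v) \<in> borel_measurable (vecM \<Otimes>\<^sub>M (vecM :: ('w \<Rightarrow> real) measure))"
      by (rule measurable_compose[OF measurable_snd measurable_vecM_component])
    have "Measurable.pred (vecM \<Otimes>\<^sub>M vecM) (\<lambda>p :: ('w \<Rightarrow> real) \<times> ('w \<Rightarrow> real). gumbel_dec (fst p) (snd p) = v \<and> 1 - snd p v \<le> x)"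
      by measurable
    then show ?thesis by (simp add: D_def pred_def space_pair_measure)
  qed
  interpret H: sigma_algebra "space M" "hist_sets M Pt xi w t" by (rule hist_sets_sigma_algebra)
  \<comment> \<open>The history at time \<open>t\<close> contains the events of \<open>Pt t\<close>,
    so \<open>A\<close> can be intersected with them before independence of \<open>xi t\<close> is
    invoked.\<close>
  have indepD: "measure M (A \<inter> Pt t -` B \<inter> xi t -` C) = measure M (A \<inter> Pt t -` B) * measure M (xi t -` C \<inter> space M)"
    if "B \<in> sets vecM" "C \<in> sets vecM" for B C
  proof -
    have "A \<inter> (Pt t -` B \<inter> space M) \<in> hist_sets M Pt xi w t"
      using A t that by (intro H.Int hist_sets_P) auto
    moreover have "A \<inter> (Pt t -` B \<inter> space M) = A \<inter> Pt t -` B" using AM by auto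
    ultimately show ?thesis using indep that by simp
  qed
  have gain: "ennreal g \<le> (\<Sum>v\<in>UNIV. emeasure unifvec (Pair P -` D v))" if P: "P \<in> P_Delta x" for P
  proof -
    have pv: "prob_vec P" and nn: "\<And>v. 0 \<le> P v" using P by (auto simp: P_Delta_def prob_vec_def)
    have le1: "P v \<le> 1" for v using P x by (auto simp: P_Delta_def intro: order_trans[where y="1 - x"])
    have "g \<le> (\<Sum>v\<in>UNIV. P v * (1 - (1 - x) powr (1 / P v)))"
      unfolding g_def by (rule gumbel_gain[OF P x])
    then have "ennreal g \<le> ennreal (\<Sum>v\<in>UNIV. P v * (1 - (1 - x) powr (1 / P v)))"
      by (rule ennreal_leI)
    also have "\<dots> = (\<Sum>v\<in>UNIV. ennreal (P v * (1 - (1 - x) powr (1 / P v))))"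
      using nn x by (intro sum_ennreal[symmetric] mult_nonneg_nonneg) (auto intro!: powr_le1)
    also have "\<dots> \<le> (\<Sum>v\<in>UNIV. emeasure unifvec (Pair P -` D v))"
    proof (rule sum_mono)
      fix v
      have eq: "Pair P -` D v = {U. gumbel_dec P U = v \<and> 1 - x \<le> U v}" by (auto simp: D_def)
      show "ennreal (P v * (1 - (1 - x) powr (1 / P v))) \<le> emeasure unifvec (Pair P -` D v)"
        unfolding eq using gumbel_win_prob[OF pv, of v x] nn[of v] x by (cases "P v = 0") auto
    qed
    finally show ?thesis .
  qed
  have wm: "g * measure M A \<le> (\<Sum>v\<in>UNIV. measure M (A \<inter> xi t -` C v \<inter> {\<omega>. gumbel_dec (Pt t \<omega>) (xi t \<omega>) = v}))"
  proof -
    have eq: "A \<inter> xi t -` C v \<inter> {\<omega>. gumbel_dec (Pt t \<omega>) (xi t \<omega>) = v} = {\<omega> \<in> A. (Pt t \<omega>, xi t \<omega>) \<in> D v}" for v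
      by (auto simp: C_def D_def)
    have "ennreal g * emeasure M A = (\<integral>\<^sup>+\<omega>. ennreal g * indicator A \<omega> \<partial>M)"
      by (simp add: nn_integral_cmult_indicator)
    also have "\<dots> \<le> (\<integral>\<^sup>+\<omega>. (\<Sum>v\<in>UNIV. indicator A \<omega> * emeasure unifvec (Pair (Pt t \<omega>) -` D v)) \<partial>M)"
      using AE_t
    proof (intro nn_integral_mono_AE, eventually_elim)
      fix \<omega> assume "Pt t \<omega> \<in> P_Delta x"
      from gain[OF this] show "ennreal g * indicator A \<omega> \<le> (\<Sum>v\<in>UNIV. indicator A \<omega> * emeasure unifvec (Pair (Pt t \<omega>) -` D v))"
        by (simp add: sum_distrib_left[symmetric] indicator_def)
    qed
    also have "\<dots> = (\<Sum>v\<in>UNIV. \<integral>\<^sup>+\<omega>. indicator A \<omega> * emeasure unifvec (Pair (Pt t \<omega>) -` D v) \<partial>M)"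
    proof (rule nn_integral_sum)
      fix v
      interpret U: prob_space "unifvec :: ('w \<Rightarrow> real) measure" by (rule prob_space_unifvec)
      have "D v \<in> sets (vecM \<Otimes>\<^sub>M unifvec)"
        unfolding sets_pair_measure_cong[OF refl sets_unifvec] by (rule D)
      from measurable_compose[OF \<open>Pt t \<in> M \<rightarrow>\<^sub>M vecM\<close> U.measurable_emeasure_Pair[OF this]]
      show "(\<lambda>\<omega>. indicator A \<omega> * emeasure unifvec (Pair (Pt t \<omega>) -` D v)) \<in> borel_measurable M"
        by measurable
    qed
    also have "\<dots> = (\<Sum>v\<in>UNIV. emeasure M {\<omega> \<in> A. (Pt t \<omega>, xi t \<omega>) \<in> D v})"
      by (intro sum.cong refl emeasure_indep_pair[symmetric] m distr indepD D) auto
    also have "\<dots> = ennreal (\<Sum>v\<in>UNIV. measure M {\<omega> \<in> A. (Pt t \<omega>, xi t \<omega>) \<in> D v})"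
      by (simp add: emeasure_eq_measure sum_ennreal)
    finally have "ennreal (g * measure M A) \<le> \<dots>"
      using \<open>0 \<le> g\<close> by (simp add: emeasure_eq_measure ennreal_mult)
    then show ?thesis unfolding eq by (subst (asm) ennreal_le_iff) (auto intro: sum_nonneg)
  qed
  have sP: "(\<Sum>v\<in>UNIV. set_lebesgue_integral M A (\<lambda>\<omega>. Pt t \<omega> v)) = measure M A"
  proof -
    have [measurable]: "(\<lambda>\<omega>. Pt t \<omega> v) \<in> borel_measurable M" for v
      by (rule measurable_compose[OF \<open>Pt t \<in> M \<rightarrow>\<^sub>M vecM\<close> measurable_vecM_component])
    have int: "integrable M (\<lambda>\<omega>. indicator A \<omega> *\<^sub>R Pt t \<omega> v)" for v
    proof (rule integrable_const_bound[where B=1])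
      show "AE \<omega> in M. norm (indicator A \<omega> *\<^sub>R Pt t \<omega> v) \<le> 1"
        using AE_t
      proof eventually_elim
        fix \<omega> assume "Pt t \<omega> \<in> P_Delta x"
        then have "0 \<le> Pt t \<omega> v" "Pt t \<omega> v \<le> 1 - x" by (auto simp: P_Delta_def prob_vec_def)
        then show "norm (indicator A \<omega> *\<^sub>R Pt t \<omega> v) \<le> 1" using x by (auto simp: indicator_def)
      qed
    qed measurable
    have "(\<Sum>v\<in>UNIV. set_lebesgue_integral M A (\<lambda>\<omega>. Pt t \<omega> v)) = (\<integral>\<omega>. (\<Sum>v\<in>UNIV. indicator A \<omega> *\<^sub>R Pt t \<omega> v) \<partial>M)"
      unfolding set_lebesgue_integral_def using int by (subst Bochner_Integration.integral_sum) auto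
    also have "\<dots> = (\<integral>\<omega>. indicator A \<omega> \<partial>M)"
    proof (rule integral_cong_AE)
      show "AE \<omega> in M. (\<Sum>v\<in>UNIV. indicator A \<omega> *\<^sub>R Pt t \<omega> v) = indicator A \<omega>"
        using AE_t by eventually_elim (simp add: P_Delta_def prob_vec_def scaleR_sum_right[symmetric])
    qed measurable
    finally show ?thesis by simp
  qed
  \<comment> \<open>The index \<open>w t \<omega>\<close> is random; partitioning by its value
    leaves events of the form that \<open>mix\<close> describes.\<close>
  have "A \<inter> {\<omega>. 1 - xi t \<omega> (w t \<omega>) \<le> x} = (\<Union>v\<in>UNIV. A \<inter> xi t -` C v \<inter> {\<omega>. w t \<omega> = v})"
    by (auto simp: C_def)
  moreover have "A \<inter> xi t -` C v \<inter> {\<omega>. w t \<omega> = v} \<in> sets M" for v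
  proof -
    have "A \<inter> (xi t -` C v \<inter> space M) \<inter> (w t -` {v} \<inter> space M) \<in> sets M"
      by (intro sets.Int A_sets measurable_sets[of "xi t" M vecM] measurable_sets[of "w t" M "count_space UNIV"]) auto
    also have "A \<inter> (xi t -` C v \<inter> space M) \<inter> (w t -` {v} \<inter> space M) = A \<inter> xi t -` C v \<inter> {\<omega>. w t \<omega> = v}"
      using AM by auto
    finally show ?thesis .
  qed
  ultimately have "measure M (A \<inter> {\<omega>. 1 - xi t \<omega> (w t \<omega>) \<le> x}) = (\<Sum>v\<in>UNIV. measure M (A \<inter> xi t -` C v \<inter> {\<omega>. w t \<omega> = v}))"
    by (simp, intro finite_measure_finite_Union) (auto simp: disjoint_family_on_def)
  also have "\<dots> = eps * (\<Sum>v\<in>UNIV. measure M (A \<inter> xi t -` C v \<inter> {\<omega>. gumbel_dec (Pt t \<omega>) (xi t \<omega>) = v}))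
      + (1 - eps) * (\<Sum>v\<in>UNIV. set_lebesgue_integral M A (\<lambda>\<omega>. Pt t \<omega> v)) * x"
    by (simp add: mix[OF C] pC sum.distrib sum_distrib_left sum_distrib_right)
  also have "\<dots> \<ge> eps * (g * measure M A) + (1 - eps) * measure M A * x"
    unfolding sP using wm eps by (intro add_right_mono mult_left_mono) auto
  finally show ?thesis by (simp add: g_def algebra_simps)
qed

section \<open>Exponential moments of dependent counts\<close>

text \<open>The count has finitely many values, so its exponential moment is a sum over level sets,
  on which the success bound \<open>step\<close> of \<open>exp_moment_count_le\<close> applies.
  \<open>Q\<close> will be either trivial or the next success.\<close>

lemma integral_exp_card_eq_sum:
  fixes X :: "nat \<Rightarrow> 'a \<Rightarrow> bool"
  assumes "prob_space M" and X: "\<And>j. j \<in> {1..t} \<Longrightarrow> Measurable.pred M (X j)" and Q: "Measurable.pred M Q"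
  shows "(\<integral>\<omega>. exp (- s * real (card {j\<in>{1..t}. X j \<omega>})) * indicator {\<omega>. Q \<omega>} \<omega> \<partial>M)
     = (\<Sum>k\<le>t. exp (- s * real k) * measure M {\<omega> \<in> space M. card {j\<in>{1..t}. X j \<omega>} = k \<and> Q \<omega>})"
proof -
  interpret prob_space M by fact
  let ?S = "\<lambda>\<omega>. card {j\<in>{1..t}. X j \<omega>}"
  have S: "?S \<in> M \<rightarrow>\<^sub>M count_space UNIV"
  proof -
    have "?S \<omega> = (\<Sum>j\<in>{1..t}. if X j \<omega> then 1 else 0)" for \<omega>
      by (simp add: sum.If_cases Int_def)
    moreover have "(\<lambda>\<omega>. \<Sum>j\<in>{1..t}. if X j \<omega> then 1 else (0::nat)) \<in> M \<rightarrow>\<^sub>M count_space UNIV"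
      using X by (intro measurable_sum_nat measurable_If) auto
    ultimately show ?thesis by simp
  qed
  have St: "?S \<omega> \<le> t" for \<omega>
    by (rule order_trans[OF card_mono[of "{1..t}"]]) auto
  define E where "E k = {\<omega> \<in> space M. ?S \<omega> = k \<and> Q \<omega>}" for k
  have E: "E k \<in> sets M" for k
  proof -
    have "E k = (?S -` {k} \<inter> space M) \<inter> {\<omega> \<in> space M. Q \<omega>}" by (auto simp: E_def)
    also have "\<dots> \<in> sets M" using Q by (intro sets.Int measurable_sets[OF S]) (auto simp: pred_def)
    finally show ?thesis .
  qed
  have int: "integrable M (\<lambda>\<omega>. exp (- s * real k) * indicator (E k) \<omega>)" for k
    by (rule integrable_mult_right, rule integrable_real_indicator[OF E]) (simp add: emeasure_eq_measure)
  have "(\<integral>\<omega>. exp (- s * real (?S \<omega>)) * indicator {\<omega>. Q \<omega>} \<omega> \<partial>M)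
      = (\<integral>\<omega>. (\<Sum>k\<le>t. exp (- s * real k) * indicator (E k) \<omega>) \<partial>M)"
  proof (rule Bochner_Integration.integral_cong[OF refl])
    fix \<omega> assume \<omega>: "\<omega> \<in> space M"
    have "(\<Sum>k\<le>t. exp (- s * real k) * indicator (E k) \<omega>)
        = (\<Sum>k\<le>t. if k = ?S \<omega> then exp (- s * real k) * indicator {\<omega>. Q \<omega>} \<omega> else 0)"
      using \<omega> by (intro sum.cong refl) (auto simp: indicator_def E_def)
    also have "\<dots> = exp (- s * real (?S \<omega>)) * indicator {\<omega>. Q \<omega>} \<omega>"
      using St by (subst sum.delta) auto
    finally show "exp (- s * real (?S \<omega>)) * indicator {\<omega>. Q \<omega>} \<omega>
        = (\<Sum>k\<le>t. exp (- s * real k) * indicator (E k) \<omega>)" ..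
  qed
  also have "\<dots> = (\<Sum>k\<le>t. \<integral>\<omega>. exp (- s * real k) * indicator (E k) \<omega> \<partial>M)"
    by (rule Bochner_Integration.integral_sum[OF int])
  also have "\<dots> = (\<Sum>k\<le>t. exp (- s * real k) * measure M (E k))"
    by (simp only: integral_mult_right_zero Bochner_Integration.integral_indicator sets.Int_space_eq2[OF E])
  finally show ?thesis unfolding E_def .
qed

text \<open>
  Stands in for conditional independence: a lower bound on the conditional success probability
  given the running count already makes the count dominate a binomial one exponentially.
\<close>
lemma exp_moment_count_le:
  fixes X :: "nat \<Rightarrow> 'a \<Rightarrow> bool"
  assumes "prob_space M" and X: "\<And>j. j \<in> {1..n} \<Longrightarrow> Measurable.pred M (X j)" and "0 \<le> s"
    and step: "\<And>t k. t < n \<Longrightarrow> \<mu> * measure M {\<omega> \<in> space M. card {j\<in>{1..t}. X j \<omega>} = k}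
        \<le> measure M {\<omega> \<in> space M. card {j\<in>{1..t}. X j \<omega>} = k \<and> X (Suc t) \<omega>}"
    and "t \<le> n"
  shows "(\<integral>\<omega>. exp (- s * real (card {j\<in>{1..t}. X j \<omega>})) \<partial>M) \<le> exp (- (real t * \<mu> * (1 - exp (- s))))"
  using \<open>t \<le> n\<close>
proof (induction t)
  case 0
  interpret prob_space M by fact
  show ?case by (simp add: prob_space)
next
  case (Suc t)
  interpret prob_space M by fact
  let ?S = "\<lambda>t \<omega>. card {j\<in>{1..t}. X j \<omega>}"
  let ?e = "\<lambda>t \<omega>. exp (- s * real (?S t \<omega>))"
  have Xt: "Measurable.pred M (X j)" if "j \<in> {1..t}" for j using X that Suc.prems by auto
  have XS[measurable]: "Measurable.pred M (X (Suc t))" using X Suc.prems by auto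
  have em[measurable]: "?e t \<in> borel_measurable M"
  proof -
    have "real (?S t \<omega>) = (\<Sum>j\<in>{1..t}. if X j \<omega> then 1 else 0)" for \<omega>
      by (simp add: sum.If_cases Int_def)
    moreover have "(\<lambda>\<omega>. \<Sum>j\<in>{1..t}. if X j \<omega> then 1 else (0::real)) \<in> borel_measurable M"
      using Xt by (intro borel_measurable_sum measurable_If) auto
    ultimately show ?thesis by simp
  qed
  have int: "integrable M (?e t)" "integrable M (\<lambda>\<omega>. ?e t \<omega> * indicator {\<omega>. X (Suc t) \<omega>} \<omega>)"
  proof -
    have bd: "norm (?e t \<omega>) \<le> 1" for \<omega> using \<open>0 \<le> s\<close> by simp
    show "integrable M (?e t)" by (rule integrable_const_bound[OF AE_I2[OF bd] em])
    have "(\<lambda>\<omega>. if X (Suc t) \<omega> then ?e t \<omega> else 0) \<in> borel_measurable M"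
      by (intro measurable_If em) (use XS in \<open>simp_all add: pred_def\<close>)
    moreover have "norm (if X (Suc t) \<omega> then ?e t \<omega> else 0) \<le> 1" for \<omega>
      using bd[of \<omega>] by (cases "X (Suc t) \<omega>") (simp_all only: if_True if_False norm_zero zero_le_one)
    ultimately have "integrable M (\<lambda>\<omega>. if X (Suc t) \<omega> then ?e t \<omega> else 0)"
      by (rule integrable_const_bound[OF AE_I2, rotated])
    also have "(\<lambda>\<omega>. if X (Suc t) \<omega> then ?e t \<omega> else 0) = (\<lambda>\<omega>. ?e t \<omega> * indicator {\<omega>. X (Suc t) \<omega>} \<omega>)"
      by (simp add: fun_eq_iff indicator_def)
    finally show "integrable M (\<lambda>\<omega>. ?e t \<omega> * indicator {\<omega>. X (Suc t) \<omega>} \<omega>)" .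
  qed
  \<comment> \<open>A success multiplies the weight by \<open>exp (- s)\<close>. With conditional
    success probability at least \<mu>, the mean therefore shrinks to at most
    \<open>1 - \<mu> * (1 - exp (- s))\<close> times its value.\<close>
  have split: "?e (Suc t) \<omega> = ?e t \<omega> - (1 - exp (- s)) * (?e t \<omega> * indicator {\<omega>. X (Suc t) \<omega>} \<omega>)" for \<omega>
  proof (cases "X (Suc t) \<omega>")
    case True
    then have "{j\<in>{1..Suc t}. X j \<omega>} = insert (Suc t) {j\<in>{1..t}. X j \<omega>}" by (auto simp: le_Suc_eq)
    then have "?S (Suc t) \<omega> = Suc (?S t \<omega>)" by simp
    then show ?thesis using True by (simp add: algebra_simps flip: exp_add)
  next
    case False
    then have "{j\<in>{1..Suc t}. X j \<omega>} = {j\<in>{1..t}. X j \<omega>}" by (auto simp: le_Suc_eq)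
    then show ?thesis using False by simp
  qed
  have "\<mu> * (\<integral>\<omega>. ?e t \<omega> \<partial>M) \<le> (\<integral>\<omega>. ?e t \<omega> * indicator {\<omega>. X (Suc t) \<omega>} \<omega> \<partial>M)"
  proof -
    have "(\<integral>\<omega>. ?e t \<omega> \<partial>M) = (\<Sum>k\<le>t. exp (- s * real k) * measure M {\<omega> \<in> space M. ?S t \<omega> = k})"
      using integral_exp_card_eq_sum[OF assms(1) Xt, where Q="\<lambda>_. True" and s=s] by simp
    then have "\<mu> * (\<integral>\<omega>. ?e t \<omega> \<partial>M) = (\<Sum>k\<le>t. exp (- s * real k) * (\<mu> * measure M {\<omega> \<in> space M. ?S t \<omega> = k}))"
      by (simp add: sum_distrib_left mult_ac)
    also have "\<dots> \<le> (\<Sum>k\<le>t. exp (- s * real k) * measure M {\<omega> \<in> space M. ?S t \<omega> = k \<and> X (Suc t) \<omega>})"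
      using Suc.prems by (intro sum_mono mult_left_mono step) auto
    also have "\<dots> = (\<integral>\<omega>. ?e t \<omega> * indicator {\<omega>. X (Suc t) \<omega>} \<omega> \<partial>M)"
      by (rule integral_exp_card_eq_sum[OF assms(1) Xt XS, symmetric])
    finally show ?thesis .
  qed
  then have "(1 - exp (- s)) * (\<mu> * (\<integral>\<omega>. ?e t \<omega> \<partial>M)) \<le> (1 - exp (- s)) * (\<integral>\<omega>. ?e t \<omega> * indicator {\<omega>. X (Suc t) \<omega>} \<omega> \<partial>M)"
    using \<open>0 \<le> s\<close> by (intro mult_left_mono) auto
  moreover have "(\<integral>\<omega>. ?e (Suc t) \<omega> \<partial>M) = (\<integral>\<omega>. ?e t \<omega> \<partial>M) - (1 - exp (- s)) * (\<integral>\<omega>. ?e t \<omega> * indicator {\<omega>. X (Suc t) \<omega>} \<omega> \<partial>M)"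
    unfolding split using int by simp
  ultimately have "(\<integral>\<omega>. ?e (Suc t) \<omega> \<partial>M) \<le> (1 + - (\<mu> * (1 - exp (- s)))) * (\<integral>\<omega>. ?e t \<omega> \<partial>M)"
    by (simp add: algebra_simps)
  also have "\<dots> \<le> exp (- (\<mu> * (1 - exp (- s)))) * (\<integral>\<omega>. ?e t \<omega> \<partial>M)"
    by (intro mult_right_mono exp_ge_add_one_self integral_nonneg_AE AE_I2) auto
  also have "\<dots> \<le> exp (- (\<mu> * (1 - exp (- s)))) * exp (- (real t * \<mu> * (1 - exp (- s))))"
    using Suc.IH Suc.prems by (intro mult_left_mono) auto
  also have "\<dots> = exp (- (real (Suc t) * \<mu> * (1 - exp (- s))))"
    by (simp add: algebra_simps flip: exp_add)
  finally show ?case .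
qed

text \<open>Markov's inequality for \<open>exp (- s * count)\<close>. The first conclusion lets the
  event serve as a measurable superset of non-rejection.\<close>

lemma count_lower_tail_le:
  fixes X :: "nat \<Rightarrow> 'a \<Rightarrow> bool" and b :: real
  assumes "prob_space M" and X: "\<And>j. j \<in> {1..n} \<Longrightarrow> Measurable.pred M (X j)" and "0 \<le> s"
    and step: "\<And>t k. t < n \<Longrightarrow> \<mu> * measure M {\<omega> \<in> space M. card {j\<in>{1..t}. X j \<omega>} = k}
        \<le> measure M {\<omega> \<in> space M. card {j\<in>{1..t}. X j \<omega>} = k \<and> X (Suc t) \<omega>}"
  shows "{\<omega> \<in> space M. card {j\<in>{1..n}. X j \<omega>} < b} \<in> sets M"
    and "measure M {\<omega> \<in> space M. card {j\<in>{1..n}. X j \<omega>} < b} \<le> exp (s * b - real n * \<mu> * (1 - exp (- s)))"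
proof -
  interpret prob_space M by fact
  let ?S = "\<lambda>\<omega>. card {j\<in>{1..n}. X j \<omega>}"
  have Sm[measurable]: "(\<lambda>\<omega>. real (?S \<omega>)) \<in> borel_measurable M"
  proof -
    have "real (?S \<omega>) = (\<Sum>j\<in>{1..n}. if X j \<omega> then 1 else 0)" for \<omega>
      by (simp add: sum.If_cases Int_def)
    moreover have "(\<lambda>\<omega>. \<Sum>j\<in>{1..n}. if X j \<omega> then 1 else (0::real)) \<in> borel_measurable M"
      using X by (intro borel_measurable_sum measurable_If) auto
    ultimately show ?thesis by simp
  qed
  show E: "{\<omega> \<in> space M. ?S \<omega> < b} \<in> sets M" by measurable
  define A where "A = {\<omega> \<in> space M. ?S \<omega> < b}"
  have A: "A \<in> sets M" unfolding A_def by (rule E)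
  have "exp (- s * b) * measure M A = (\<integral>\<omega>. exp (- s * b) * indicator A \<omega> \<partial>M)"
    using A by (simp only: integral_mult_right_zero Bochner_Integration.integral_indicator sets.Int_space_eq2)
  also have "\<dots> \<le> (\<integral>\<omega>. exp (- s * real (?S \<omega>)) \<partial>M)"
  proof (rule integral_mono)
    have "norm (exp (- s * real (?S \<omega>))) \<le> 1" for \<omega> using \<open>0 \<le> s\<close> by simp
    moreover have "(\<lambda>\<omega>. exp (- s * real (?S \<omega>))) \<in> borel_measurable M"
      by (rule measurable_compose[OF Sm]) measurable
    ultimately show "integrable M (\<lambda>\<omega>. exp (- s * real (?S \<omega>)))"
      by (rule integrable_const_bound[OF AE_I2])
    have "integrable M (indicator A :: 'a \<Rightarrow> real)"
      by (rule integrable_real_indicator[OF A]) (simp add: emeasure_eq_measure)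
    then show "integrable M (\<lambda>\<omega>. exp (- s * b) * indicator A \<omega>)"
      by (rule integrable_mult_right)
    show "exp (- s * b) * indicator A \<omega> \<le> exp (- s * real (?S \<omega>))" for \<omega>
    proof (cases "\<omega> \<in> A")
      case True
      then have "s * real (?S \<omega>) \<le> s * b" using \<open>0 \<le> s\<close> by (intro mult_left_mono) (auto simp: A_def)
      then show ?thesis using True by simp
    qed simp
  qed
  also have "\<dots> \<le> exp (- (real n * \<mu> * (1 - exp (- s))))"
    by (rule exp_moment_count_le[OF assms(1) X \<open>0 \<le> s\<close> step order_refl])
  finally have "exp (s * b) * (exp (- s * b) * measure M A) \<le> exp (s * b) * exp (- (real n * \<mu> * (1 - exp (- s))))"
    by (rule mult_left_mono) simp
  then have "measure M A \<le> exp (s * b - real n * \<mu> * (1 - exp (- s)))"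
    by (simp flip: exp_add mult.assoc)
  then show "measure M {\<omega> \<in> space M. ?S \<omega> < b} \<le> exp (s * b - real n * \<mu> * (1 - exp (- s)))"
    unfolding A_def .
qed

section \<open>A deterministic criterion for rejection\<close>

text \<open>\<open>HC\<close> is evaluated at an order statistic \<open>p \<le> x\<close> instead of
  at \<open>x\<close>, and this can only help. After squaring, the difference factors as \<open>(x -
  p) * (\<tau>^2 * (1 - x) * (1 - p) - x * p * (1 - \<tau>)^2)\<close>, nonnegative because
  \<open>p\<close> and \<open>x\<close> are at most \<tau>.\<close>

lemma HC_score_antimono:
  fixes p x \<tau> :: real
  assumes "0 < p" "p \<le> x" "x < 1" "x \<le> \<tau>" "\<tau> \<le> 1"
  shows "(\<tau> - x) / sqrt (x * (1 - x)) \<le> (\<tau> - p) / sqrt (p * (1 - p))"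
proof -
  have pos: "0 < x * (1 - x)" "0 < p * (1 - p)" using assms by auto
  have a: "x * (1 - \<tau>) \<le> \<tau> * (1 - x)" "p * (1 - \<tau>) \<le> \<tau> * (1 - p)"
    using assms by (simp_all add: algebra_simps)
  have "(x * (1 - \<tau>)) * (p * (1 - \<tau>)) \<le> (\<tau> * (1 - x)) * (\<tau> * (1 - p))"
    using assms by (intro mult_mono a) auto
  then have "0 \<le> (x - p) * ((\<tau> * (1 - x)) * (\<tau> * (1 - p)) - (x * (1 - \<tau>)) * (p * (1 - \<tau>)))"
    using assms by (intro mult_nonneg_nonneg) auto
  also have "\<dots> = (\<tau> - p)\<^sup>2 * (x * (1 - x)) - (\<tau> - x)\<^sup>2 * (p * (1 - p))"
    by (simp add: power2_eq_square algebra_simps)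
  finally have "sqrt ((\<tau> - x)\<^sup>2 * (p * (1 - p))) \<le> sqrt ((\<tau> - p)\<^sup>2 * (x * (1 - x)))"
    by (intro real_sqrt_le_mono) simp
  then have "(\<tau> - x) * sqrt (p * (1 - p)) \<le> (\<tau> - p) * sqrt (x * (1 - x))"
    using assms by (simp add: real_sqrt_mult)
  then show ?thesis
    using pos by (simp add: divide_le_eq pos_le_divide_eq mult.commute)
qed

lemma HC_rejectI:
  assumes "0 < n" "0 < x" "x < 1" "c \<le> x" and y: "\<And>i. i \<in> {1..n} \<Longrightarrow> y i < 1"
    and lam: "lam = sqrt (2 * (1 + \<delta>) * ln (ln (real n)))" "0 \<le> lam"
    and big: "real n * x + lam * sqrt (real n * x * (1 - x)) \<le> card {i\<in>{1..n}. 1 - y i \<le> x}"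
  shows "HC_reject \<delta> c n y"
proof -
  define t where "t = card {i\<in>{1..n}. 1 - y i \<le> x}"
  have nx: "real n * x \<le> real t"
    using big assms by (intro order_trans[OF _ big[folded t_def]]) auto
  have "0 < real n * x" using assms by simp
  with nx have "0 < t" by linarith
  have "t \<le> n" unfolding t_def by (rule order_trans[OF card_mono[of "{1..n}"]]) auto
  have t: "t \<in> {1..n}" using \<open>0 < t\<close> \<open>t \<le> n\<close> by auto
  define p where "p = porder n y t"
  have "porder n y t \<le> x \<longleftrightarrow> t \<le> card {i\<in>{1..n}. 1 - y i \<le> x}" by (rule porder_le_iff[OF t])
  then have "p \<le> x" by (simp add: p_def t_def)
  \<comment> \<open>At \<open>p = 0\<close> division by zero would set \<open>HC\<close> to 0;
    values below 1 exclude this.\<close>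
  have "0 < p"
  proof (rule ccontr)
    assume "\<not> 0 < p"
    then have "porder n y t \<le> 0" by (simp add: p_def)
    then have "t \<le> card {i\<in>{1..n}. 1 - y i \<le> 0}" unfolding porder_le_iff[OF t] .
    moreover have "{i\<in>{1..n}. 1 - y i \<le> 0} = {}" using y by force
    ultimately show False using \<open>0 < t\<close> by (metis card.empty not_less)
  qed
  have c: "c \<le> porder n y (t + 1)"
  proof (cases "t = n")
    case True
    then show ?thesis using assms by (simp add: porder_def)
  next
    case False
    then have "t + 1 \<in> {1..n}" using t by auto
    from porder_le_iff[OF this, of y x] have "x < porder n y (t + 1)" by (simp add: t_def)
    then show ?thesis using assms by simp
  qed
  have sx: "0 < sqrt (x * (1 - x))" using assms by simp
  have "lam * sqrt (real n * x * (1 - x)) \<le> real t - real n * x" using big by (simp add: t_def)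
  also have "\<dots> = real n * (real t / real n - x)" using assms by (simp add: right_diff_distrib)
  also have "\<dots> = sqrt (real n) * (real t / real n - x) * sqrt (real n)" by simp
  also have "lam * sqrt (real n * x * (1 - x)) = lam * sqrt (x * (1 - x)) * sqrt (real n)"
    by (simp add: real_sqrt_mult)
  finally have "lam * sqrt (x * (1 - x)) * sqrt (real n) \<le> sqrt (real n) * (real t / real n - x) * sqrt (real n)" .
  then have "lam * sqrt (x * (1 - x)) \<le> sqrt (real n) * (real t / real n - x)"
    using assms(1) by (simp only: mult_le_cancel_right_pos real_sqrt_gt_zero of_nat_0_less_iff)
  then have "lam \<le> sqrt (real n) * ((real t / real n - x) / sqrt (x * (1 - x)))"
    using sx by (simp add: pos_le_divide_eq)
  also have "\<dots> \<le> sqrt (real n) * ((real t / real n - p) / sqrt (p * (1 - p)))"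
    using \<open>0 < p\<close> \<open>p \<le> x\<close> assms(1,3) nx \<open>t \<le> n\<close>
    by (intro mult_left_mono HC_score_antimono) (auto simp: field_simps)
  also have "\<dots> = HC n y t" by (simp add: HC_def p_def)
  finally have "ereal lam \<le> ereal (HC n y t)" by simp
  also have "\<dots> \<le> HC_plus c n y"
    unfolding HC_plus_def by (rule Sup_upper) (use t c in blast)
  finally show ?thesis by (simp add: HC_reject_def lam(1))
qed

lemma AE_unifvec_less_1: "AE U in (unifvec :: ('w::finite \<Rightarrow> real) measure). \<forall>v. U v < 1"
proof -
  have "AE z in unif01. z < 1"
  proof -
    interpret prob_space unif01 by (rule prob_space_unif01)
    have "measure unif01 {..<1} = 1" by (rule measure_unif01_lessThan) auto
    then show ?thesis by (subst (asm) prob_eq_1) auto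
  qed
  then have "AE U in (unifvec :: ('w \<Rightarrow> real) measure). U v < 1" for v
    unfolding unifvec_def by (intro AE_PiM_component prob_space_unif01) auto
  then show ?thesis by (simp add: AE_all_countable)
qed

text \<open>The condition \<open>signal\<close> lets the critical deviation use up at most half of
  the mean gain \<open>n * eps * \<kappa> * x\<close>; the other half drives the Chernoff
  bound.\<close>

lemma type_II_error_le:
  fixes Pt xi :: "nat \<Rightarrow> 'a \<Rightarrow> 'w::finite \<Rightarrow> real"
  assumes model: "gumbel_model M eps Pt xi w n" and "0 < n" and eps: "0 \<le> eps" "eps \<le> 1"
    and AE: "AE \<omega> in M. \<forall>t\<in>{1..n}. Pt t \<omega> \<in> P_Delta x"
    and x: "0 < x" "x < 1" and "c \<le> x"
    and lam: "lam = sqrt (2 * (1 + \<delta>) * ln (ln (real n)))" "0 \<le> lam"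
    and \<kappa>: "\<kappa> = 1 / (2 * real CARD('w) * (real CARD('w) + 1))"
    and signal: "lam * sqrt (real n * x) \<le> real n * (eps * \<kappa> * x) / 2"
  shows "type_II_error M xi w \<delta> c n \<le> exp (- ((real n * eps\<^sup>2 * x) * \<kappa>\<^sup>2 / 16))"
proof -
  have m: "prob_space M"
    and meas: "\<And>t. t \<in> {1..n} \<Longrightarrow> Pt t \<in> M \<rightarrow>\<^sub>M vecM \<and> xi t \<in> M \<rightarrow>\<^sub>M vecM \<and> w t \<in> M \<rightarrow>\<^sub>M count_space UNIV"
    and distr: "\<And>t. t \<in> {1..n} \<Longrightarrow> distr M vecM (xi t) = unifvec"
    using model unfolding gumbel_model_def by blast+
  interpret prob_space M by fact
  have \<kappa>01: "0 \<le> \<kappa>" "\<kappa> \<le> 1"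
  proof -
    have "1 \<le> real CARD('w)" by (simp add: Suc_leI)
    then have "1 * 1 \<le> (2 * real CARD('w)) * (real CARD('w) + 1)" by (intro mult_mono) linarith+
    then show "0 \<le> \<kappa>" "\<kappa> \<le> 1" unfolding \<kappa> by (auto simp: divide_le_eq_1)
  qed
  define X where "X t \<omega> \<longleftrightarrow> 1 - xi t \<omega> (w t \<omega>) \<le> x" for t \<omega>
  define \<mu> where "\<mu> = x + eps * (\<kappa> * x)"
  define b where "b = real n * x + lam * sqrt (real n * x * (1 - x))"
  \<comment> \<open>Minimises \<open>n * x * (s^2 - s * eps * \<kappa> / 2)\<close>, the exponent
    obtained from \<open>\<mu> \<le> 2 * x\<close>; its value there is the stated one.\<close>
  define s where "s = eps * \<kappa> / 4"
  have "0 \<le> s" using eps \<kappa>01 by (simp add: s_def)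
  have X_eq: "{\<omega> \<in> space M. X t \<omega>} = (\<Union>v\<in>UNIV. (w t -` {v} \<inter> space M) \<inter> (xi t -` {U. 1 - U v \<le> x} \<inter> space M))" for t
    by (auto simp: X_def)
  have C: "{U. 1 - U v \<le> x} \<in> sets (vecM :: ('w \<Rightarrow> real) measure)" for v
  proof -
    have "Measurable.pred (vecM :: ('w \<Rightarrow> real) measure) (\<lambda>U. 1 - U v \<le> x)" by measurable
    then show ?thesis by (simp add: pred_def)
  qed
  have Xm: "Measurable.pred M (X t)" if "t \<in> {1..n}" for t
  proof -
    have xw: "xi t \<in> M \<rightarrow>\<^sub>M vecM" "w t \<in> M \<rightarrow>\<^sub>M count_space UNIV" using meas[OF that] by auto
    have "(w t -` {v} \<inter> space M) \<inter> (xi t -` {U. 1 - U v \<le> x} \<inter> space M) \<in> sets M" for v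
    proof (rule sets.Int)
      show "w t -` {v} \<inter> space M \<in> sets M" by (rule measurable_sets[OF xw(2)]) simp
      show "xi t -` {U. 1 - U v \<le> x} \<inter> space M \<in> sets M" by (rule measurable_sets[OF xw(1) C])
    qed
    then show ?thesis
      unfolding pred_def X_eq by (intro sets.finite_UN finite)
  qed
  have step: "\<mu> * measure M {\<omega> \<in> space M. card {j\<in>{1..t}. X j \<omega>} = k}
        \<le> measure M {\<omega> \<in> space M. card {j\<in>{1..t}. X j \<omega>} = k \<and> X (Suc t) \<omega>}"
    if "t < n" for t k
  proof -
    let ?H = "hist_sets M Pt xi w (Suc t)"
    interpret H: sigma_algebra "space M" ?H by (rule hist_sets_sigma_algebra)
    \<comment> \<open>The history as a measurable space, so that the usual rules show the count up
      to \<open>t\<close> to be a past quantity at time \<open>Suc t\<close>.\<close>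
    define HM where "HM = sigma (space M) ?H"
    have HM: "space HM = space M" "sets HM = ?H"
      unfolding HM_def using H.space_closed H.sigma_sets_eq by (auto simp: space_measure_of sets_measure_of)
    have "{\<omega> \<in> space HM. X j \<omega>} \<in> sets HM" if "j \<in> {1..t}" for j
      unfolding HM X_eq using that C
      by (intro H.finite_UN H.Int hist_sets_w hist_sets_xi) auto
    then have "(\<lambda>\<omega>. \<Sum>j\<in>{1..t}. if X j \<omega> then 1 else (0::nat)) \<in> HM \<rightarrow>\<^sub>M count_space UNIV"
      by (intro measurable_sum_nat measurable_If) auto
    moreover have "card {j\<in>{1..t}. X j \<omega>} = (\<Sum>j\<in>{1..t}. if X j \<omega> then 1 else (0::nat))" for \<omega>
      by (simp add: sum.If_cases Int_def)
    ultimately have "(\<lambda>\<omega>. card {j\<in>{1..t}. X j \<omega>}) \<in> HM \<rightarrow>\<^sub>M count_space UNIV" by simp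
    from measurable_sets[OF this, of "{k}"]
    have "{\<omega> \<in> space M. card {j\<in>{1..t}. X j \<omega>} = k} \<in> ?H"
      unfolding HM by (simp add: vimage_def Int_def conj_commute)
    from gumbel_model_cond_prob[OF model _ this eps x AE] that
    have "\<mu> * measure M {\<omega> \<in> space M. card {j\<in>{1..t}. X j \<omega>} = k}
        \<le> measure M ({\<omega> \<in> space M. card {j\<in>{1..t}. X j \<omega>} = k} \<inter> {\<omega>. X (Suc t) \<omega>})"
      by (simp add: \<mu>_def \<kappa> X_def)
    also have "{\<omega> \<in> space M. card {j\<in>{1..t}. X j \<omega>} = k} \<inter> {\<omega>. X (Suc t) \<omega>}
        = {\<omega> \<in> space M. card {j\<in>{1..t}. X j \<omega>} = k \<and> X (Suc t) \<omega>}" by auto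
    finally show ?thesis .
  qed
  note tail = count_lower_tail_le[OF m Xm \<open>0 \<le> s\<close> step, where b=b]
  have AE1: "AE \<omega> in M. \<forall>t\<in>{1..n}. \<forall>v. xi t \<omega> v < 1"
  proof (rule AE_finite_allI)
    fix t assume t: "t \<in> {1..n}"
    have "AE U in distr M vecM (xi t). \<forall>v. U v < 1"
      unfolding distr[OF t] by (rule AE_unifvec_less_1)
    then show "AE \<omega> in M. \<forall>v. xi t \<omega> v < 1"
      using meas[OF t] by (intro AE_distrD[where M'=vecM and f="xi t"]) auto
  qed simp
  have "type_II_error M xi w \<delta> c n \<le> measure M {\<omega> \<in> space M. card {j\<in>{1..n}. X j \<omega>} < b}"
    unfolding type_II_error_def
  proof (rule finite_measure_mono_AE[OF _ tail(1)])
    show "AE \<omega> in M. \<omega> \<in> {\<omega> \<in> space M. \<not> HC_reject \<delta> c n (\<lambda>t. xi t \<omega> (w t \<omega>))}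
        \<longrightarrow> \<omega> \<in> {\<omega> \<in> space M. card {j\<in>{1..n}. X j \<omega>} < b}"
      using AE1
    proof (eventually_elim, intro impI)
      fix \<omega> assume lt1: "\<forall>t\<in>{1..n}. \<forall>v. xi t \<omega> v < 1"
        and "\<omega> \<in> {\<omega> \<in> space M. \<not> HC_reject \<delta> c n (\<lambda>t. xi t \<omega> (w t \<omega>))}"
      then have sp: "\<omega> \<in> space M" and nr: "\<not> HC_reject \<delta> c n (\<lambda>t. xi t \<omega> (w t \<omega>))" by auto
      have "HC_reject \<delta> c n (\<lambda>t. xi t \<omega> (w t \<omega>))" if "b \<le> card {j\<in>{1..n}. X j \<omega>}"
        by (rule HC_rejectI[OF \<open>0 < n\<close> x \<open>c \<le> x\<close> _ lam])
          (use lt1 that in \<open>auto simp: b_def X_def\<close>)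
      then show "\<omega> \<in> {\<omega> \<in> space M. card {j\<in>{1..n}. X j \<omega>} < b}" using sp nr not_le by blast
    qed
  qed
  also have "\<dots> \<le> exp (s * b - real n * \<mu> * (1 - exp (- s)))" by (rule tail(2))
  also have "\<dots> \<le> exp (- ((real n * eps\<^sup>2 * x) * \<kappa>\<^sup>2 / 16))"
  proof -
    have "real n * x * (1 - x) \<le> real n * x" using x by (simp add: algebra_simps)
    then have "lam * sqrt (real n * x * (1 - x)) \<le> lam * sqrt (real n * x)"
      using lam(2) by (intro mult_left_mono real_sqrt_le_mono)
    with signal have "b \<le> real n * x + real n * (eps * \<kappa> * x) / 2" unfolding b_def by linarith
    also have "\<dots> = real n * \<mu> - real n * (eps * \<kappa> * x) / 2" by (simp add: \<mu>_def algebra_simps)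
    finally have sb: "s * b \<le> s * (real n * \<mu> - real n * (eps * \<kappa> * x) / 2)"
      using \<open>0 \<le> s\<close> by (intro mult_left_mono)
    have "eps * (\<kappa> * x) \<le> 1 * (1 * x)" using eps \<kappa>01 x by (intro mult_mono) auto
    then have mu: "0 \<le> \<mu>" "\<mu> \<le> 2 * x" using eps \<kappa>01 x by (auto simp: \<mu>_def)
    have "real n * \<mu> * (s - s\<^sup>2 / 2) \<le> real n * \<mu> * (1 - exp (- s))"
      using exp_minus_le_quadratic[OF \<open>0 \<le> s\<close>] mu by (intro mult_left_mono) auto
    moreover have "real n * \<mu> * (s\<^sup>2 / 2) \<le> real n * (2 * x) * (s\<^sup>2 / 2)"
      using mu by (intro mult_right_mono mult_left_mono) auto
    ultimately have "s * b - real n * \<mu> * (1 - exp (- s)) \<le> - s * (real n * (eps * \<kappa> * x) / 2) + real n * (2 * x) * (s\<^sup>2 / 2)"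
      using sb by (simp add: algebra_simps)
    also have "\<dots> = - ((real n * eps\<^sup>2 * x) * \<kappa>\<^sup>2 / 16)"
      by (simp add: s_def power2_eq_square field_simps)
    finally show ?thesis by simp
  qed
  finally show ?thesis .
qed

lemma type_II_error_tendsto_0:
  fixes M :: "nat \<Rightarrow> 'a measure"
    and Pt xi :: "nat \<Rightarrow> nat \<Rightarrow> 'a \<Rightarrow> 'w::finite \<Rightarrow> real"
  assumes pq: "q + 2 * p < 1"
    and eps: "asymp_equiv_seq (\<lambda>n. real n powr (- p)) eps" "\<forall>n. 0 \<le> eps n \<and> eps n \<le> 1"
    and Delta: "asymp_equiv_seq (\<lambda>n. real n powr (- q)) Delta"
    and model: "\<forall>n. gumbel_model (M n) (eps n) (Pt n) (xi n) (w n) n"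
    and AE: "\<forall>n. AE \<omega> in M n. \<forall>t\<in>{1..n}. Pt n t \<omega> \<in> P_Delta (Delta n)"
    and "0 < \<delta>" and c: "\<forall>n. c n \<le> Delta n"
  shows "(\<lambda>n. type_II_error (M n) (xi n) (w n) \<delta> (c n) n) \<longlonglongrightarrow> 0"
proof -
  obtain C1 where C1: "0 < C1" "\<And>n. 1 \<le> n \<Longrightarrow> C1 * real n powr (- p) \<le> eps n"
    using eps(1) unfolding asymp_equiv_seq_def by blast
  obtain C2 where C2: "0 < C2" "\<And>n. 1 \<le> n \<Longrightarrow> C2 * real n powr (- q) \<le> Delta n"
    using Delta unfolding asymp_equiv_seq_def by blast
  define \<kappa> where "\<kappa> = 1 / (2 * real CARD('w) * (real CARD('w) + 1))"
  have "0 < \<kappa>" unfolding \<kappa>_def by (intro divide_pos_pos mult_pos_pos add_pos_pos) auto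
  define r where "r = 1 - 2 * p - q"
  have "0 < r" using pq by (simp add: r_def)
  define C where "C = C1\<^sup>2 * C2"
  have "0 < C" using C1 C2 by (simp add: C_def)
  define lam where "lam n = sqrt (2 * (1 + \<delta>) * ln (ln (real n)))" for n :: nat
  \<comment> \<open>The lower halves of the two growth hypotheses multiply to the exponent
    \<open>1 - 2 * p - q\<close>, positive by assumption.\<close>
  have T: "C * real n powr r \<le> real n * (eps n)\<^sup>2 * Delta n" if "1 \<le> n" for n
  proof -
    have n: "0 < real n" using that by simp
    have "(C1 * real n powr (- p))\<^sup>2 \<le> (eps n)\<^sup>2"
      using C1(1) C1(2)[OF that] by (intro power_mono) auto
    then have "real n * (C1 * real n powr (- p))\<^sup>2 * (C2 * real n powr (- q)) \<le> real n * (eps n)\<^sup>2 * Delta n"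
      using C2(1) C2(2)[OF that] by (intro mult_mono mult_left_mono) auto
    also have "real n * (C1 * real n powr (- p))\<^sup>2 * (C2 * real n powr (- q))
        = C * (real n powr 1 * real n powr (- p) * real n powr (- p) * real n powr (- q))"
      using n by (simp add: C_def power2_eq_square)
    also have "real n powr 1 * real n powr (- p) * real n powr (- p) * real n powr (- q) = real n powr r"
      unfolding powr_add[symmetric] by (simp add: r_def)
    finally show ?thesis .
  qed
  have D0: "0 < Delta n" if "1 \<le> n" for n
  proof -
    have "0 < C2 * real n powr (- q)" using C2(1) that by simp
    also have "\<dots> \<le> Delta n" by (rule C2(2)[OF that])
    finally show ?thesis .
  qed
  \<comment> \<open>Otherwise \<open>P_Delta (Delta n)\<close> would be empty, against almost sure
    membership; \<open>1 \<le> n\<close> supplies a time index.\<close>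
  have D1: "Delta n < 1" if "1 \<le> n" for n
  proof (rule ccontr)
    assume "\<not> Delta n < 1"
    then have P_nonpos: "P \<notin> P_Delta (Delta n)" for P :: "'w \<Rightarrow> real"
    proof -
      have "(\<Sum>v\<in>UNIV. P v) \<le> 0" if "P \<in> P_Delta (Delta n)"
      proof (rule sum_nonpos)
        fix v
        have "P v \<le> 1 - Delta n" using that by (simp add: P_Delta_def)
        then show "P v \<le> 0" using \<open>\<not> Delta n < 1\<close> by linarith
      qed
      then show ?thesis by (auto simp: P_Delta_def prob_vec_def)
    qed
    interpret prob_space "M n" using model by (simp add: gumbel_model_def)
    have "AE \<omega> in M n. False"
      using AE[rule_format, of n] that by (auto elim!: eventually_mono dest!: bspec[of _ _ n] simp: P_nonpos)
    then show False by simp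
  qed
  have "eventually (\<lambda>n. 0 \<le> lam n) at_top"
    unfolding lam_def using \<open>0 < \<delta>\<close> by real_asymp
  \<comment> \<open>This is \<open>signal\<close> divided by \<open>sqrt (n * Delta n)\<close>, with
    \<open>T\<close> inserted: \<open>lam\<close> grows like \<open>sqrt (ln (ln n))\<close>, slower
    than any positive power of \<open>n\<close>.\<close>
  moreover have "eventually (\<lambda>n. lam n \<le> \<kappa> / 2 * sqrt (C * real n powr r)) at_top"
    unfolding lam_def using \<open>0 < \<delta>\<close> \<open>0 < \<kappa>\<close> \<open>0 < C\<close> \<open>0 < r\<close> by real_asymp
  ultimately have le: "eventually (\<lambda>n. type_II_error (M n) (xi n) (w n) \<delta> (c n) n \<le> exp (- ((C * real n powr r) * \<kappa>\<^sup>2 / 16))) at_top"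
    using eventually_ge_at_top[of 1]
  proof eventually_elim
    case (elim n)
    have "lam n * sqrt (real n * Delta n) \<le> \<kappa> / 2 * sqrt (real n * (eps n)\<^sup>2 * Delta n) * sqrt (real n * Delta n)"
    proof (rule mult_right_mono)
      have "\<kappa> / 2 * sqrt (C * real n powr r) \<le> \<kappa> / 2 * sqrt (real n * (eps n)\<^sup>2 * Delta n)"
        using \<open>0 < \<kappa>\<close> T[OF elim(3)] by (intro mult_left_mono real_sqrt_le_mono) auto
      with elim(2) show "lam n \<le> \<kappa> / 2 * sqrt (real n * (eps n)\<^sup>2 * Delta n)" by linarith
    qed (use D0[OF elim(3)] in auto)
    also have "\<dots> = real n * (eps n * \<kappa> * Delta n) / 2"
    proof -
      have "sqrt (real n * (eps n)\<^sup>2 * Delta n) = eps n * sqrt (real n * Delta n)"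
        using eps(2) by (simp add: real_sqrt_mult)
      moreover have "sqrt (real n * Delta n) * sqrt (real n * Delta n) = real n * Delta n"
        using D0[OF elim(3)] by simp
      ultimately show ?thesis by (simp only: mult_ac) (simp add: mult_ac)
    qed
    finally have signal: "lam n * sqrt (real n * Delta n) \<le> real n * (eps n * \<kappa> * Delta n) / 2" .
    have "type_II_error (M n) (xi n) (w n) \<delta> (c n) n \<le> exp (- ((real n * (eps n)\<^sup>2 * Delta n) * \<kappa>\<^sup>2 / 16))"
      using eps(2) elim D0 D1 c signal
      by (intro type_II_error_le[OF model[rule_format] _ _ _ AE[rule_format] _ _ _ lam_def _ \<kappa>_def]) auto
    also have "\<dots> \<le> exp (- ((C * real n powr r) * \<kappa>\<^sup>2 / 16))"
      using T[OF elim(3)] by (auto intro!: divide_right_mono mult_right_mono)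
    finally show ?case .
  qed
  have lim: "((\<lambda>n. exp (- ((C * real n powr r) * \<kappa>\<^sup>2 / 16))) \<longlongrightarrow> 0) at_top"
    using \<open>0 < \<kappa>\<close> \<open>0 < C\<close> \<open>0 < r\<close> by real_asymp
  have "eventually (\<lambda>n. 0 \<le> type_II_error (M n) (xi n) (w n) \<delta> (c n) n) at_top"
    by (rule always_eventually) (simp add: type_II_error_def)
  then show ?thesis by (rule tendsto_sandwich[OF _ le tendsto_const lim])
qed

theorem theoremA1:
  fixes M :: "nat \<Rightarrow> 'a measure"
    and Pt xi :: "nat \<Rightarrow> nat \<Rightarrow> 'a \<Rightarrow> 'w::finite \<Rightarrow> real"
    and w :: "nat \<Rightarrow> nat \<Rightarrow> 'a \<Rightarrow> 'w"
    and eps Delta c :: "nat \<Rightarrow> real"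
    and p q \<delta> :: real
  assumes "0 \<le> p" and "0 \<le> q" and "q + 2 * p < 1"
    and "asymp_equiv_seq (\<lambda>n. real n powr (- p)) eps"
    and "\<forall>n. 0 \<le> eps n \<and> eps n \<le> 1"
    and "asymp_equiv_seq (\<lambda>n. real n powr (- q)) Delta"
    and "\<forall>n. gumbel_model (M n) (eps n) (Pt n) (xi n) (w n) n"
    and "\<forall>n. AE \<omega> in M n. \<forall>t\<in>{1..n}. Pt n t \<omega> \<in> P_Delta (Delta n)"
    and "0 < \<delta>"
    and "\<forall>n. 0 \<le> c n \<and> c n \<le> Delta n"
  shows "(\<lambda>n. type_I_error \<delta> (c n) n + type_II_error (M n) (xi n) (w n) \<delta> (c n) n)
           \<longlonglongrightarrow> 0"
proof -
  have "(\<lambda>n. type_II_error (M n) (xi n) (w n) \<delta> (c n) n) \<longlonglongrightarrow> 0"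
    by (rule type_II_error_tendsto_0[OF assms(3-9)]) (use assms(10) in simp)
  from tendsto_add[OF type_I_error_tendsto_0[OF assms(9)] this] show ?thesis by simp
qed

end
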